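(* Let $A$ be an $H^*$-Galois left $H$-module algebra over a finite dimensional Hopf algebra $H$ and let $E=\operatorname{End}_HA$ with its Hopf algebra structure. Let $x\in H$ be a left integral and $\alpha\in H^*$ the modular function on $H$. The linear function $\chi\in A^*$ defined by $\chi(a)=xa$ satisfies $$\chi(\varphi a)=\varepsilon(\varphi)\chi(a),\qquad \chi(ha)=\alpha(h)\chi(a)$$ for all $\varphi\in E$, $h\in H$ and $a\in A$. There exists an algebra automorphism of finite order $\theta:A\to A$ such that $$\chi(ba)=\chi(a\cdot\theta b)\qquad\text{for all }a,b\in A.$$ One has, in $\operatorname{End}A$, $$\theta\varphi\theta^{-1}=S^2(\varphi),\qquad \theta h\theta^{-1}=S^2(\alpha^{-1}\rightharpoonup h\leftharpoonup\alpha)$$ for all $\varphi\in E$ and $h\in H$.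
   Context: $k$ is a field; unadorned $\otimes$, $\operatorname{Hom}$, $\operatorname{End}$ are over $k$. $H$ is a finite dimensional Hopf algebra over $k$ with $\Delta h=\sum_{(h)}h'\otimes h''$, counit $\varepsilon$, antipode $S$ (the same symbols are used for $E$). Algebras are extensions of $k$ (so $A\neq0$, $k=k1_A\subset A$). A left $H$-module algebra $A$ is $H^*$-Galois if the map $\pi:A\otimes H\to\operatorname{End}A$, $\pi(a\otimes h)(b)=a(hb)$, is bijective; equivalently (known fact) if any one of the maps $\pi'(a\otimes h)(b)=(hb)a$ from $A\otimes H$ to $\operatorname{End}A$, $\gamma(a\otimes b)(h)=a(hb)$, $\gamma'(a\otimes b)(h)=(ha)b$ from $A\otimes A$ to $\operatorname{Hom}(H,A)\cong A\otimes H^*$ is bijective. Then $\dim A<\infty$ and $A^H=\{a:ha=\varepsilon(h)a\ \forall h\in H\}=k$. $E=\operatorname{End}_HA$ acts on $A$ from the left and carries the unique Hopf algebra structure making $A$ a left $E$-module algebra: $\varphi(ab)=\sum_{(\varphi)}\varphi'(a)\varphi''(b)$, $\varepsilon(\varphi)=\varphi(1)$. Both $H$ and $E$ are regarded as subalgebras of $\operatorname{End}A$ via their actions on $A$. A left integral is a nonzero $x\in H$ with $hx=\varepsilon(h)x$ for all $h\in H$; the modular function is the algebra homomorphism $\alpha:H\to k$ with $xh=\alpha(h)x$ for all $h$; it is a grouplike element of $H^*$ with inverse $\alpha^{-1}=\alpha\circ S$. Since $xA\subset A^H=k$, $\chi$ is well defined. For $\xi\in H^*$, $h\in H$: $\xi\rightharpoonup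 h=\sum_{(h)}\langle\xi,h''\rangle h'$ and $h\leftharpoonup\xi=\sum_{(h)}\langle\xi,h'\rangle h''$. *)

theory Defs
  imports Complex_Main "HOL-Library.Function_Algebras"
begin

definition linear_on ::
  "('k \<Rightarrow> 'u \<Rightarrow> 'u) \<Rightarrow> ('k \<Rightarrow> 'v \<Rightarrow> 'v) \<Rightarrow> 'u set \<Rightarrow> ('u::ab_group_add \<Rightarrow> 'v::ab_group_add) \<Rightarrow> bool"
where
  "linear_on s1 s2 C f \<longleftrightarrow>
     (\<forall>x\<in>C. \<forall>y\<in>C. f (x + y) = f x + f y) \<and> (\<forall>c. \<forall>x\<in>C. f (s1 c x) = s2 c (f x))"

definition bilinear_on ::
  "('k \<Rightarrow> 'u \<Rightarrow> 'u) \<Rightarrow> ('k \<Rightarrow> 'w \<Rightarrow> 'w) \<Rightarrow> ('k \<Rightarrow> 'v \<Rightarrow> 'v) \<Rightarrow> 'u set \<Rightarrow> 'w set \<Rightarrow>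
   ('u::ab_group_add \<Rightarrow> 'w::ab_group_add \<Rightarrow> 'v::ab_group_add) \<Rightarrow> bool"
where
  "bilinear_on s1 s2 s3 C D \<beta> \<longleftrightarrow>
     (\<forall>u\<in>C. linear_on s2 s3 D (\<beta> u)) \<and> (\<forall>w\<in>D. linear_on s1 s3 C (\<lambda>u. \<beta> u w))"

definition pointwise_scale :: "('k \<Rightarrow> 'v \<Rightarrow> 'v) \<Rightarrow> 'k \<Rightarrow> ('x \<Rightarrow> 'v) \<Rightarrow> ('x \<Rightarrow> 'v)" where
  "pointwise_scale s c f = (\<lambda>x. s c (f x))"

text \<open>
  The tensor product of two vector spaces is realised inside the dual of the space of bilinear
  forms: the pure tensor of \<open>u\<close> and \<open>w\<close> is evaluation of bilinear forms at \<open>(u, w)\<close>, and the tensor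
  product is the span of the pure tensors.  Over a field this is the usual tensor product (its
  universal property is \<open>tensor_lift_sum\<close> below), and for subspaces \<open>C\<close>, \<open>D\<close> the span of the pure
  tensors with entries in \<open>C\<close>, \<open>D\<close> is the tensor product of \<open>C\<close> and \<open>D\<close>.
\<close>

type_synonym ('u, 'w, 'k) tensor = "('u \<Rightarrow> 'w \<Rightarrow> 'k) \<Rightarrow> 'k"

definition tensor ::
  "('k::field \<Rightarrow> 'u::ab_group_add \<Rightarrow> 'u) \<Rightarrow> ('k \<Rightarrow> 'w::ab_group_add \<Rightarrow> 'w) \<Rightarrow> 'u \<Rightarrow> 'w \<Rightarrow> ('u, 'w, 'k) tensor"
where
  "tensor s1 s2 u w = (\<lambda>B. if bilinear_on s1 s2 (*) UNIV UNIV B then B u w else 0)"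

abbreviation tensor_scale :: "'k::field \<Rightarrow> ('u, 'w, 'k) tensor \<Rightarrow> ('u, 'w, 'k) tensor" where
  "tensor_scale \<equiv> pointwise_scale (*)"

definition tensor_space ::
  "('k::field \<Rightarrow> 'u::ab_group_add \<Rightarrow> 'u) \<Rightarrow> ('k \<Rightarrow> 'w::ab_group_add \<Rightarrow> 'w) \<Rightarrow> 'u set \<Rightarrow> 'w set \<Rightarrow>
   ('u, 'w, 'k) tensor set"
where
  "tensor_space s1 s2 C D = module.span tensor_scale {tensor s1 s2 u w |u w. u \<in> C \<and> w \<in> D}"

text \<open>
  \<open>tensor_lift s1 s2 C D \<beta>\<close> is the linear map on the tensor product of \<open>C\<close> and \<open>D\<close> induced by a map
  \<open>\<beta>\<close> that is bilinear on \<open>C\<close>, \<open>D\<close>.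
\<close>

definition tensor_lift ::
  "('k::field \<Rightarrow> 'u::ab_group_add \<Rightarrow> 'u) \<Rightarrow> ('k \<Rightarrow> 'w::ab_group_add \<Rightarrow> 'w) \<Rightarrow> 'u set \<Rightarrow> 'w set \<Rightarrow>
   ('u \<Rightarrow> 'w \<Rightarrow> 'v::ab_group_add) \<Rightarrow> ('u, 'w, 'k) tensor \<Rightarrow> 'v"
where
  "tensor_lift s1 s2 C D \<beta> t =
     (THE y. \<exists>ps. set ps \<subseteq> C \<times> D \<and> t = (\<Sum>(u, w)\<leftarrow>ps. tensor s1 s2 u w) \<and> y = (\<Sum>(u, w)\<leftarrow>ps. \<beta> u w))"

lemma linear_on_UNIV_iff:
  assumes "vector_space s1" "vector_space s2"
  shows "linear_on s1 s2 UNIV f \<longleftrightarrow> Vector_Spaces.linear s1 s2 f"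
  using assms by (auto simp: linear_on_def Vector_Spaces.linear_def module_hom_def
      module_hom_axioms_def vector_space_def module_def)

lemma vector_space_field: "vector_space ((*) :: 'k::field \<Rightarrow> 'k \<Rightarrow> 'k)"
  by unfold_locales (auto simp: algebra_simps)

lemma vector_space_pointwise:
  assumes "vector_space s"
  shows "vector_space (pointwise_scale s)"
  using assms by (auto simp: vector_space_def pointwise_scale_def fun_eq_iff)

lemma sum_list_tensor_apply:
  assumes "bilinear_on s1 s2 (*) UNIV UNIV B"
  shows "(\<Sum>(u, w)\<leftarrow>ps. tensor s1 s2 u w) B = (\<Sum>(u, w)\<leftarrow>ps. B u w)"
  using assms by (induction ps) (auto simp: tensor_def)

lemma tensor_relation:
  fixes s1 :: "'k::field \<Rightarrow> 'u::ab_group_add \<Rightarrow> 'u" and s2 :: "'k \<Rightarrow> 'w::ab_group_add \<Rightarrow> 'w"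
    and s3 :: "'k \<Rightarrow> 'v::ab_group_add \<Rightarrow> 'v"
  assumes vs: "vector_space s1" "vector_space s2" "vector_space s3"
    and C: "module.subspace s1 C" and D: "module.subspace s2 D"
    and \<beta>: "bilinear_on s1 s2 s3 C D \<beta>"
    and ps: "set ps \<subseteq> C \<times> D" and qs: "set qs \<subseteq> C \<times> D"
    and eq: "(\<Sum>(u, w)\<leftarrow>ps. tensor s1 s2 u w) = (\<Sum>(u, w)\<leftarrow>qs. tensor s1 s2 u w)"
  shows "(\<Sum>(u, w)\<leftarrow>ps. \<beta> u w) = (\<Sum>(u, w)\<leftarrow>qs. \<beta> u w)"
proof (rule ccontr)
  assume neq: "\<not> ?thesis"
  define d where "d = (\<Sum>(u, w)\<leftarrow>ps. \<beta> u w) - (\<Sum>(u, w)\<leftarrow>qs. \<beta> u w)"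
  have d: "d \<noteq> 0" using neq by (simp add: d_def)
  interpret V1: vector_space s1 by fact
  interpret V2: vector_space s2 by fact
  interpret V3: vector_space s3 by fact
  interpret K: vector_space "(*) :: 'k \<Rightarrow> 'k \<Rightarrow> 'k" by (rule vector_space_field)
  interpret P1: vector_space_pair s1 s1 ..
  interpret P2: vector_space_pair s2 s2 ..
  interpret P3: vector_space_pair s3 "(*) :: 'k \<Rightarrow> 'k \<Rightarrow> 'k" ..
  have "Vector_Spaces.linear s1 s1 id" by (rule V1.linear_id)
  then obtain p where p: "range p \<subseteq> C" "Vector_Spaces.linear s1 s1 p" "\<forall>v\<in>C. p v = v"
    using P1.linear_exists_left_inverse_on[of id C] C by auto
  have "Vector_Spaces.linear s2 s2 id" by (rule V2.linear_id)
  then obtain q where q: "range q \<subseteq> D" "Vector_Spaces.linear s2 s2 q" "\<forall>v\<in>D. q v = v"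
    using P2.linear_exists_left_inverse_on[of id D] D by auto
  have "\<not> V3.dependent {d}" using d by simp
  then obtain \<xi> where \<xi>: "Vector_Spaces.linear s3 (*) \<xi>" "\<xi> d = 1"
    using P3.linear_independent_extend[of "{d}" "\<lambda>_. 1"] by auto
  interpret \<xi>: Vector_Spaces.linear s3 "(*)" \<xi> by fact
  interpret p: Vector_Spaces.linear s1 s1 p by fact
  interpret q: Vector_Spaces.linear s2 s2 q by fact
  define B where "B = (\<lambda>u w. \<xi> (\<beta> (p u) (q w)))"
  have pC: "p u \<in> C" and qD: "q w \<in> D" for u w using p q by auto
  have B: "bilinear_on s1 s2 (*) UNIV UNIV B"
    using \<beta> pC qD
    by (auto simp: bilinear_on_def linear_on_def B_def p.add p.scale q.add q.scale \<xi>.add \<xi>.scale)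
  have sum: "(\<Sum>(u, w)\<leftarrow>rs. B u w) = \<xi> (\<Sum>(u, w)\<leftarrow>rs. \<beta> u w)" if "set rs \<subseteq> C \<times> D" for rs
    using that p(3) q(3) by (induction rs) (auto simp: B_def \<xi>.add)
  have "\<xi> d = (\<Sum>(u, w)\<leftarrow>ps. B u w) - (\<Sum>(u, w)\<leftarrow>qs. B u w)"
    using ps qs by (simp add: sum d_def \<xi>.diff)
  also have "\<dots> = 0"
    using sum_list_tensor_apply[OF B, of ps] sum_list_tensor_apply[OF B, of qs] eq by simp
  finally show False using \<xi>(2) by simp
qed

lemma tensor_lift_sum:
  fixes s1 :: "'k::field \<Rightarrow> 'u::ab_group_add \<Rightarrow> 'u" and s2 :: "'k \<Rightarrow> 'w::ab_group_add \<Rightarrow> 'w"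
    and s3 :: "'k \<Rightarrow> 'v::ab_group_add \<Rightarrow> 'v"
  assumes "vector_space s1" "vector_space s2" "vector_space s3"
    and "module.subspace s1 C" "module.subspace s2 D"
    and "bilinear_on s1 s2 s3 C D \<beta>"
    and "set ps \<subseteq> C \<times> D"
  shows "tensor_lift s1 s2 C D \<beta> (\<Sum>(u, w)\<leftarrow>ps. tensor s1 s2 u w) = (\<Sum>(u, w)\<leftarrow>ps. \<beta> u w)"
  unfolding tensor_lift_def
proof (rule the_equality)
  show "\<exists>qs. set qs \<subseteq> C \<times> D \<and>
      (\<Sum>(u, w)\<leftarrow>ps. tensor s1 s2 u w) = (\<Sum>(u, w)\<leftarrow>qs. tensor s1 s2 u w) \<and>
      (\<Sum>(u, w)\<leftarrow>ps. \<beta> u w) = (\<Sum>(u, w)\<leftarrow>qs. \<beta> u w)"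
    using assms(7) by blast
next
  fix y
  assume "\<exists>qs. set qs \<subseteq> C \<times> D \<and>
      (\<Sum>(u, w)\<leftarrow>ps. tensor s1 s2 u w) = (\<Sum>(u, w)\<leftarrow>qs. tensor s1 s2 u w) \<and>
      y = (\<Sum>(u, w)\<leftarrow>qs. \<beta> u w)"
  then show "y = (\<Sum>(u, w)\<leftarrow>ps. \<beta> u w)"
    using tensor_relation[OF assms] by metis
qed

lemma tensor_space_elim:
  fixes s1 :: "'k::field \<Rightarrow> 'u::ab_group_add \<Rightarrow> 'u" and s2 :: "'k \<Rightarrow> 'w::ab_group_add \<Rightarrow> 'w"
  assumes "vector_space s1" "module.subspace s1 C" "t \<in> tensor_space s1 s2 C D"
  obtains ps where "set ps \<subseteq> C \<times> D" "t = (\<Sum>(u, w)\<leftarrow>ps. tensor s1 s2 u w)"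
proof -
  interpret V1: vector_space s1 by fact
  interpret T: vector_space "tensor_scale :: 'k \<Rightarrow> ('u, 'w, 'k) tensor \<Rightarrow> _"
    by (rule vector_space_pointwise[OF vector_space_field])
  have scale: "tensor_scale c (tensor s1 s2 u w) = tensor s1 s2 (s1 c u) w" for c u w
    by (auto simp: pointwise_scale_def tensor_def bilinear_on_def linear_on_def fun_eq_iff)
  have "\<exists>ps. set ps \<subseteq> C \<times> D \<and> t = (\<Sum>(u, w)\<leftarrow>ps. tensor s1 s2 u w)"
    using assms(3) unfolding tensor_space_def
  proof (induction rule: T.span_induct_alt)
    case base
    show ?case by (rule exI[of _ "[]"]) simp
  next
    case (step c x y)
    then obtain u w ps where "u \<in> C" "w \<in> D" "x = tensor s1 s2 u w"
      "set ps \<subseteq> C \<times> D" "y = (\<Sum>(u, w)\<leftarrow>ps. tensor s1 s2 u w)" by auto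
    then show ?case
      using V1.subspace_scale[OF assms(2)] by (intro exI[of _ "(s1 c u, w) # ps"]) (auto simp: scale)
  qed
  then show ?thesis using that by blast
qed

text \<open>
  Nonzero associative unital algebras over the field \<open>'k\<close>, carried by a subspace of an ambient vector
  space, so that subalgebras of an endomorphism algebra are covered.
\<close>

locale k_algebra = vector_space scale
  for scale :: "'k::field \<Rightarrow> 'h::ab_group_add \<Rightarrow> 'h" +
  fixes C :: "'h set" and mult :: "'h \<Rightarrow> 'h \<Rightarrow> 'h" (infixl \<open>\<star>\<close> 70) and unit :: 'h (\<open>\<one>\<close>)
  assumes subspace_C: "subspace C"
    and unit_closed: "\<one> \<in> C"
    and mult_closed: "g \<in> C \<Longrightarrow> h \<in> C \<Longrightarrow> g \<star> h \<in> C"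
    and mult_bilinear: "bilinear_on scale scale scale C C (\<star>)"
    and mult_assoc: "f \<in> C \<Longrightarrow> g \<in> C \<Longrightarrow> h \<in> C \<Longrightarrow> (f \<star> g) \<star> h = f \<star> (g \<star> h)"
    and unit_left: "h \<in> C \<Longrightarrow> \<one> \<star> h = h"
    and unit_right: "h \<in> C \<Longrightarrow> h \<star> \<one> = h"
    and unit_nonzero: "\<one> \<noteq> 0"

text \<open>
  \<open>sweedler s C \<Delta> \<beta> h\<close> is the Sweedler sum of \<open>\<beta> h' h''\<close> over the coproduct of \<open>h\<close>.
\<close>

definition sweedler ::
  "('k::field \<Rightarrow> 'h::ab_group_add \<Rightarrow> 'h) \<Rightarrow> 'h set \<Rightarrow> ('h \<Rightarrow> ('h, 'h, 'k) tensor) \<Rightarrow>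
   ('h \<Rightarrow> 'h \<Rightarrow> 'v::ab_group_add) \<Rightarrow> 'h \<Rightarrow> 'v"
where
  "sweedler s C \<Delta> \<beta> h = tensor_lift s s C C \<beta> (\<Delta> h)"

locale hopf_algebra = k_algebra scale C mult unit
  for scale :: "'k::field \<Rightarrow> 'h::ab_group_add \<Rightarrow> 'h" and C :: "'h set"
    and mult :: "'h \<Rightarrow> 'h \<Rightarrow> 'h" (infixl \<open>\<star>\<close> 70) and unit :: 'h (\<open>\<one>\<close>) +
  fixes \<Delta> :: "'h \<Rightarrow> ('h, 'h, 'k) tensor" and \<epsilon> :: "'h \<Rightarrow> 'k" and S :: "'h \<Rightarrow> 'h"
  assumes comult_closed: "h \<in> C \<Longrightarrow> \<Delta> h \<in> tensor_space scale scale C C"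
    and comult_linear: "linear_on scale tensor_scale C \<Delta>"
    and counit_linear: "linear_on scale (*) C \<epsilon>"
    and coassoc: "h \<in> C \<Longrightarrow>
      sweedler scale C \<Delta>
        (\<lambda>u v. sweedler scale C \<Delta>
          (\<lambda>u' u''. tensor scale tensor_scale u' (tensor scale scale u'' v)) u) h
      = sweedler scale C \<Delta> (\<lambda>u v. tensor scale tensor_scale u (\<Delta> v)) h"
    and counit_left: "h \<in> C \<Longrightarrow> sweedler scale C \<Delta> (\<lambda>u v. scale (\<epsilon> u) v) h = h"
    and counit_right: "h \<in> C \<Longrightarrow> sweedler scale C \<Delta> (\<lambda>u v. scale (\<epsilon> v) u) h = h"
    and comult_mult: "g \<in> C \<Longrightarrow> h \<in> C \<Longrightarrow>
      \<Delta> (g \<star> h) = sweedler scale C \<Delta>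
        (\<lambda>u v. sweedler scale C \<Delta> (\<lambda>u' v'. tensor scale scale (u \<star> u') (v \<star> v')) h) g"
    and comult_unit: "\<Delta> \<one> = tensor scale scale \<one> \<one>"
    and counit_mult: "g \<in> C \<Longrightarrow> h \<in> C \<Longrightarrow> \<epsilon> (g \<star> h) = \<epsilon> g * \<epsilon> h"
    and counit_unit: "\<epsilon> \<one> = 1"
    and antipode_closed: "h \<in> C \<Longrightarrow> S h \<in> C"
    and antipode_linear: "linear_on scale scale C S"
    and antipode_left: "h \<in> C \<Longrightarrow> sweedler scale C \<Delta> (\<lambda>u v. S u \<star> v) h = scale (\<epsilon> h) \<one>"
    and antipode_right: "h \<in> C \<Longrightarrow> sweedler scale C \<Delta> (\<lambda>u v. u \<star> S v) h = scale (\<epsilon> h) \<one>"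

locale module_algebra = hopf_algebra scale C mult unit \<Delta> \<epsilon> S + A: k_algebra scaleA UNIV "(*)" 1
  for scale :: "'k::field \<Rightarrow> 'h::ab_group_add \<Rightarrow> 'h" and C :: "'h set"
    and mult :: "'h \<Rightarrow> 'h \<Rightarrow> 'h" (infixl \<open>\<star>\<close> 70) and unit :: 'h (\<open>\<one>\<close>)
    and \<Delta> :: "'h \<Rightarrow> ('h, 'h, 'k) tensor" and \<epsilon> :: "'h \<Rightarrow> 'k" and S :: "'h \<Rightarrow> 'h"
    and scaleA :: "'k \<Rightarrow> 'a::ring_1 \<Rightarrow> 'a" +
  fixes act :: "'h \<Rightarrow> 'a \<Rightarrow> 'a"  (infixr \<open>\<cdot>\<close> 75)
  assumes act_bilinear: "bilinear_on scale scaleA scaleA C UNIV (\<cdot>)"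
    and act_unit: "\<one> \<cdot> a = a"
    and act_mult: "g \<in> C \<Longrightarrow> h \<in> C \<Longrightarrow> (g \<star> h) \<cdot> a = g \<cdot> h \<cdot> a"
    and act_times: "h \<in> C \<Longrightarrow> h \<cdot> (a * b) = sweedler scale C \<Delta> (\<lambda>u v. (u \<cdot> a) * (v \<cdot> b)) h"
    and act_one: "h \<in> C \<Longrightarrow> h \<cdot> 1 = scaleA (\<epsilon> h) 1"

definition Endo :: "('k::field \<Rightarrow> 'a::ab_group_add \<Rightarrow> 'a) \<Rightarrow> ('a \<Rightarrow> 'a) set" where
  "Endo scaleA = {f. Vector_Spaces.linear scaleA scaleA f}"

definition module_Endo ::
  "('k::field \<Rightarrow> 'a::ab_group_add \<Rightarrow> 'a) \<Rightarrow> 'h set \<Rightarrow> ('h \<Rightarrow> 'a \<Rightarrow> 'a) \<Rightarrow> ('a \<Rightarrow> 'a) set"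
where
  "module_Endo scaleA C act = {f \<in> Endo scaleA. \<forall>h\<in>C. \<forall>a. f (act h a) = act h (f a)}"

text \<open>
  Being Galois for the dual Hopf algebra, i.e. bijectivity of the canonical map from the tensor
  product of \<open>A\<close> and the Hopf algebra to the linear endomorphisms of \<open>A\<close>.
\<close>

locale dual_galois_module_algebra = module_algebra scale C mult unit \<Delta> \<epsilon> S scaleA act
  for scale :: "'k::field \<Rightarrow> 'h::ab_group_add \<Rightarrow> 'h" and C :: "'h set"
    and mult :: "'h \<Rightarrow> 'h \<Rightarrow> 'h" (infixl \<open>\<star>\<close> 70) and unit :: 'h (\<open>\<one>\<close>)
    and \<Delta> :: "'h \<Rightarrow> ('h, 'h, 'k) tensor" and \<epsilon> :: "'h \<Rightarrow> 'k" and S :: "'h \<Rightarrow> 'h"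
    and scaleA :: "'k \<Rightarrow> 'a::ring_1 \<Rightarrow> 'a"
    and act :: "'h \<Rightarrow> 'a \<Rightarrow> 'a"  (infixr \<open>\<cdot>\<close> 75) +
  assumes finite_dimensional: "\<exists>B. finite B \<and> span B = C"
    and galois: "bij_betw (tensor_lift scaleA scale UNIV C (\<lambda>a h. \<lambda>b. a * (h \<cdot> b)))
      (tensor_space scaleA scale UNIV C) (Endo scaleA)"

definition left_integral ::
  "('k::field \<Rightarrow> 'h::ab_group_add \<Rightarrow> 'h) \<Rightarrow> 'h set \<Rightarrow> ('h \<Rightarrow> 'h \<Rightarrow> 'h) \<Rightarrow> ('h \<Rightarrow> 'k) \<Rightarrow> 'h \<Rightarrow> bool"
where
  "left_integral scale C mult \<epsilon> x \<longleftrightarrow> x \<in> C \<and> x \<noteq> 0 \<and> (\<forall>h\<in>C. mult h x = scale (\<epsilon> h) x)"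

definition modular_function ::
  "('k::field \<Rightarrow> 'h::ab_group_add \<Rightarrow> 'h) \<Rightarrow> 'h set \<Rightarrow> ('h \<Rightarrow> 'h \<Rightarrow> 'h) \<Rightarrow> 'h \<Rightarrow> 'h \<Rightarrow> ('h \<Rightarrow> 'k) \<Rightarrow> bool"
where
  "modular_function scale C mult unit x \<alpha> \<longleftrightarrow>
     linear_on scale (*) C \<alpha> \<and> \<alpha> unit = 1 \<and> (\<forall>g\<in>C. \<forall>h\<in>C. \<alpha> (mult g h) = \<alpha> g * \<alpha> h) \<and>
     (\<forall>h\<in>C. mult x h = scale (\<alpha> h) x)"

definition hit_left ::
  "('k::field \<Rightarrow> 'h::ab_group_add \<Rightarrow> 'h) \<Rightarrow> 'h set \<Rightarrow> ('h \<Rightarrow> ('h, 'h, 'k) tensor) \<Rightarrow>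
   ('h \<Rightarrow> 'k) \<Rightarrow> 'h \<Rightarrow> 'h"
where
  "hit_left scale C \<Delta> \<xi> h = sweedler scale C \<Delta> (\<lambda>u v. scale (\<xi> v) u) h"

definition hit_right ::
  "('k::field \<Rightarrow> 'h::ab_group_add \<Rightarrow> 'h) \<Rightarrow> 'h set \<Rightarrow> ('h \<Rightarrow> ('h, 'h, 'k) tensor) \<Rightarrow>
   'h \<Rightarrow> ('h \<Rightarrow> 'k) \<Rightarrow> 'h"
where
  "hit_right scale C \<Delta> h \<xi> = sweedler scale C \<Delta> (\<lambda>u v. scale (\<xi> u) v) h"

text \<open>
  The scalars \<open>'k\<close> are identified with the scalar multiples of the unit of \<open>A\<close>.
\<close>

definition integral_functional ::
  "('k::field \<Rightarrow> 'a::ring_1 \<Rightarrow> 'a) \<Rightarrow> ('h \<Rightarrow> 'a \<Rightarrow> 'a) \<Rightarrow> 'h \<Rightarrow> 'a \<Rightarrow> 'k"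
where
  "integral_functional scaleA act x a = (THE c. act x a = scaleA c 1)"

definition algebra_automorphism :: "('k::field \<Rightarrow> 'a::ring_1 \<Rightarrow> 'a) \<Rightarrow> ('a \<Rightarrow> 'a) \<Rightarrow> bool" where
  "algebra_automorphism scaleA \<theta> \<longleftrightarrow>
     bij \<theta> \<and> Vector_Spaces.linear scaleA scaleA \<theta> \<and> (\<forall>a b. \<theta> (a * b) = \<theta> a * \<theta> b) \<and> \<theta> 1 = 1"

end

theory Submission
  imports Defs
begin

text \<open>
  By bijectivity of the canonical map, every linear endomorphism of \<open>A\<close> is a sum of maps
  \<open>b \<mapsto> a (h b)\<close>, and there are no nontrivial relations among such maps.  The integral \<open>x\<close> sends \<open>A\<close>
  to invariants.  Right multiplication by an invariant commutes with every endomorphism, so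
  invariants are scalars and \<open>\<chi>\<close> is defined; its behaviour under \<open>E\<close> and \<open>H\<close> follows because \<open>E\<close>
  commutes with \<open>x\<close> and because \<open>x h = \<alpha>(h) x\<close>.

  In every module algebra \<open>(h b) a = \<Sum> h' (b (S(h'') a))\<close> (\<open>act_times_transfer\<close>).  Applying \<open>\<chi>\<close> yields
  \<open>\<chi>((h b) a) = \<chi>(b (\<sigma>(h) a))\<close> with \<open>\<sigma>(h) = S(h \<leftharpoonup> \<alpha>)\<close>, and the same identity for \<open>E\<close> yields
  \<open>\<chi>(\<phi>(b) a) = \<chi>(b S(\<phi>)(a))\<close>.  If \<open>\<chi>(b a) = \<chi>(a \<theta>(b))\<close>, then moving an operator around the form
  twice gives \<open>\<theta> \<phi> = S\<^sup>2(\<phi>) \<theta>\<close> and \<open>\<theta> h = \<sigma>\<^sup>2(h) \<theta>\<close>, and \<open>\<sigma>\<^sup>2(h)\<close> is \<open>S\<^sup>2\<close> of the twist of \<open>h\<close> by \<open>\<alpha>\<close>.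

  Such a \<open>\<theta>\<close> exists because the form \<open>(c, a) \<mapsto> \<chi>(c a)\<close> is nondegenerate.  As \<open>\<sigma>\<close> is bijective, the
  functionals \<open>\<chi>(c -)\<close> are stable under composition with all maps \<open>b \<mapsto> a (h b)\<close>, hence with all
  endomorphisms, and so they exhaust the dual of \<open>A\<close>; an infinite-dimensional space cannot
  parametrize its dual linearly, so \<open>A\<close> is finite dimensional.  If \<open>\<chi>(c a) = 0\<close> for all \<open>a\<close>, then
  \<open>\<Sum> (x' c) \<otimes> x'' = 0\<close>, and \<open>c = 0\<close> follows because \<open>1\<close> has the form \<open>\<Sum> \<psi>(x'') x'\<close>.

  For the finite order, Radford's formula for \<open>S\<^sup>4\<close> is needed, in the form
  \<open>\<omega>(h) g = g \<sigma>\<^sup>4(h)\<close> (\<open>\<omega>_gl\<close>), where \<open>\<omega>\<close> is the twist by \<open>\<alpha>\<close> and \<open>g\<close> is the distinguished grouplike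
  element.  It results from computing \<open>\<Sum> \<psi>(S(h) x') x''\<close> in two ways.  Distinct multiplicative maps
  are linearly independent, so in finite dimension \<open>\<alpha>\<close> and \<open>g\<close> have finite order, and some power of
  \<open>\<theta>\<close> commutes with \<open>H\<close>.  The maps commuting with \<open>H\<close> that are independent over \<open>k\<close> remain independent
  over \<open>A\<close>, and the same principle shows that an algebra automorphism commuting with \<open>H\<close> has finite
  order.
\<close>

section \<open>Linear and multiplicative maps\<close>

lemma linear_onI:
  assumes "\<And>x y. x \<in> C \<Longrightarrow> y \<in> C \<Longrightarrow> f (x + y) = f x + f y"
    and "\<And>c x. x \<in> C \<Longrightarrow> f (s1 c x) = s2 c (f x)"
  shows "linear_on s1 s2 C f"
  using assms by (simp add: linear_on_def)

lemma bilinear_onI: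
  assumes "\<And>u v v'. u \<in> C \<Longrightarrow> v \<in> D \<Longrightarrow> v' \<in> D \<Longrightarrow> \<beta> u (v + v') = \<beta> u v + \<beta> u v'"
    and "\<And>u u' v. u \<in> C \<Longrightarrow> u' \<in> C \<Longrightarrow> v \<in> D \<Longrightarrow> \<beta> (u + u') v = \<beta> u v + \<beta> u' v"
    and "\<And>c u v. u \<in> C \<Longrightarrow> v \<in> D \<Longrightarrow> \<beta> u (s2 c v) = s3 c (\<beta> u v)"
    and "\<And>c u v. u \<in> C \<Longrightarrow> v \<in> D \<Longrightarrow> \<beta> (s1 c u) v = s3 c (\<beta> u v)"
  shows "bilinear_on s1 s2 s3 C D \<beta>"
  using assms by (simp add: bilinear_on_def linear_on_def)

lemma bilinear_onD:
  assumes "bilinear_on s1 s2 s3 C D \<beta>" "u \<in> C" "v \<in> D"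
  shows "v' \<in> D \<Longrightarrow> \<beta> u (v + v') = \<beta> u v + \<beta> u v'"
    and "u' \<in> C \<Longrightarrow> \<beta> (u + u') v = \<beta> u v + \<beta> u' v"
    and "\<beta> u (s2 c v) = s3 c (\<beta> u v)"
    and "\<beta> (s1 c u) v = s3 c (\<beta> u v)"
  using assms by (simp_all add: bilinear_on_def linear_on_def)

definition trilinear_on where
  "trilinear_on s t C \<beta> \<longleftrightarrow>
     (\<forall>u\<in>C. bilinear_on s s t C C (\<beta> u)) \<and> (\<forall>w\<in>C. bilinear_on s s t C C (\<lambda>u v. \<beta> u v w))"

lemma trilinear_onI:
  assumes "\<And>u v w w'. u \<in> C \<Longrightarrow> v \<in> C \<Longrightarrow> w \<in> C \<Longrightarrow> w' \<in> C \<Longrightarrow> \<beta> u v (w + w') = \<beta> u v w + \<beta> u v w'"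
    and "\<And>u v v' w. u \<in> C \<Longrightarrow> v \<in> C \<Longrightarrow> v' \<in> C \<Longrightarrow> w \<in> C \<Longrightarrow> \<beta> u (v + v') w = \<beta> u v w + \<beta> u v' w"
    and "\<And>u u' v w. u \<in> C \<Longrightarrow> u' \<in> C \<Longrightarrow> v \<in> C \<Longrightarrow> w \<in> C \<Longrightarrow> \<beta> (u + u') v w = \<beta> u v w + \<beta> u' v w"
    and "\<And>c u v w. u \<in> C \<Longrightarrow> v \<in> C \<Longrightarrow> w \<in> C \<Longrightarrow> \<beta> u v (s c w) = t c (\<beta> u v w)"
    and "\<And>c u v w. u \<in> C \<Longrightarrow> v \<in> C \<Longrightarrow> w \<in> C \<Longrightarrow> \<beta> u (s c v) w = t c (\<beta> u v w)"
    and "\<And>c u v w. u \<in> C \<Longrightarrow> v \<in> C \<Longrightarrow> w \<in> C \<Longrightarrow> \<beta> (s c u) v w = t c (\<beta> u v w)"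
  shows "trilinear_on s t C \<beta>"
  using assms by (simp add: trilinear_on_def bilinear_on_def linear_on_def)

lemma sum_list_case_prod_scale:
  assumes "vector_space s"
  shows "(\<Sum>(u, v)\<leftarrow>ps. s c (\<beta> u v)) = s c (\<Sum>(u, v)\<leftarrow>ps. \<beta> u v)"
proof -
  interpret vector_space s by fact
  show ?thesis by (induction ps) (auto simp: scale_right_distrib)
qed

lemma sum_list_concat: "sum_list (concat xss) = sum_list (map sum_list xss)"
  by (induction xss) auto

lemma (in vector_space) finite_basis_coordinates:
  assumes "finite B" "span B = UNIV"
  obtains Bs c where "finite_dimensional_vector_space scale Bs"
    and "\<forall>b. linear_on scale (*) UNIV (c b)" and "\<forall>v. v = (\<Sum>b\<in>Bs. c b v *s b)"
proof -
  obtain Bs where Bs: "Bs \<subseteq> B" "independent Bs" "B \<subseteq> span Bs"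
    using maximal_independent_subset[of B] by metis
  have "span Bs = UNIV" using Bs(3) assms(2) by (metis span_minimal subspace_span top.extremum_uniqueI)
  moreover have "finite Bs" using Bs(1) assms(1) finite_subset by blast
  ultimately have fd: "finite_dimensional_vector_space scale Bs"
    using Bs(2) by unfold_locales auto
  show thesis
  proof (rule that[OF fd])
    show "\<forall>b. linear_on scale (*) UNIV (\<lambda>v. representation Bs v b)"
      using representation_add[OF Bs(2)] representation_scale[OF Bs(2)] \<open>span Bs = UNIV\<close>
      by (intro allI linear_onI) auto
    show "\<forall>v. v = (\<Sum>b\<in>Bs. representation Bs v b *s b)"
      using sum_representation_eq[OF Bs(2), of _ Bs] \<open>finite Bs\<close> \<open>span Bs = UNIV\<close> by auto
  qed
qed

lemma (in vector_space) injective_linear_surjective: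
  assumes "finite B" "span B = UNIV" and f: "linear_on scale scale UNIV f"
    and inj: "\<And>v. f v = 0 \<Longrightarrow> v = 0"
  shows "bij f"
proof -
  obtain Bs where "finite_dimensional_vector_space scale Bs"
    using finite_basis_coordinates[OF assms(1,2)] by metis
  then interpret F: finite_dimensional_vector_space scale Bs .
  have lin: "Vector_Spaces.linear scale scale f"
    using f linear_on_UNIV_iff[OF vector_space_axioms vector_space_axioms] by blast
  then interpret f: Vector_Spaces.linear scale scale f .
  have "inj f" using inj f.inj_iff_eq_0 by blast
  then show ?thesis using F.linear_inj_imp_surj[OF lin] by (simp add: bij_def)
qed

lemma (in vector_space) functional_separates:
  assumes "v \<noteq> 0"
  obtains f where "linear_on scale (*) UNIV f" "f v = 1"
proof -
  interpret P: vector_space_pair scale "(*) :: 'a \<Rightarrow> 'a \<Rightarrow> 'a"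
    using vector_space_axioms vector_space_field by (rule vector_space_pair.intro)
  obtain f where "Vector_Spaces.linear scale (*) f" "f v = 1"
    using P.linear_independent_extend[of "{v}" "\<lambda>_. 1"] assms by auto
  then show thesis
    using that linear_on_UNIV_iff[OF vector_space_axioms vector_space_field] by blast
qed

lemma (in vector_space) zero_if_functionals_vanish:
  "(\<And>f. linear_on scale (*) UNIV f \<Longrightarrow> f v = 0) \<Longrightarrow> v = 0"
  using functional_separates by (metis zero_neq_one)

lemma sum_apply: "(\<Sum>a\<in>A. f a) y = (\<Sum>a\<in>A. f a y)"
  by (induction A rule: infinite_finite_induct) auto

text \<open>
  Maps between finite-dimensional spaces lie in the span of the finitely many matrix units.
\<close>

lemma finite_span_linear_maps:
  fixes s :: "'k::field \<Rightarrow> 'u::ab_group_add \<Rightarrow> 'u" and t :: "'k \<Rightarrow> 'v::ab_group_add \<Rightarrow> 'v"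
  assumes s: "vector_space s" and t: "vector_space t"
    and fin: "finite B" "module.span s B = UNIV" "finite B'" "module.span t B' = UNIV"
  obtains F where "finite F" "\<And>f. linear_on s t UNIV f \<Longrightarrow> f \<in> module.span (pointwise_scale t) F"
proof -
  interpret s: vector_space s by fact
  interpret t: vector_space t by fact
  interpret p: vector_space "pointwise_scale t :: 'k \<Rightarrow> ('u \<Rightarrow> 'v) \<Rightarrow> _"
    by (rule vector_space_pointwise[OF t])
  obtain Bs c where Bs: "finite_dimensional_vector_space s Bs"
    and "\<forall>b. linear_on s (*) UNIV (c b)" and rep: "\<forall>v. v = (\<Sum>b\<in>Bs. s (c b v) b)"
    using s.finite_basis_coordinates[OF fin(1,2)] .
  obtain Bs' c' where Bs': "finite_dimensional_vector_space t Bs'"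
    and "\<forall>b. linear_on t (*) UNIV (c' b)" and rep': "\<forall>v. v = (\<Sum>b\<in>Bs'. t (c' b v) b)"
    using t.finite_basis_coordinates[OF fin(3,4)] .
  define F where "F = (\<lambda>(b, b') u. t (c b u) b') ` (Bs \<times> Bs')"
  have "finite Bs" "finite Bs'"
    using Bs Bs' by (simp_all add: finite_dimensional_vector_space_def finite_dimensional_vector_space_axioms_def)
  then have "finite F" by (simp add: F_def)
  moreover have "f \<in> p.span F" if f: "linear_on s t UNIV f" for f
  proof -
    interpret f: Vector_Spaces.linear s t f
      using f linear_on_UNIV_iff[OF s t] by blast
    have "f u = (\<Sum>b\<in>Bs. \<Sum>b'\<in>Bs'. pointwise_scale t (c' b' (f b)) (\<lambda>u. t (c b u) b') u)" for u
    proof -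
      have "f u = (\<Sum>b\<in>Bs. t (c b u) (f b))"
      proof -
        have "f u = f (\<Sum>b\<in>Bs. s (c b u) b)" by (rule arg_cong[OF rep[rule_format]])
        then show ?thesis by (simp add: f.sum f.scale)
      qed
      also have "\<dots> = (\<Sum>b\<in>Bs. \<Sum>b'\<in>Bs'. t (c b u) (t (c' b' (f b)) b'))"
      proof (rule sum.cong[OF refl])
        fix b
        have "t (c b u) (f b) = t (c b u) (\<Sum>b'\<in>Bs'. t (c' b' (f b)) b')" by (rule arg_cong[OF rep'[rule_format]])
        then show "t (c b u) (f b) = (\<Sum>b'\<in>Bs'. t (c b u) (t (c' b' (f b)) b'))"
          by (simp only: t.scale_sum_right)
      qed
      finally show ?thesis by (simp add: pointwise_scale_def mult.commute)
    qed
    then have "f u = (\<Sum>b\<in>Bs. \<Sum>b'\<in>Bs'. pointwise_scale t (c' b' (f b)) (\<lambda>u. t (c b u) b')) u" for u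
      unfolding sum_apply .
    then have "f = (\<Sum>b\<in>Bs. \<Sum>b'\<in>Bs'. pointwise_scale t (c' b' (f b)) (\<lambda>u. t (c b u) b'))"
      by (rule ext)
    also have "\<dots> \<in> p.span F"
      by (intro p.span_sum p.span_scale p.span_base) (auto simp: F_def)
    finally show ?thesis .
  qed
  ultimately show thesis using that by blast
qed

text \<open>
  Dedekind's independence argument for maps into a noncommutative algebra.  From a relation
  \<open>\<psi> = \<Sum> c\<^sub>\<phi> \<phi>\<close>, evaluating at \<open>m y z\<close> gives \<open>\<Sum> c\<^sub>\<phi> (\<phi> y - \<psi> y) \<phi> z = 0\<close>, a relation whose coefficients lie
  in the algebra; this is why independence over the scalars has to entail independence over the
  algebra (assumption \<open>strong\<close>).
\<close>

lemma multiplicative_maps_independent: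
  fixes t :: "'k::field \<Rightarrow> 'b::ring_1 \<Rightarrow> 'b" and \<Psi> :: "('x \<Rightarrow> 'b) set" and m :: "'x \<Rightarrow> 'x \<Rightarrow> 'x"
  assumes t: "vector_space t" and t_mult: "\<And>c a b. t c a * b = t c (a * b)" "\<And>c a b. a * t c b = t c (a * b)"
    and mult: "\<And>\<psi> a b. \<psi> \<in> \<Psi> \<Longrightarrow> \<psi> (m a b) = \<psi> a * \<psi> b"
    and nonzero: "\<And>\<psi>. \<psi> \<in> \<Psi> \<Longrightarrow> \<psi> \<noteq> 0"
    and strong: "\<And>\<Phi> b \<phi>. \<Phi> \<subseteq> \<Psi> \<Longrightarrow> finite \<Phi> \<Longrightarrow> \<not> module.dependent (pointwise_scale t) \<Phi> \<Longrightarrow>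
      (\<And>y. (\<Sum>\<phi>\<in>\<Phi>. b \<phi> * \<phi> y) = 0) \<Longrightarrow> \<phi> \<in> \<Phi> \<Longrightarrow> b \<phi> = 0"
  shows "\<not> module.dependent (pointwise_scale t) \<Psi>"
proof -
  interpret t: vector_space t by fact
  interpret p: vector_space "pointwise_scale t :: 'k \<Rightarrow> ('x \<Rightarrow> 'b) \<Rightarrow> _"
    by (rule vector_space_pointwise[OF t])
  have fin: "p.independent \<Phi>" if "finite \<Phi>" "\<Phi> \<subseteq> \<Psi>" for \<Phi>
    using that
  proof (induction \<Phi> rule: finite_induct)
    case empty
    show ?case by (rule p.independent_empty)
  next
    case (insert \<psi> \<Phi>)
    have "\<psi> \<notin> p.span \<Phi>"
    proof
      assume "\<psi> \<in> p.span \<Phi>"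
      then obtain c where c: "\<psi> = (\<Sum>\<phi>\<in>\<Phi>. pointwise_scale t (c \<phi>) \<phi>)"
        unfolding p.span_finite[OF insert(1)] by blast
      have \<psi>: "\<psi> y = (\<Sum>\<phi>\<in>\<Phi>. t (c \<phi>) (\<phi> y))" for y
        unfolding c by (simp add: sum_apply pointwise_scale_def)
      have prod: "t (c \<phi>) (\<phi> y - \<psi> y) = 0" if "\<phi> \<in> \<Phi>" for y \<phi>
      proof (rule strong[OF _ insert(1) insert(3) _ that])
        show "\<Phi> \<subseteq> \<Psi>" "\<Phi> \<subseteq> \<Psi>" using insert.prems by auto
        fix z
        have "(\<Sum>\<phi>\<in>\<Phi>. t (c \<phi>) (\<phi> y - \<psi> y) * \<phi> z)
            = (\<Sum>\<phi>\<in>\<Phi>. t (c \<phi>) (\<phi> (m y z))) - \<psi> y * (\<Sum>\<phi>\<in>\<Phi>. t (c \<phi>) (\<phi> z))"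
          unfolding sum_distrib_left sum_subtractf[symmetric] using insert.prems
          by (intro sum.cong) (auto simp: mult t_mult t.scale_right_diff_distrib left_diff_distrib)
        also have "\<dots> = 0" using mult[of \<psi> y z] insert.prems by (simp add: \<psi>[symmetric])
        finally show "(\<Sum>\<phi>\<in>\<Phi>. t (c \<phi>) (\<phi> y - \<psi> y) * \<phi> z) = 0" .
      qed
      have neq: "\<phi> \<noteq> \<psi>" if "\<phi> \<in> \<Phi>" for \<phi> using insert(2) that by auto
      have "c \<phi> = 0" if "\<phi> \<in> \<Phi>" for \<phi>
      proof (rule ccontr)
        assume "c \<phi> \<noteq> 0"
        then have "\<phi> y = \<psi> y" for y
          using prod[OF that, of y] by simp
        then show False using neq[OF that] by (simp add: fun_eq_iff)
      qed
      then have "\<psi> = 0" by (simp add: fun_eq_iff \<psi>)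
      then show False using nonzero insert.prems by blast
    qed
    then show ?case using insert by (simp add: p.independent_insertI)
  qed
  show ?thesis
  proof
    assume "p.dependent \<Psi>"
    then obtain U u where "finite U" "U \<subseteq> \<Psi>" "(\<Sum>v\<in>U. pointwise_scale t (u v) v) = 0" "\<exists>v\<in>U. u v \<noteq> 0"
      unfolding p.dependent_explicit by blast
    then show False using fin[of U] unfolding p.dependent_explicit by blast
  qed
qed

text \<open>
  Typically \<open>\<psi> n\<close> is the \<open>n\<close>-th power of something, and a repetition means finite order.
\<close>

lemma multiplicative_sequence_repeats:
  fixes t :: "'k::field \<Rightarrow> 'b::ring_1 \<Rightarrow> 'b" and \<psi> :: "nat \<Rightarrow> 'x \<Rightarrow> 'b" and m :: "'x \<Rightarrow> 'x \<Rightarrow> 'x"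
  assumes t: "vector_space t" and t_mult: "\<And>c a b. t c a * b = t c (a * b)" "\<And>c a b. a * t c b = t c (a * b)"
    and mult: "\<And>n a b. \<psi> n (m a b) = \<psi> n a * \<psi> n b"
    and nonzero: "\<And>n. \<psi> n \<noteq> 0"
    and strong: "\<And>\<Phi> b \<phi>. \<Phi> \<subseteq> range \<psi> \<Longrightarrow> finite \<Phi> \<Longrightarrow> \<not> module.dependent (pointwise_scale t) \<Phi> \<Longrightarrow>
      (\<And>y. (\<Sum>\<phi>\<in>\<Phi>. b \<phi> * \<phi> y) = 0) \<Longrightarrow> \<phi> \<in> \<Phi> \<Longrightarrow> b \<phi> = 0"
    and F: "finite F" "range \<psi> \<subseteq> module.span (pointwise_scale t) F"
  shows "\<exists>i j. i < j \<and> \<psi> i = \<psi> j"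
proof -
  interpret p: vector_space "pointwise_scale t :: 'k \<Rightarrow> ('x \<Rightarrow> 'b) \<Rightarrow> _"
    by (rule vector_space_pointwise[OF t])
  have "p.independent (range \<psi>)"
  proof (rule multiplicative_maps_independent[OF t t_mult, of _ m])
    show "\<phi> (m a b) = \<phi> a * \<phi> b" if "\<phi> \<in> range \<psi>" for \<phi> a b using that mult by auto
    show "\<phi> \<noteq> 0" if "\<phi> \<in> range \<psi>" for \<phi> using that by (auto simp: nonzero)
    show "b \<phi> = 0" if "\<Phi> \<subseteq> range \<psi>" "finite \<Phi>" "p.independent \<Phi>"
      "\<And>y. (\<Sum>\<phi>\<in>\<Phi>. b \<phi> * \<phi> y) = 0" "\<phi> \<in> \<Phi>" for \<Phi> b \<phi>
      by (rule strong[OF that])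
  qed
  then have "finite (range \<psi>)" using p.independent_span_bound[OF F(1)] F(2) by blast
  then have "\<not> inj \<psi>" using finite_imageD infinite_UNIV_nat by blast
  then obtain i j where "i \<noteq> j" "\<psi> i = \<psi> j" by (auto simp: inj_def)
  then show ?thesis by (metis linorder_neqE_nat)
qed

lemma bij_funpow_repeat:
  assumes "bij f" "i < j" "f ^^ i = f ^^ j"
  shows "f ^^ (j - i) = id"
proof
  fix y
  have "surj (f ^^ i)" using assms(1) by (simp add: bij_fn bij_is_surj)
  then obtain z where z: "y = (f ^^ i) z" by (metis surjD)
  have "(f ^^ (j - i)) y = (f ^^ (j - i + i)) z" by (simp only: funpow_add z o_apply)
  then show "(f ^^ (j - i)) y = id y" using assms z by simp
qed

section \<open>Vector spaces that parametrize their dual\<close>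

text \<open>
  Every finite list over an infinite set \<open>B\<close> is given its own infinite block of elements of \<open>B\<close>,
  the blocks being disjoint.  The code of a list is built from a pairing \<open>B \<times> B \<rightarrow> B\<close>; that code
  separates only lists of equal length, so the length is recorded as well.
\<close>

lemma infinite_list_injection:
  assumes "infinite B"
  obtains \<iota> :: "'a list \<Rightarrow> nat \<Rightarrow> 'a"
  where "\<And>xs j. xs \<in> lists B \<Longrightarrow> \<iota> xs j \<in> B"
    and "\<And>xs ys i j. xs \<in> lists B \<Longrightarrow> ys \<in> lists B \<Longrightarrow> \<iota> xs i = \<iota> ys j \<Longrightarrow> xs = ys \<and> i = j"
proof -
  obtain p where p: "bij_betw p (B \<times> B) B"
    using card_of_Times_same_infinite[OF assms] card_of_ordIso by blast
  obtain n :: "nat \<Rightarrow> 'a" where n: "inj n" "range n \<subseteq> B"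
    using infinite_countable_subset[OF assms] by blast
  have p_in: "p (a, b) \<in> B" if "a \<in> B" "b \<in> B" for a b
    using p that by (auto simp: bij_betw_def)
  have p_inj: "a = c \<and> b = d" if "p (a, b) = p (c, d)" "a \<in> B" "b \<in> B" "c \<in> B" "d \<in> B" for a b c d
    using inj_onD[OF bij_betw_imp_inj_on[OF p] that(1)] that by auto
  define e where "e xs = foldr (\<lambda>b c. p (b, c)) xs (n 0)" for xs
  have e_Cons: "e (b # xs) = p (b, e xs)" for b xs by (simp add: e_def)
  have nB: "n i \<in> B" for i using n by auto
  have e_in: "e xs \<in> B" if "xs \<in> lists B" for xs
    using that by (induction xs) (auto simp: e_Cons p_in nB, simp add: e_def nB)
  have e_inj: "xs = ys" if "length xs = length ys" "xs \<in> lists B" "ys \<in> lists B" "e xs = e ys" for xs ys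
    using that
  proof (induction xs ys rule: list_induct2)
    case (Cons b xs c ys)
    then show ?case using p_inj[of b "e xs" c "e ys"] e_in by (auto simp: e_Cons)
  qed simp
  define \<iota> where "\<iota> xs j = p (p (n (length xs), n j), e xs)" for xs j
  show thesis
  proof (rule that[of \<iota>])
    show "\<iota> xs j \<in> B" if "xs \<in> lists B" for xs j
      using that by (simp add: \<iota>_def p_in nB e_in)
    show "xs = ys \<and> i = j" if "xs \<in> lists B" "ys \<in> lists B" "\<iota> xs i = \<iota> ys j" for xs ys i j
    proof -
      have "p (n (length xs), n i) = p (n (length ys), n j) \<and> e xs = e ys"
        using that by (intro p_inj) (simp_all add: \<iota>_def p_in nB e_in)
      moreover from this have "n (length xs) = n (length ys) \<and> n i = n j"
        by (intro p_inj) (simp_all add: nB)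
      ultimately show ?thesis using n(1) e_inj that by (auto dest: injD)
    qed
  qed
qed

text \<open>
  A homogeneous linear system with more unknowns than equations has a nontrivial solution.
\<close>

lemma (in vector_space) common_zero_in_span:
  assumes T: "\<And>b. linear_on scale (*) UNIV (T b)"
    and S: "finite S" and W: "finite W" "independent W" "card S < card W"
  shows "\<exists>v\<in>span W. v \<noteq> 0 \<and> (\<forall>b\<in>S. T b v = 0)"
proof (rule ccontr)
  assume no: "\<not> ?thesis"
  interpret p: vector_space "pointwise_scale (*) :: 'a \<Rightarrow> ('c \<Rightarrow> 'a) \<Rightarrow> _"
    by (rule vector_space_pointwise[OF vector_space_field])
  define R where "R v = (\<lambda>b. if b \<in> S then T b v else 0)" for v
  have "linear_on scale (pointwise_scale (*)) UNIV R"
    using T by (intro linear_onI) (auto simp: R_def pointwise_scale_def linear_on_def fun_eq_iff)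
  then have "Vector_Spaces.linear scale (pointwise_scale (*)) R"
    using linear_on_UNIV_iff[OF vector_space_axioms p.vector_space_axioms] by blast
  then interpret R: Vector_Spaces.linear scale "pointwise_scale (*)" R .
  have inj: "inj_on R (span W)"
  proof (rule inj_onI)
    fix u v assume uv: "u \<in> span W" "v \<in> span W" "R u = R v"
    then have zero: "R (u - v) = 0" by (simp add: R.diff)
    have "T b (u - v) = 0" if "b \<in> S" for b
      using that fun_cong[OF zero, of b] by (simp add: R_def)
    then have "u - v = 0" using no span_diff[OF uv(1,2)] by blast
    then show "u = v" by simp
  qed
  let ?\<delta> = "\<lambda>b c. if c = b then 1 else (0::'a)"
  have "R v \<in> p.span (?\<delta> ` S)" for v
  proof -
    have "R v = (\<Sum>b\<in>S. pointwise_scale (*) (T b v) (?\<delta> b))"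
      by (rule ext) (simp add: R_def sum_apply pointwise_scale_def S if_distrib cong: if_cong)
    also have "\<dots> \<in> p.span (?\<delta> ` S)"
      by (intro p.span_sum p.span_scale p.span_base) auto
    finally show ?thesis .
  qed
  then have "card (R ` W) \<le> card (?\<delta> ` S)"
    using p.independent_span_bound[of "?\<delta> ` S" "R ` W"] R.independent_injective_image[OF W(2) inj] S
    by blast
  moreover have "card (R ` W) = card W"
    by (rule card_image) (use inj span_superset in \<open>blast intro: inj_on_subset\<close>)
  ultimately show False using card_image_le[OF S, of ?\<delta>] W(3) by linarith
qed

text \<open>
  An infinite-dimensional space has no linear surjection onto its dual (the weak form of the
  Erdos--Kaplansky theorem).  Let \<open>B\<close> be an infinite basis.  For each list \<open>xs\<close> over \<open>B\<close> there is a vector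
  \<open>v xs \<noteq> 0\<close> annihilated by \<open>T b\<close> for every \<open>b\<close> in \<open>xs\<close>, supported on a block of basis vectors that belongs
  to \<open>xs\<close> alone.  Disjointness of the blocks allows a functional that is nonzero on all \<open>v xs\<close>; but
  a functional \<open>T u\<close> vanishes on \<open>v xs\<close> as soon as \<open>xs\<close> lists the support of \<open>u\<close>.
\<close>

lemma (in vector_space) finite_dimensional_if_dual_parametrized:
  assumes T: "bilinear_on scale scale (*) UNIV UNIV T"
    and surj: "\<And>f. linear_on scale (*) UNIV f \<Longrightarrow> \<exists>u. f = T u"
  shows "\<exists>B. finite B \<and> span B = UNIV"
proof -
  obtain B where B: "independent B" "span B = UNIV"
    using maximal_independent_subset[of UNIV] by (metis top.extremum_uniqueI)
  have "finite B"
  proof (rule ccontr)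
    assume "infinite B"
    then obtain \<iota> :: "'b list \<Rightarrow> nat \<Rightarrow> 'b"
      where \<iota>: "\<And>xs j. xs \<in> lists B \<Longrightarrow> \<iota> xs j \<in> B"
        and \<iota>_inj: "\<And>xs ys i j. xs \<in> lists B \<Longrightarrow> ys \<in> lists B \<Longrightarrow> \<iota> xs i = \<iota> ys j \<Longrightarrow> xs = ys \<and> i = j"
      by (rule infinite_list_injection) blast
    define W where "W xs = \<iota> xs ` {..length xs}" for xs
    have W: "W xs \<subseteq> B" "finite (W xs)" "independent (W xs)" "card (W xs) = Suc (length xs)"
      if "xs \<in> lists B" for xs
    proof -
      show "W xs \<subseteq> B" "finite (W xs)" using \<iota> that by (auto simp: W_def)
      then show "independent (W xs)" using B(1) independent_mono by blast
      show "card (W xs) = Suc (length xs)"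
        unfolding W_def using \<iota>_inj[OF that that] by (subst card_image) (auto intro!: inj_onI)
    qed
    have lin: "linear_on scale (*) UNIV (T b)" for b using T by (simp add: bilinear_on_def)
    have "\<exists>v\<in>span (W xs). v \<noteq> 0 \<and> (\<forall>b\<in>set xs. T b v = 0)" if "xs \<in> lists B" for xs
      by (rule common_zero_in_span[OF lin]) (use W[OF that] card_length[of xs] in auto)
    then obtain v where v: "\<And>xs. xs \<in> lists B \<Longrightarrow> v xs \<in> span (W xs)"
      "\<And>xs. xs \<in> lists B \<Longrightarrow> v xs \<noteq> 0"
      "\<And>xs b. xs \<in> lists B \<Longrightarrow> b \<in> set xs \<Longrightarrow> T b (v xs) = 0"
      by metis
    have sum_rep: "(\<Sum>b\<in>W xs. scale (representation B (v xs) b) b) = v xs" if "xs \<in> lists B" for xs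
      using sum_representation_eq[OF W(3)[OF that] v(1)[OF that] W(2)[OF that] order.refl]
        representation_extend[OF B(1) v(1)[OF that] W(1)[OF that]] by simp
    have "\<exists>b\<in>W xs. representation B (v xs) b \<noteq> 0" if "xs \<in> lists B" for xs
    proof (rule ccontr)
      assume "\<not> ?thesis"
      then have "(\<Sum>b\<in>W xs. scale (representation B (v xs) b) b) = 0" by (simp add: sum.neutral)
      then have "v xs = 0" using sum_rep[OF that] by simp
      then show False using v(2)[OF that] by simp
    qed
    then obtain w where w: "\<And>xs. xs \<in> lists B \<Longrightarrow> w xs \<in> W xs"
      "\<And>xs. xs \<in> lists B \<Longrightarrow> representation B (v xs) (w xs) \<noteq> 0"
      by metis
    interpret P: vector_space_pair scale "(*) :: 'a \<Rightarrow> 'a \<Rightarrow> 'a"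
      using vector_space_axioms vector_space_field by (rule vector_space_pair.intro)
    \<comment> \<open>\<open>w xs\<close> lies in the support of \<open>v xs\<close>, and no other \<open>w ys\<close> lies in the block of \<open>xs\<close>.\<close>
    obtain f where f: "Vector_Spaces.linear scale (*) f" "\<And>b. b \<in> B \<Longrightarrow> f b = (if b \<in> w ` lists B then 1 else 0)"
      using P.linear_independent_extend[OF B(1), of "\<lambda>b. if b \<in> w ` lists B then 1 else 0"] by blast
    interpret f: Vector_Spaces.linear scale "(*)" f by fact
    have fv: "f (v xs) \<noteq> 0" if xs: "xs \<in> lists B" for xs
    proof -
      have one: "b \<in> w ` lists B \<longleftrightarrow> b = w xs" if b: "b \<in> W xs" for b
      proof
        assume "b \<in> w ` lists B"
        then obtain ys where ys: "ys \<in> lists B" "b = w ys" by blast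
        have "b \<in> W ys" using w(1) ys by blast
        then obtain j where j: "b = \<iota> ys j" unfolding W_def by blast
        obtain i where i: "b = \<iota> xs i" using b unfolding W_def by blast
        have "xs = ys \<and> i = j" by (rule \<iota>_inj[OF xs ys(1)]) (use i j in simp)
        then show "b = w xs" using ys(2) by simp
      qed (use xs in blast)
      have "f (v xs) = (\<Sum>b\<in>W xs. representation B (v xs) b * f b)"
        using arg_cong[OF sum_rep[OF xs], of f] by (simp add: f.sum f.scale)
      also have "\<dots> = (\<Sum>b\<in>W xs. if b = w xs then representation B (v xs) b else 0)"
        by (rule sum.cong[OF refl]) (use f(2) W(1)[OF xs] one in auto)
      also have "\<dots> = representation B (v xs) (w xs)"
        using W(2)[OF xs] w(1)[OF xs] by simp
      finally show ?thesis using w(2)[OF xs] by simp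
    qed
    have "linear_on scale (*) UNIV f"
      using f(1) linear_on_UNIV_iff[OF vector_space_axioms vector_space_field] by blast
    then obtain u where u: "f = T u" using surj by blast
    define F where "F = {b. representation B u b \<noteq> 0}"
    have F: "finite F" "F \<subseteq> B" "(\<Sum>b\<in>F. scale (representation B u b) b) = u"
      unfolding F_def using finite_representation[of B u] representation_ne_zero[of B u]
        sum_nonzero_representation_eq[OF B(1), of u] B(2) by auto
    obtain xs where xs: "set xs = F" using finite_list[OF F(1)] by blast
    have xsB: "xs \<in> lists B" using xs F(2) by auto
    have linT: "linear_on scale (*) UNIV (\<lambda>u. T u (v xs))" using T by (simp add: bilinear_on_def)
    then interpret t: Vector_Spaces.linear scale "(*)" "\<lambda>u. T u (v xs)"
      using linear_on_UNIV_iff[OF vector_space_axioms vector_space_field] by blast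
    have "T u (v xs) = (\<Sum>b\<in>F. representation B u b * T b (v xs))"
      using arg_cong[OF F(3), of "\<lambda>u. T u (v xs)"] by (simp add: t.sum t.scale)
    also have "\<dots> = 0" using v(3)[OF xsB] xs by simp
    finally show False using fv[OF xsB] u by simp
  qed
  then show ?thesis using B by blast
qed

section \<open>Sweedler sums in a Hopf algebra\<close>

lemma bilinear_on_tensor:
  "bilinear_on s1 s2 tensor_scale UNIV UNIV (tensor s1 s2)"
  by (rule bilinear_onI)
    (auto simp: tensor_def pointwise_scale_def bilinear_on_def linear_on_def fun_eq_iff)

lemma tensor_in_tensor_space:
  fixes s1 :: "'k::field \<Rightarrow> 'u::ab_group_add \<Rightarrow> 'u" and s2 :: "'k \<Rightarrow> 'w::ab_group_add \<Rightarrow> 'w"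
  assumes "u \<in> C" "w \<in> D"
  shows "tensor s1 s2 u w \<in> tensor_space s1 s2 C D"
proof -
  interpret T: vector_space "tensor_scale :: 'k \<Rightarrow> ('u, 'w, 'k) tensor \<Rightarrow> _"
    by (rule vector_space_pointwise[OF vector_space_field])
  show ?thesis unfolding tensor_space_def by (rule T.span_base) (use assms in blast)
qed

lemma subspace_tensor_space:
  fixes s1 :: "'k::field \<Rightarrow> 'u::ab_group_add \<Rightarrow> 'u" and s2 :: "'k \<Rightarrow> 'w::ab_group_add \<Rightarrow> 'w"
  shows "module.subspace tensor_scale (tensor_space s1 s2 C D)"
proof -
  interpret T: vector_space "tensor_scale :: 'k \<Rightarrow> ('u, 'w, 'k) tensor \<Rightarrow> _"
    by (rule vector_space_pointwise[OF vector_space_field])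
  show ?thesis unfolding tensor_space_def by (rule T.subspace_span)
qed

text \<open>
  A trilinear map, seen as a bilinear map whose second argument is a tensor.
\<close>

lemma bilinear_on_tensor_lift:
  fixes s :: "'k::field \<Rightarrow> 'u::ab_group_add \<Rightarrow> 'u" and t :: "'k \<Rightarrow> 'v::ab_group_add \<Rightarrow> 'v"
  assumes s: "vector_space s" and t: "vector_space t" and C: "module.subspace s C"
    and \<beta>: "trilinear_on s t C \<beta>"
  shows "bilinear_on s tensor_scale t C (tensor_space s s C C) (\<lambda>u. tensor_lift s s C C (\<beta> u))"
proof -
  interpret S: vector_space s by fact
  have tri: "bilinear_on s s t C C (\<beta> u)" if "u \<in> C" for u
    using \<beta> that by (simp add: trilinear_on_def)
  have lift: "tensor_lift s s C C (\<beta> u) (\<Sum>(u, w)\<leftarrow>ps. tensor s s u w) = (\<Sum>(v, w)\<leftarrow>ps. \<beta> u v w)"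
    if "u \<in> C" "set ps \<subseteq> C \<times> C" for u ps
    by (rule tensor_lift_sum[OF s s t C C tri]) (use that in auto)
  have left: "\<beta> (u + u') v w = \<beta> u v w + \<beta> u' v w" "\<beta> (s c u) v w = t c (\<beta> u v w)"
    if "u \<in> C" "u' \<in> C" "v \<in> C" "w \<in> C" for u u' v w c
    using \<beta> that by (auto simp: trilinear_on_def bilinear_on_def linear_on_def)
  show ?thesis
  proof (rule bilinear_onI)
    fix u a b assume u: "u \<in> C" and a: "a \<in> tensor_space s s C C" and b: "b \<in> tensor_space s s C C"
    obtain ps where ps: "set ps \<subseteq> C \<times> C" "a = (\<Sum>(u, w)\<leftarrow>ps. tensor s s u w)"
      using tensor_space_elim[OF s C a] .
    obtain qs where qs: "set qs \<subseteq> C \<times> C" "b = (\<Sum>(u, w)\<leftarrow>qs. tensor s s u w)"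
      using tensor_space_elim[OF s C b] .
    have "a + b = (\<Sum>(u, w)\<leftarrow>ps @ qs. tensor s s u w)" by (simp add: ps qs)
    then show "tensor_lift s s C C (\<beta> u) (a + b)
        = tensor_lift s s C C (\<beta> u) a + tensor_lift s s C C (\<beta> u) b"
      using lift[OF u, of "ps @ qs"] lift[OF u ps(1)] lift[OF u qs(1)] ps qs by simp
  next
    fix u u' a assume u: "u \<in> C" "u' \<in> C" and a: "a \<in> tensor_space s s C C"
    obtain ps where ps: "set ps \<subseteq> C \<times> C" "a = (\<Sum>(u, w)\<leftarrow>ps. tensor s s u w)"
      using tensor_space_elim[OF s C a] .
    have "u + u' \<in> C" using u S.subspace_add[OF C] by blast
    moreover have "(\<Sum>(v, w)\<leftarrow>ps. \<beta> (u + u') v w) = (\<Sum>(v, w)\<leftarrow>ps. \<beta> u v w) + (\<Sum>(v, w)\<leftarrow>ps. \<beta> u' v w)"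
      using ps(1) u left by (induction ps) (auto simp: algebra_simps)
    ultimately show "tensor_lift s s C C (\<beta> (u + u')) a
        = tensor_lift s s C C (\<beta> u) a + tensor_lift s s C C (\<beta> u') a"
      using lift[OF _ ps(1)] u ps by simp
  next
    fix c u a assume u: "u \<in> C" and a: "a \<in> tensor_space s s C C"
    obtain ps where ps: "set ps \<subseteq> C \<times> C" "a = (\<Sum>(u, w)\<leftarrow>ps. tensor s s u w)"
      using tensor_space_elim[OF s C a] .
    have T: "vector_space (tensor_scale :: 'k \<Rightarrow> ('u, 'u, 'k) tensor \<Rightarrow> _)"
      by (rule vector_space_pointwise[OF vector_space_field])
    define qs where "qs = map (\<lambda>(v, w). (s c v, w)) ps"
    have qs: "set qs \<subseteq> C \<times> C" using ps(1) S.subspace_scale[OF C] by (auto simp: qs_def)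
    have "tensor s s (s c v) w = tensor_scale c (tensor s s v w)" for v w
      by (rule bilinear_onD(4)[OF bilinear_on_tensor]) auto
    then have "(\<Sum>(u, w)\<leftarrow>qs. tensor s s u w) = (\<Sum>(v, w)\<leftarrow>ps. tensor_scale c (tensor s s v w))"
      by (simp add: qs_def o_def case_prod_unfold)
    then have 1: "tensor_scale c a = (\<Sum>(u, w)\<leftarrow>qs. tensor s s u w)"
      using sum_list_case_prod_scale[OF T] ps(2) by metis
    have "\<beta> u (s c v) w = t c (\<beta> u v w)" if "v \<in> C" "w \<in> C" for v w
      by (rule bilinear_onD(4)[OF tri]) (use u that in auto)
    then have "(\<Sum>(v, w)\<leftarrow>qs. \<beta> u v w) = (\<Sum>(v, w)\<leftarrow>ps. t c (\<beta> u v w))"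
      unfolding qs_def using ps(1) by (induction ps) auto
    then have 2: "(\<Sum>(v, w)\<leftarrow>qs. \<beta> u v w) = t c (\<Sum>(v, w)\<leftarrow>ps. \<beta> u v w)"
      using sum_list_case_prod_scale[OF t] by metis
    show "tensor_lift s s C C (\<beta> u) (tensor_scale c a) = t c (tensor_lift s s C C (\<beta> u) a)"
      using lift[OF u qs] lift[OF u ps(1)] 1 2 ps(2) by simp
    have "s c u \<in> C" using u S.subspace_scale[OF C] by blast
    moreover have "(\<Sum>(v, w)\<leftarrow>ps. \<beta> (s c u) v w) = (\<Sum>(v, w)\<leftarrow>ps. t c (\<beta> u v w))"
      using ps(1) u left by (induction ps) auto
    ultimately show "tensor_lift s s C C (\<beta> (s c u)) a = t c (tensor_lift s s C C (\<beta> u) a)"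
      using lift[OF _ ps(1)] u ps(2) sum_list_case_prod_scale[OF t] by metis
  qed
qed

context hopf_algebra
begin

definition coprod_list :: "'h \<Rightarrow> ('h \<times> 'h) list" where
  "coprod_list h =
     (SOME ps. set ps \<subseteq> C \<times> C \<and> \<Delta> h = (\<Sum>(u, v)\<leftarrow>ps. tensor scale scale u v))"

text \<open>
  The Sweedler sum of a bilinear \<open>\<beta>\<close> (\<open>sweedler_eq_sw\<close>) as an explicit finite sum, which makes it
  visible that it commutes with additive maps and with other such sums.
\<close>

definition sw :: "('h \<Rightarrow> 'h \<Rightarrow> 'v::ab_group_add) \<Rightarrow> 'h \<Rightarrow> 'v" where
  "sw \<beta> h = (\<Sum>(u, v)\<leftarrow>coprod_list h. \<beta> u v)"

lemma coprod_list:
  assumes "h \<in> C"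
  shows "set (coprod_list h) \<subseteq> C \<times> C" "\<Delta> h = (\<Sum>(u, v)\<leftarrow>coprod_list h. tensor scale scale u v)"
proof -
  obtain ps where "set ps \<subseteq> C \<times> C" "\<Delta> h = (\<Sum>(u, v)\<leftarrow>ps. tensor scale scale u v)"
    using tensor_space_elim[OF vector_space_axioms subspace_C comult_closed[OF assms]] .
  then have "\<exists>ps. set ps \<subseteq> C \<times> C \<and> \<Delta> h = (\<Sum>(u, v)\<leftarrow>ps. tensor scale scale u v)" by blast
  from someI_ex[OF this] show "set (coprod_list h) \<subseteq> C \<times> C"
    "\<Delta> h = (\<Sum>(u, v)\<leftarrow>coprod_list h. tensor scale scale u v)"
    by (simp_all add: coprod_list_def)
qed

lemma sw_cong:
  assumes "h = h'" "h' \<in> C" "\<And>u v. u \<in> C \<Longrightarrow> v \<in> C \<Longrightarrow> \<beta> u v = \<gamma> u v"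
  shows "sw \<beta> h = sw \<gamma> h'"
  unfolding sw_def assms(1) using coprod_list(1)[OF assms(2)] assms(3)
  by (intro arg_cong[of _ _ sum_list] map_cong) auto

lemma sw_add: "sw (\<lambda>u v. \<beta> u v + \<gamma> u v) h = sw \<beta> h + sw \<gamma> h"
  unfolding sw_def by (induction "coprod_list h") (simp_all add: sum_list_addf case_prod_unfold)

lemma sw_zero: "sw (\<lambda>u v. 0) h = 0"
  unfolding sw_def by (induction "coprod_list h") auto

lemma sw_push:
  assumes "\<And>a b. f (a + b) = f a + f b"
  shows "f (sw \<beta> h) = sw (\<lambda>u v. f (\<beta> u v)) h"
proof -
  have "f 0 = 0" using assms[of 0 0] by simp
  then have "f (\<Sum>(u, v)\<leftarrow>ps. \<beta> u v) = (\<Sum>(u, v)\<leftarrow>ps. f (\<beta> u v))" for ps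
    by (induction ps) (auto simp: assms)
  then show ?thesis by (simp add: sw_def)
qed

lemma sw_scale: "vector_space t \<Longrightarrow> sw (\<lambda>u v. t c (\<beta> u v)) h = t c (sw \<beta> h)"
  unfolding sw_def by (rule sum_list_case_prod_scale)

lemma sw_swap: "sw (\<lambda>u v. sw (\<lambda>p q. \<beta> u v p q) g) h = sw (\<lambda>p q. sw (\<lambda>u v. \<beta> u v p q) h) g"
proof -
  have "(\<Sum>(u, v)\<leftarrow>ps. \<Sum>(p, q)\<leftarrow>qs. \<beta> u v p q) = (\<Sum>(p, q)\<leftarrow>qs. \<Sum>(u, v)\<leftarrow>ps. \<beta> u v p q)" for ps qs
    by (induction ps) (simp_all add: sum_list_addf case_prod_unfold)
  then show ?thesis by (simp add: sw_def)
qed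

lemma sweedler_eq_sw:
  assumes "vector_space t" "bilinear_on scale scale t C C \<beta>" "h \<in> C"
  shows "sweedler scale C \<Delta> \<beta> h = sw \<beta> h"
  unfolding sweedler_def sw_def coprod_list(2)[OF assms(3)]
  by (rule tensor_lift_sum[OF vector_space_axioms vector_space_axioms assms(1) subspace_C subspace_C
        assms(2) coprod_list(1)[OF assms(3)]])

lemma sw_linear:
  assumes t: "vector_space t" and \<beta>: "bilinear_on scale scale t C C \<beta>"
  shows "linear_on scale t C (sw \<beta>)"
proof -
  interpret t: vector_space t by fact
  have mem: "c \<in> C \<Longrightarrow> d \<in> C \<Longrightarrow> c + d \<in> C" "c \<in> C \<Longrightarrow> scale k c \<in> C" for c d k
    using subspace_C subspace_add subspace_scale by auto
  have vs: "vector_space (tensor_scale :: 'k \<Rightarrow> ('h, 'h, 'k) tensor \<Rightarrow> _)"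
    by (rule vector_space_pointwise[OF vector_space_field])
  note rel = tensor_relation[OF vector_space_axioms vector_space_axioms t subspace_C subspace_C \<beta>]
  have \<Delta>_add: "\<Delta> (g + h) = \<Delta> g + \<Delta> h" and \<Delta>_scale: "\<Delta> (scale c h) = tensor_scale c (\<Delta> h)"
    if "g \<in> C" "h \<in> C" for c g h
    using comult_linear that by (auto simp: linear_on_def)
  show ?thesis
  proof (rule linear_onI)
    fix g h assume gh: "g \<in> C" "h \<in> C"
    have "sw \<beta> (g + h) = (\<Sum>(u, v)\<leftarrow>coprod_list g @ coprod_list h. \<beta> u v)"
      unfolding sw_def using gh mem coprod_list[OF gh(1)] coprod_list[OF gh(2)]
        coprod_list[OF mem(1)[OF gh]] \<Delta>_add[OF gh]
      by (intro rel) auto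
    then show "sw \<beta> (g + h) = sw \<beta> g + sw \<beta> h" by (simp add: sw_def)
  next
    fix c h assume h: "h \<in> C"
    define qs where "qs = map (\<lambda>(v, w). (scale c v, w)) (coprod_list h)"
    have qs: "set qs \<subseteq> C \<times> C" using coprod_list(1)[OF h] mem by (auto simp: qs_def)
    have "tensor scale scale (scale c v) w = tensor_scale c (tensor scale scale v w)" for v w
      by (rule bilinear_onD(4)[OF bilinear_on_tensor]) auto
    then have "(\<Sum>(u, w)\<leftarrow>qs. tensor scale scale u w)
        = (\<Sum>(v, w)\<leftarrow>coprod_list h. tensor_scale c (tensor scale scale v w))"
      by (simp add: qs_def o_def case_prod_unfold)
    also have "\<dots> = tensor_scale c (\<Delta> h)"
      using sum_list_case_prod_scale[OF vs] coprod_list(2)[OF h] by metis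
    also have "\<dots> = (\<Sum>(u, v)\<leftarrow>coprod_list (scale c h). tensor scale scale u v)"
      using coprod_list(2)[OF mem(2)[OF h]] \<Delta>_scale[OF h h] by metis
    finally have "sw \<beta> (scale c h) = (\<Sum>(u, w)\<leftarrow>qs. \<beta> u w)"
      unfolding sw_def using coprod_list(1)[OF mem(2)[OF h]] qs by (intro rel) auto
    also have "\<dots> = (\<Sum>(v, w)\<leftarrow>coprod_list h. t c (\<beta> v w))"
      unfolding qs_def using coprod_list(1)[OF h] bilinear_onD(4)[OF \<beta>]
      by (simp add: o_def case_prod_unfold) (intro arg_cong[of _ _ sum_list] map_cong, auto)
    also have "\<dots> = t c (sw \<beta> h)"
      unfolding sw_def by (rule sum_list_case_prod_scale[OF t])
    finally show "sw \<beta> (scale c h) = t c (sw \<beta> h)" .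
  qed
qed

text \<open>
  The axiom is an identity between elements of \<open>H \<otimes> (H \<otimes> H)\<close>; a trilinear map induces a bilinear map
  on \<open>H\<close> and \<open>H \<otimes> H\<close>, to which \<open>tensor_relation\<close> applies.
\<close>

lemma sw_coassoc:
  fixes \<beta> :: "'h \<Rightarrow> 'h \<Rightarrow> 'h \<Rightarrow> 'v::ab_group_add"
  assumes t: "vector_space t" and \<beta>: "trilinear_on scale t C \<beta>" and h: "h \<in> C"
  shows "sw (\<lambda>u v. sw (\<lambda>p q. \<beta> p q v) u) h = sw (\<lambda>u v. sw (\<lambda>p q. \<beta> u p q) v) h"
proof -
  have T: "vector_space (tensor_scale :: 'k \<Rightarrow> ('h, 'h, 'k) tensor \<Rightarrow> _)"
    and T3: "vector_space (tensor_scale :: 'k \<Rightarrow> ('h, ('h, 'h, 'k) tensor, 'k) tensor \<Rightarrow> _)"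
    by (rule vector_space_pointwise[OF vector_space_field])+
  let ?t2 = "tensor scale scale" and ?t3 = "tensor scale (tensor_scale :: 'k \<Rightarrow> ('h, 'h, 'k) tensor \<Rightarrow> _)"
  note b2 = bilinear_onD[OF bilinear_on_tensor[of scale scale], simplified]
  note b3 = bilinear_onD[OF bilinear_on_tensor[of scale tensor_scale], simplified]
  have bil: "bilinear_on scale scale tensor_scale C C (\<lambda>p q. ?t3 p (?t2 q v))" for v
    by (rule bilinear_onI) (simp_all add: b2 b3)
  have bil3: "bilinear_on scale scale tensor_scale C C (\<lambda>u v. ?t3 u (\<Delta> v))"
    by (rule bilinear_onI) (use comult_linear in \<open>simp_all add: b3 linear_on_def\<close>)
  have inner: "sweedler scale C \<Delta> (\<lambda>p q. ?t3 p (?t2 q v)) u = sw (\<lambda>p q. ?t3 p (?t2 q v)) u"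
    if "u \<in> C" for u v
    by (rule sweedler_eq_sw[OF T3 bil that])
  have bil2: "bilinear_on scale scale tensor_scale C C
      (\<lambda>u v. sweedler scale C \<Delta> (\<lambda>p q. ?t3 p (?t2 q v)) u)"
  proof (rule bilinear_onI)
    fix u v v' assume "u \<in> C"
    then show "sweedler scale C \<Delta> (\<lambda>p q. ?t3 p (?t2 q (v + v'))) u
        = sweedler scale C \<Delta> (\<lambda>p q. ?t3 p (?t2 q v)) u
        + sweedler scale C \<Delta> (\<lambda>p q. ?t3 p (?t2 q v')) u"
      by (simp only: inner) (simp add: b2 b3 sw_add)
  next
    fix u v c assume "u \<in> C"
    then show "sweedler scale C \<Delta> (\<lambda>p q. ?t3 p (?t2 q (scale c v))) u
        = tensor_scale c (sweedler scale C \<Delta> (\<lambda>p q. ?t3 p (?t2 q v)) u)"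
      by (simp only: inner) (simp add: b2 b3 sw_scale[OF T3])
  next
    fix u u' v assume "u \<in> C" "u' \<in> C"
    then show "sweedler scale C \<Delta> (\<lambda>p q. ?t3 p (?t2 q v)) (u + u')
        = sweedler scale C \<Delta> (\<lambda>p q. ?t3 p (?t2 q v)) u
        + sweedler scale C \<Delta> (\<lambda>p q. ?t3 p (?t2 q v)) u'"
      using sw_linear[OF T3 bil] subspace_add[OF subspace_C] by (simp add: inner linear_on_def)
  next
    fix u v c assume "u \<in> C"
    then show "sweedler scale C \<Delta> (\<lambda>p q. ?t3 p (?t2 q v)) (scale c u)
        = tensor_scale c (sweedler scale C \<Delta> (\<lambda>p q. ?t3 p (?t2 q v)) u)"
      using sw_linear[OF T3 bil] subspace_scale[OF subspace_C] by (simp add: inner linear_on_def)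
  qed
  have "sw (\<lambda>u v. sw (\<lambda>p q. ?t3 p (?t2 q v)) u) h = sw (\<lambda>u v. ?t3 u (\<Delta> v)) h"
  proof -
    have "sw (\<lambda>u v. sw (\<lambda>p q. ?t3 p (?t2 q v)) u) h
        = sw (\<lambda>u v. sweedler scale C \<Delta> (\<lambda>p q. ?t3 p (?t2 q v)) u) h"
      by (rule sw_cong[OF refl h]) (simp only: inner)
    then show ?thesis
      using coassoc[OF h] unfolding sweedler_eq_sw[OF T3 bil2 h] sweedler_eq_sw[OF T3 bil3 h] by simp
  qed
  then have tensors: "sw (\<lambda>u v. sw (\<lambda>p q. ?t3 p (?t2 q v)) u) h = sw (\<lambda>u v. ?t3 u (\<Delta> v)) h" .
  define L where
    "L = concat (map (\<lambda>(u, v). map (\<lambda>(p, q). (p, ?t2 q v)) (coprod_list u)) (coprod_list h))"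
  define R where "R = map (\<lambda>(u, v). (u, \<Delta> v)) (coprod_list h)"
  have sumL: "(\<Sum>(u, w)\<leftarrow>L. f u w) = sw (\<lambda>u v. sw (\<lambda>p q. f p (?t2 q v)) u) h"
    for f :: "'h \<Rightarrow> ('h, 'h, 'k) tensor \<Rightarrow> 'z::ab_group_add"
    unfolding L_def sw_def by (simp add: sum_list_concat map_concat o_def case_prod_unfold)
  have sumR: "(\<Sum>(u, w)\<leftarrow>R. f u w) = sw (\<lambda>u v. f u (\<Delta> v)) h"
    for f :: "'h \<Rightarrow> ('h, 'h, 'k) tensor \<Rightarrow> 'z::ab_group_add"
    unfolding R_def sw_def by (simp add: o_def case_prod_unfold)
  let ?B = "\<lambda>u. tensor_lift scale scale C C (\<beta> u)"
  have tri: "bilinear_on scale scale t C C (\<beta> u)" if "u \<in> C" for u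
    using \<beta> that by (simp add: trilinear_on_def)
  have lift: "?B u (\<Sum>(u, w)\<leftarrow>ps. ?t2 u w) = (\<Sum>(v, w)\<leftarrow>ps. \<beta> u v w)"
    if "u \<in> C" "set ps \<subseteq> C \<times> C" for u ps
    by (rule tensor_lift_sum[OF vector_space_axioms vector_space_axioms t subspace_C subspace_C tri])
      (use that in auto)
  have "(\<Sum>(u, w)\<leftarrow>L. ?B u w) = (\<Sum>(u, w)\<leftarrow>R. ?B u w)"
  proof (rule tensor_relation[OF vector_space_axioms T t subspace_C subspace_tensor_space
        bilinear_on_tensor_lift[OF vector_space_axioms t subspace_C \<beta>]])
    show "set L \<subseteq> C \<times> tensor_space scale scale C C"
    proof -
      have "(p, ?t2 q v) \<in> C \<times> tensor_space scale scale C C"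
        if "(u, v) \<in> set (coprod_list h)" "(p, q) \<in> set (coprod_list u)" for u v p q
      proof -
        have "u \<in> C" "v \<in> C" using coprod_list(1)[OF h] that(1) by auto
        moreover from this have "p \<in> C" "q \<in> C" using coprod_list(1) that(2) by auto
        ultimately show ?thesis by (simp add: tensor_in_tensor_space)
      qed
      then show ?thesis unfolding L_def by auto
    qed
    show "set R \<subseteq> C \<times> tensor_space scale scale C C"
      unfolding R_def using coprod_list(1)[OF h] comult_closed by auto
    show "(\<Sum>(u, w)\<leftarrow>L. ?t3 u w) = (\<Sum>(u, w)\<leftarrow>R. ?t3 u w)"
      unfolding sumL sumR by (fact tensors)
  qed
  then have eq: "sw (\<lambda>u v. sw (\<lambda>p q. ?B p (?t2 q v)) u) h = sw (\<lambda>u v. ?B u (\<Delta> v)) h"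
    unfolding sumL sumR .
  have B: "?B p (?t2 q v) = \<beta> p q v" if "p \<in> C" "q \<in> C" "v \<in> C" for p q v
    using lift[of p "[(q, v)]"] that by simp
  have "sw (\<lambda>u v. sw (\<lambda>p q. \<beta> p q v) u) h = sw (\<lambda>u v. sw (\<lambda>p q. ?B p (?t2 q v)) u) h"
    by (rule sw_cong[OF refl h], rule sw_cong[OF refl], simp, simp add: B)
  also note eq
  also have "sw (\<lambda>u v. ?B u (\<Delta> v)) h = sw (\<lambda>u v. sw (\<lambda>p q. \<beta> u p q) v) h"
  proof (rule sw_cong[OF refl h])
    fix u v assume u: "u \<in> C" and v: "v \<in> C"
    show "?B u (\<Delta> v) = sw (\<lambda>p q. \<beta> u p q) v"
      using lift[OF u coprod_list(1)[OF v]] coprod_list(2)[OF v]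
      by (simp add: sw_def)
  qed
  finally show ?thesis .
qed

lemma add_closed: "g \<in> C \<Longrightarrow> h \<in> C \<Longrightarrow> g + h \<in> C"
  and scale_closed: "h \<in> C \<Longrightarrow> scale c h \<in> C"
  and zero_closed: "0 \<in> C"
  using subspace_C subspace_add subspace_scale subspace_0 by auto

lemma mult_add:
  assumes "f \<in> C" "g \<in> C" "h \<in> C"
  shows "f \<star> (g + h) = f \<star> g + f \<star> h" "(f + g) \<star> h = f \<star> h + g \<star> h"
    and "f \<star> scale c g = scale c (f \<star> g)" "scale c f \<star> g = scale c (f \<star> g)"
  using bilinear_onD[OF mult_bilinear] assms by auto

lemma S_linear: "g \<in> C \<Longrightarrow> h \<in> C \<Longrightarrow> S (g + h) = S g + S h" "h \<in> C \<Longrightarrow> S (scale c h) = scale c (S h)"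
  using antipode_linear by (auto simp: linear_on_def)

lemma \<epsilon>_linear: "g \<in> C \<Longrightarrow> h \<in> C \<Longrightarrow> \<epsilon> (g + h) = \<epsilon> g + \<epsilon> h" "h \<in> C \<Longrightarrow> \<epsilon> (scale c h) = c * \<epsilon> h"
  using counit_linear by (auto simp: linear_on_def)

lemma linear_on_sw:
  assumes t: "vector_space t" and F: "linear_on scale t C F" and h: "h \<in> C"
    and \<beta>: "\<And>u v. u \<in> C \<Longrightarrow> v \<in> C \<Longrightarrow> \<beta> u v \<in> C"
  shows "F (sw \<beta> h) = sw (\<lambda>u v. F (\<beta> u v)) h"
proof -
  interpret t: vector_space t by fact
  have F0: "F 0 = 0"
    using F zero_closed by (metis linear_on_def scale_zero_left t.scale_zero_left)
  have "(\<Sum>(u, v)\<leftarrow>ps. \<beta> u v) \<in> C \<and> F (\<Sum>(u, v)\<leftarrow>ps. \<beta> u v) = (\<Sum>(u, v)\<leftarrow>ps. F (\<beta> u v))"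
    if "set ps \<subseteq> C \<times> C" for ps
    using that F \<beta> by (induction ps) (auto simp: F0 linear_on_def zero_closed add_closed)
  then show ?thesis using coprod_list(1)[OF h] by (simp add: sw_def)
qed

lemma sw_counit_left:
  assumes t: "vector_space t" and F: "linear_on scale t C F" and h: "h \<in> C"
  shows "sw (\<lambda>u v. t (\<epsilon> u) (F v)) h = F h"
proof -
  have "bilinear_on scale scale scale C C (\<lambda>u v. scale (\<epsilon> u) v)"
    by (rule bilinear_onI) (auto simp: \<epsilon>_linear algebra_simps)
  then have "F h = F (sw (\<lambda>u v. scale (\<epsilon> u) v) h)"
    using counit_left[OF h] sweedler_eq_sw[OF vector_space_axioms _ h] by simp
  also have "\<dots> = sw (\<lambda>u v. F (scale (\<epsilon> u) v)) h"
    by (rule linear_on_sw[OF t F h]) (simp add: scale_closed)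
  also have "\<dots> = sw (\<lambda>u v. t (\<epsilon> u) (F v)) h"
    by (rule sw_cong[OF refl h]) (use F in \<open>simp add: linear_on_def\<close>)
  finally show ?thesis ..
qed

lemma sw_counit_right:
  assumes t: "vector_space t" and F: "linear_on scale t C F" and h: "h \<in> C"
  shows "sw (\<lambda>u v. t (\<epsilon> v) (F u)) h = F h"
proof -
  have "bilinear_on scale scale scale C C (\<lambda>u v. scale (\<epsilon> v) u)"
    by (rule bilinear_onI) (auto simp: \<epsilon>_linear algebra_simps)
  then have "F h = F (sw (\<lambda>u v. scale (\<epsilon> v) u) h)"
    using counit_right[OF h] sweedler_eq_sw[OF vector_space_axioms _ h] by simp
  also have "\<dots> = sw (\<lambda>u v. F (scale (\<epsilon> v) u)) h"
    by (rule linear_on_sw[OF t F h]) (simp add: scale_closed)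
  also have "\<dots> = sw (\<lambda>u v. t (\<epsilon> v) (F u)) h"
    by (rule sw_cong[OF refl h]) (use F in \<open>simp add: linear_on_def\<close>)
  finally show ?thesis ..
qed

lemma sw_antipode_left:
  assumes t: "vector_space t" and F: "linear_on scale t C F" and h: "h \<in> C"
  shows "sw (\<lambda>u v. F (S u \<star> v)) h = t (\<epsilon> h) (F \<one>)"
proof -
  have "bilinear_on scale scale scale C C (\<lambda>u v. S u \<star> v)"
    by (rule bilinear_onI) (auto simp: S_linear mult_add antipode_closed scale_closed)
  then have "F (scale (\<epsilon> h) \<one>) = F (sw (\<lambda>u v. S u \<star> v) h)"
    using antipode_left[OF h] sweedler_eq_sw[OF vector_space_axioms _ h] by simp
  also have "\<dots> = sw (\<lambda>u v. F (S u \<star> v)) h"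
    by (rule linear_on_sw[OF t F h]) (simp add: mult_closed antipode_closed)
  finally show ?thesis using F unit_closed by (simp add: linear_on_def)
qed

lemma sw_antipode_right:
  assumes t: "vector_space t" and F: "linear_on scale t C F" and h: "h \<in> C"
  shows "sw (\<lambda>u v. F (u \<star> S v)) h = t (\<epsilon> h) (F \<one>)"
proof -
  have "bilinear_on scale scale scale C C (\<lambda>u v. u \<star> S v)"
    by (rule bilinear_onI) (auto simp: S_linear mult_add antipode_closed scale_closed)
  then have "F (scale (\<epsilon> h) \<one>) = F (sw (\<lambda>u v. u \<star> S v) h)"
    using antipode_right[OF h] sweedler_eq_sw[OF vector_space_axioms _ h] by simp
  also have "\<dots> = sw (\<lambda>u v. F (u \<star> S v)) h"
    by (rule linear_on_sw[OF t F h]) (simp add: mult_closed antipode_closed)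
  finally show ?thesis using F unit_closed by (simp add: linear_on_def)
qed

lemma sw_unit:
  assumes t: "vector_space t" and \<beta>: "bilinear_on scale scale t C C \<beta>"
  shows "sw \<beta> \<one> = \<beta> \<one> \<one>"
proof -
  have "(\<Sum>(u, v)\<leftarrow>coprod_list \<one>. \<beta> u v) = (\<Sum>(u, v)\<leftarrow>[(\<one>, \<one>)]. \<beta> u v)"
    by (rule tensor_relation[OF vector_space_axioms vector_space_axioms t subspace_C subspace_C \<beta>])
      (use coprod_list[OF unit_closed] comult_unit unit_closed in auto)
  then show ?thesis by (simp add: sw_def)
qed

lemma sw_mult:
  assumes t: "vector_space t" and \<beta>: "bilinear_on scale scale t C C \<beta>" and gh: "g \<in> C" "h \<in> C"
  shows "sw \<beta> (g \<star> h) = sw (\<lambda>u v. sw (\<lambda>p q. \<beta> (u \<star> p) (v \<star> q)) h) g"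
proof -
  have T: "vector_space (tensor_scale :: 'k \<Rightarrow> ('h, 'h, 'k) tensor \<Rightarrow> _)"
    by (rule vector_space_pointwise[OF vector_space_field])
  let ?t = "tensor scale scale"
  note b = bilinear_onD[OF bilinear_on_tensor[of scale scale], simplified]
  have bil: "bilinear_on scale scale tensor_scale C C (\<lambda>p q. ?t (u \<star> p) (v \<star> q))"
    if "u \<in> C" "v \<in> C" for u v
    by (rule bilinear_onI) (use that in \<open>auto simp: mult_add b scale_closed\<close>)
  have inner: "sweedler scale C \<Delta> (\<lambda>p q. ?t (u \<star> p) (v \<star> q)) h = sw (\<lambda>p q. ?t (u \<star> p) (v \<star> q)) h"
    if "u \<in> C" "v \<in> C" for u v
    by (rule sweedler_eq_sw[OF T bil gh(2)]) (use that in auto)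
  have cong: "sw (\<lambda>p q. ?t (u \<star> p) (v \<star> q)) h = f"
    if "sw (\<lambda>p q. \<gamma> p q) h = f" "\<And>p q. p \<in> C \<Longrightarrow> q \<in> C \<Longrightarrow> ?t (u \<star> p) (v \<star> q) = \<gamma> p q" for \<gamma> f u v
    using that sw_cong[OF refl gh(2), of "\<lambda>p q. ?t (u \<star> p) (v \<star> q)" \<gamma>] by simp
  have bil2: "bilinear_on scale scale tensor_scale C C
      (\<lambda>u v. sweedler scale C \<Delta> (\<lambda>p q. ?t (u \<star> p) (v \<star> q)) h)"
    by (rule bilinear_onI; simp only: inner add_closed scale_closed; rule cong)
      (auto simp: sw_add[symmetric] sw_scale[OF T, symmetric] mult_add b)
  have "\<Delta> (g \<star> h) = sw (\<lambda>u v. sweedler scale C \<Delta> (\<lambda>p q. ?t (u \<star> p) (v \<star> q)) h) g"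
    using comult_mult[OF gh] sweedler_eq_sw[OF T bil2 gh(1)] by simp
  also have "\<dots> = sw (\<lambda>u v. sw (\<lambda>p q. ?t (u \<star> p) (v \<star> q)) h) g"
    by (rule sw_cong[OF refl gh(1)]) (rule inner)
  finally have \<Delta>: "\<Delta> (g \<star> h) = sw (\<lambda>u v. sw (\<lambda>p q. ?t (u \<star> p) (v \<star> q)) h) g" .
  define L where
    "L = concat (map (\<lambda>(u, v). map (\<lambda>(p, q). (u \<star> p, v \<star> q)) (coprod_list h)) (coprod_list g))"
  have sumL: "(\<Sum>(u, w)\<leftarrow>L. f u w) = sw (\<lambda>u v. sw (\<lambda>p q. f (u \<star> p) (v \<star> q)) h) g"
    for f :: "'h \<Rightarrow> 'h \<Rightarrow> 'z::ab_group_add"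
    unfolding L_def sw_def by (simp add: sum_list_concat map_concat o_def case_prod_unfold)
  have "(u \<star> p, v \<star> q) \<in> C \<times> C"
    if "(u, v) \<in> set (coprod_list g)" "(p, q) \<in> set (coprod_list h)" for u v p q
    using that coprod_list(1)[OF gh(1)] coprod_list(1)[OF gh(2)] mult_closed by auto
  then have L: "set L \<subseteq> C \<times> C" unfolding L_def by auto
  have "(\<Sum>(u, v)\<leftarrow>coprod_list (g \<star> h). \<beta> u v) = (\<Sum>(u, v)\<leftarrow>L. \<beta> u v)"
    by (rule tensor_relation[OF vector_space_axioms vector_space_axioms t subspace_C subspace_C \<beta>])
      (use coprod_list[OF mult_closed[OF gh]] L in \<open>simp_all add: sumL \<Delta>\<close>)
  then show ?thesis by (simp add: sumL) (simp add: sw_def)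
qed

end

context module_algebra
begin

lemma scaleA_mult: "scaleA c a * b = scaleA c (a * b)" "a * scaleA c b = scaleA c (a * b)"
  using A.mult_bilinear by (auto simp: bilinear_on_def linear_on_def)

lemma act_linear:
  assumes "h \<in> C"
  shows "h \<cdot> (a + b) = h \<cdot> a + h \<cdot> b" "h \<cdot> scaleA c a = scaleA c (h \<cdot> a)"
    and "g \<in> C \<Longrightarrow> (g + h) \<cdot> a = g \<cdot> a + h \<cdot> a" "scale c h \<cdot> a = scaleA c (h \<cdot> a)"
  using act_bilinear assms by (auto simp: bilinear_on_def linear_on_def)

lemma act_times_sw:
  assumes "h \<in> C"
  shows "h \<cdot> (a * b) = sw (\<lambda>u v. (u \<cdot> a) * (v \<cdot> b)) h"
proof -
  have "bilinear_on scale scale scaleA C C (\<lambda>u v. (u \<cdot> a) * (v \<cdot> b))"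
    by (rule bilinear_onI) (auto simp: act_linear scaleA_mult algebra_simps)
  from sweedler_eq_sw[OF A.vector_space_axioms this assms] show ?thesis
    using act_times[OF assms] by simp
qed

text \<open>
  Expand \<open>h' (b (S(h'') a))\<close> to \<open>(h' b) (h'' S(h''') a)\<close> and contract.
\<close>

lemma act_times_transfer:
  assumes h: "h \<in> C"
  shows "(h \<cdot> b) * a = sw (\<lambda>u v. u \<cdot> (b * (S v \<cdot> a))) h"
proof -
  have "sw (\<lambda>u v. u \<cdot> (b * (S v \<cdot> a))) h
      = sw (\<lambda>u v. sw (\<lambda>p q. (p \<cdot> b) * (q \<cdot> S v \<cdot> a)) u) h"
    by (rule sw_cong[OF refl h]) (simp add: act_times_sw)
  also have "\<dots> = sw (\<lambda>u v. sw (\<lambda>p q. (u \<cdot> b) * (p \<cdot> S q \<cdot> a)) v) h"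
    by (rule sw_coassoc[OF A.vector_space_axioms _ h], rule trilinear_onI)
      (simp_all add: act_linear scaleA_mult algebra_simps S_linear antipode_closed scale_closed)
  also have "\<dots> = sw (\<lambda>u v. scaleA (\<epsilon> v) ((u \<cdot> b) * a)) h"
  proof (rule sw_cong[OF refl h])
    fix u v assume u: "u \<in> C" and v: "v \<in> C"
    have "sw (\<lambda>p q. (u \<cdot> b) * (p \<cdot> S q \<cdot> a)) v = sw (\<lambda>p q. (u \<cdot> b) * ((p \<star> S q) \<cdot> a)) v"
      by (rule sw_cong[OF refl v]) (simp add: act_mult antipode_closed)
    also have "\<dots> = scaleA (\<epsilon> v) ((u \<cdot> b) * (\<one> \<cdot> a))"
      by (rule sw_antipode_right[OF A.vector_space_axioms _ v], rule linear_onI)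
        (simp_all add: act_linear scaleA_mult algebra_simps)
    finally show "sw (\<lambda>p q. (u \<cdot> b) * (p \<cdot> S q \<cdot> a)) v = scaleA (\<epsilon> v) ((u \<cdot> b) * a)"
      by (simp add: act_unit)
  qed
  also have "\<dots> = (h \<cdot> b) * a"
    by (rule sw_counit_right[OF A.vector_space_axioms _ h], rule linear_onI)
        (simp_all add: act_linear scaleA_mult algebra_simps)
  finally show ?thesis ..
qed

end

section \<open>Left integrals and the Frobenius property\<close>

locale hopf_algebra_with_integral = hopf_algebra scale UNIV "(*)" 1 \<Delta> \<epsilon> S
  for scale :: "'k::field \<Rightarrow> 'h::ring_1 \<Rightarrow> 'h"
    and \<Delta> :: "'h \<Rightarrow> ('h, 'h, 'k) tensor" and \<epsilon> :: "'h \<Rightarrow> 'k" and S :: "'h \<Rightarrow> 'h" +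
  fixes x :: 'h and \<alpha> :: "'h \<Rightarrow> 'k"
  assumes finite_dim: "\<exists>B. finite B \<and> span B = UNIV"
    and integral: "left_integral scale UNIV (*) \<epsilon> x"
    and modular: "modular_function scale UNIV (*) 1 x \<alpha>"
begin

abbreviation functional :: "('h \<Rightarrow> 'k) \<Rightarrow> bool" where
  "functional \<equiv> linear_on scale (*) UNIV"

lemma functionalD: "functional f \<Longrightarrow> f (g + h) = f g + f h" "functional f \<Longrightarrow> f (scale c h) = c * f h"
  by (simp_all add: linear_on_def)

lemma mult_scale: "scale c g * h = scale c (g * h)" "g * scale c h = scale c (g * h)"
  using mult_add by auto

lemma x_nonzero: "x \<noteq> 0" and mult_x: "h * x = scale (\<epsilon> h) x"
  using integral by (auto simp: left_integral_def)

lemma x_mult: "x * h = scale (\<alpha> h) x"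
  and functional_\<alpha>: "functional \<alpha>" and \<alpha>_mult: "\<alpha> (g * h) = \<alpha> g * \<alpha> h" and \<alpha>_one: "\<alpha> 1 = 1"
  using modular by (auto simp: modular_function_def)

lemmas linear_simps = functionalD(1)[OF functional_\<alpha>] functionalD(2)[OF functional_\<alpha>]
  S_linear[simplified] \<epsilon>_linear[simplified] mult_scale scale_right_distrib scale_left_distrib

lemmas sw_coassoc_H = sw_coassoc[OF vector_space_axioms, OF _ UNIV_I]

lemma bilinear_UNIV_simps:
  assumes "bilinear_on scale scale t UNIV UNIV \<beta>"
  shows "\<beta> u (v + v') = \<beta> u v + \<beta> u v'" "\<beta> (u + u') v = \<beta> u v + \<beta> u' v"
    "\<beta> u (scale c v) = t c (\<beta> u v)" "\<beta> (scale c u) v = t c (\<beta> u v)"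
  using bilinear_onD[OF assms] by auto

text \<open>
  \<open>\<tau> h = h \<leftharpoonup> \<alpha>\<close>.
\<close>

definition \<tau> :: "'h \<Rightarrow> 'h" where
  "\<tau> h = sw (\<lambda>u v. scale (\<alpha> u) v) h"

text \<open>
  The operator adjoint to \<open>h\<close>, for \<open>\<Delta> x\<close> as well as for the form \<open>\<chi>(b a)\<close> (\<open>integral_mult_right\<close>, \<open>\<chi>_transfer\<close>).
\<close>

definition \<sigma> :: "'h \<Rightarrow> 'h" where
  "\<sigma> h = S (\<tau> h)"

lemma \<tau>_linear: "linear_on scale scale UNIV \<tau>"
  unfolding \<tau>_def[abs_def]
  by (rule sw_linear[OF vector_space_axioms], rule bilinear_onI) (simp_all add: linear_simps mult.commute)

lemma \<sigma>_linear: "linear_on scale scale UNIV \<sigma>"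
  using \<tau>_linear by (simp add: linear_on_def \<sigma>_def linear_simps)

lemma linear_on_\<sigma>:
  assumes F: "linear_on scale t UNIV F"
  shows "F (\<sigma> h) = sw (\<lambda>u v. t (\<alpha> u) (F (S v))) h"
proof -
  have "F (\<sigma> h) = sw (\<lambda>u v. F (S (scale (\<alpha> u) v))) h"
    unfolding \<sigma>_def \<tau>_def
    by (subst sw_push[of "\<lambda>h. F (S h)"]) (use F in \<open>simp_all add: linear_on_def linear_simps\<close>)
  then show ?thesis using F by (simp add: linear_on_def linear_simps)
qed

text \<open>
  Compute \<open>\<Sum> \<beta>(x' h', x'' h'' S(h'''))\<close> in two ways: contract \<open>h'' S(h''')\<close>, or absorb \<open>h' \<otimes> h''\<close>
  into \<open>\<Delta> x\<close> by \<open>\<Delta>(x h') = \<alpha>(h') \<Delta> x\<close>.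
\<close>

lemma integral_mult_right:
  assumes t: "vector_space t" and \<beta>: "bilinear_on scale scale t UNIV UNIV \<beta>"
  shows "sw (\<lambda>u v. \<beta> (u * h) v) x = sw (\<lambda>u v. \<beta> u (v * \<sigma> h)) x"
proof -
  interpret t: vector_space t by fact
  note b = bilinear_UNIV_simps[OF \<beta>]
  have "sw (\<lambda>u v. \<beta> u (v * \<sigma> h)) x
      = sw (\<lambda>u v. sw (\<lambda>p q. t (\<alpha> p) (\<beta> u (v * S q))) h) x"
    by (rule sw_cong, rule refl, rule UNIV_I, rule linear_on_\<sigma>[of t "\<lambda>h. \<beta> u (v * h)" for u v], rule linear_onI)
      (simp_all add: b linear_simps distrib_left)
  also have "\<dots> = sw (\<lambda>p q. sw (\<lambda>u v. t (\<alpha> p) (\<beta> u (v * S q))) x) h"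
    by (rule sw_swap)
  also have "\<dots> = sw (\<lambda>p q. sw (\<lambda>u v. sw (\<lambda>p' p''. \<beta> (u * p') (v * p'' * S q)) p) x) h"
  proof (rule sw_cong[OF refl UNIV_I])
    fix p q
    have bil: "bilinear_on scale scale t UNIV UNIV (\<lambda>u v. \<beta> u (v * S q))"
      by (rule bilinear_onI) (simp_all add: b linear_simps distrib_left distrib_right)
    have "sw (\<lambda>u v. t (\<alpha> p) (\<beta> u (v * S q))) x = sw (\<lambda>u v. \<beta> u (v * S q)) (scale (\<alpha> p) x)"
      using sw_linear[OF t bil] by (simp add: sw_scale[OF t] linear_on_def)
    also have "\<dots> = sw (\<lambda>u v. sw (\<lambda>p' p''. \<beta> (u * p') (v * p'' * S q)) p) x"
      unfolding x_mult[symmetric] by (rule sw_mult[OF t bil]) auto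
    finally show "sw (\<lambda>u v. t (\<alpha> p) (\<beta> u (v * S q))) x
        = sw (\<lambda>u v. sw (\<lambda>p' p''. \<beta> (u * p') (v * p'' * S q)) p) x" .
  qed
  also have "\<dots> = sw (\<lambda>u v. sw (\<lambda>p q. sw (\<lambda>p' p''. \<beta> (u * p') (v * p'' * S q)) p) h) x"
    by (rule sw_swap)
  also have "\<dots> = sw (\<lambda>u v. \<beta> (u * h) v) x"
  proof (rule sw_cong[OF refl UNIV_I])
    fix u v
    have "sw (\<lambda>p q. sw (\<lambda>p' p''. \<beta> (u * p') (v * p'' * S q)) p) h
        = sw (\<lambda>p q. sw (\<lambda>q' q''. \<beta> (u * p) (v * q' * S q'')) q) h"
      by (rule sw_coassoc[OF t _ UNIV_I], rule trilinear_onI)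
        (simp_all add: b linear_simps distrib_left distrib_right)
    also have "\<dots> = sw (\<lambda>p q. t (\<epsilon> q) (\<beta> (u * p) v)) h"
    proof (rule sw_cong[OF refl UNIV_I])
      fix p q
      show "sw (\<lambda>q' q''. \<beta> (u * p) (v * q' * S q'')) q = t (\<epsilon> q) (\<beta> (u * p) v)"
        using sw_antipode_right[OF t, of "\<lambda>y. \<beta> (u * p) (v * y)" q]
        by (simp add: linear_on_def b linear_simps distrib_left mult.assoc)
    qed
    also have "\<dots> = \<beta> (u * h) v"
      by (rule sw_counit_right[OF t, of "\<lambda>p. \<beta> (u * p) v"])
        (simp_all add: linear_on_def b linear_simps distrib_left)
    finally show "sw (\<lambda>p q. sw (\<lambda>p' p''. \<beta> (u * p') (v * p'' * S q)) p) h = \<beta> (u * h) v" .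
  qed
  finally show ?thesis ..
qed

text \<open>
  The mirror image: \<open>\<Sum> \<beta>(S(h') h'' x', h''' x'')\<close>, where \<open>\<Delta>(h x) = \<epsilon>(h) \<Delta> x\<close>.
\<close>

lemma integral_mult_left:
  assumes t: "vector_space t" and \<beta>: "bilinear_on scale scale t UNIV UNIV \<beta>"
  shows "sw (\<lambda>u v. \<beta> u (h * v)) x = sw (\<lambda>u v. \<beta> (S h * u) v) x"
proof -
  interpret t: vector_space t by fact
  note b = bilinear_UNIV_simps[OF \<beta>]
  have "sw (\<lambda>u v. \<beta> (S h * u) v) x = sw (\<lambda>u v. sw (\<lambda>p q. t (\<epsilon> q) (\<beta> (S p * u) v)) h) x"
    by (rule sw_cong, rule refl, rule UNIV_I, rule sw_counit_right[OF t, symmetric, of "\<lambda>p. \<beta> (S p * u) v" for u v])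
      (simp_all add: linear_on_def b linear_simps distrib_right)
  also have "\<dots> = sw (\<lambda>p q. sw (\<lambda>u v. t (\<epsilon> q) (\<beta> (S p * u) v)) x) h"
    by (rule sw_swap)
  also have "\<dots> = sw (\<lambda>p q. sw (\<lambda>q' q''. sw (\<lambda>u v. \<beta> (S p * (q' * u)) (q'' * v)) x) q) h"
  proof (rule sw_cong[OF refl UNIV_I])
    fix p q
    have bil: "bilinear_on scale scale t UNIV UNIV (\<lambda>u v. \<beta> (S p * u) v)"
      by (rule bilinear_onI) (simp_all add: b linear_simps distrib_left distrib_right)
    have "sw (\<lambda>u v. t (\<epsilon> q) (\<beta> (S p * u) v)) x = sw (\<lambda>u v. \<beta> (S p * u) v) (scale (\<epsilon> q) x)"
      using sw_linear[OF t bil] by (simp add: sw_scale[OF t] linear_on_def)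
    also have "\<dots> = sw (\<lambda>q' q''. sw (\<lambda>u v. \<beta> (S p * (q' * u)) (q'' * v)) x) q"
      unfolding mult_x[symmetric] by (rule sw_mult[OF t bil]) auto
    finally show "sw (\<lambda>u v. t (\<epsilon> q) (\<beta> (S p * u) v)) x
        = sw (\<lambda>q' q''. sw (\<lambda>u v. \<beta> (S p * (q' * u)) (q'' * v)) x) q" .
  qed
  also have "\<dots> = sw (\<lambda>p q. sw (\<lambda>p' p''. sw (\<lambda>u v. \<beta> (S p' * (p'' * u)) (q * v)) x) p) h"
    by (rule sw_coassoc[OF t _ UNIV_I, symmetric], rule trilinear_onI)
      (simp_all add: b linear_simps distrib_left distrib_right sw_add sw_scale[OF t])
  also have "\<dots> = sw (\<lambda>p q. t (\<epsilon> p) (sw (\<lambda>u v. \<beta> u (q * v)) x)) h"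
  proof (rule sw_cong[OF refl UNIV_I])
    fix p q
    show "sw (\<lambda>p' p''. sw (\<lambda>u v. \<beta> (S p' * (p'' * u)) (q * v)) x) p
        = t (\<epsilon> p) (sw (\<lambda>u v. \<beta> u (q * v)) x)"
      using sw_antipode_left[OF t, of "\<lambda>y. sw (\<lambda>u v. \<beta> (y * u) (q * v)) x" p]
      by (simp add: linear_on_def b linear_simps distrib_right mult.assoc sw_add sw_scale[OF t])
  qed
  also have "\<dots> = sw (\<lambda>u v. \<beta> u (h * v)) x"
    by (rule sw_counit_left[OF t, of "\<lambda>q. sw (\<lambda>u v. \<beta> u (q * v)) x"])
      (simp_all add: linear_on_def b linear_simps distrib_right sw_add sw_scale[OF t])
  finally show ?thesis ..
qed

text \<open>
  The two contractions of \<open>\<Delta> x\<close> with a functional, \<open>\<Sum> f(x'') x'\<close> and \<open>\<Sum> f(x') x''\<close>.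
\<close>

definition D :: "('h \<Rightarrow> 'k) \<Rightarrow> 'h" where
  "D f = sw (\<lambda>u v. scale (f v) u) x"

definition D' :: "('h \<Rightarrow> 'k) \<Rightarrow> 'h" where
  "D' f = sw (\<lambda>u v. scale (f u) v) x"

lemma linear_D:
  assumes "linear_on scale t UNIV F"
  shows "F (D f) = sw (\<lambda>u v. t (f v) (F u)) x"
  using assms unfolding D_def by (subst sw_push[of F]) (simp_all add: linear_on_def)

lemma linear_D':
  assumes "linear_on scale t UNIV F"
  shows "F (D' f) = sw (\<lambda>u v. t (f u) (F v)) x"
  using assms unfolding D'_def by (subst sw_push[of F]) (simp_all add: linear_on_def)

lemma D_mult:
  assumes "functional f"
  shows "D f * h = D (\<lambda>v. f (v * \<sigma> h))"
proof -
  have "D f * h = sw (\<lambda>u v. scale (f v) (u * h)) x"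
    by (rule linear_D) (simp add: linear_on_def linear_simps distrib_right)
  also have "\<dots> = D (\<lambda>v. f (v * \<sigma> h))"
    unfolding D_def
    by (rule integral_mult_right[OF vector_space_axioms], rule bilinear_onI)
      (simp_all add: functionalD[OF assms] linear_simps mult.commute)
  finally show ?thesis .
qed

lemma mult_D':
  assumes "functional f"
  shows "h * D' f = D' (\<lambda>u. f (S h * u))"
proof -
  have "h * D' f = sw (\<lambda>u v. scale (f u) (h * v)) x"
    by (rule linear_D') (simp add: linear_on_def linear_simps distrib_left)
  also have "\<dots> = D' (\<lambda>u. f (S h * u))"
    unfolding D'_def
    by (rule integral_mult_left[OF vector_space_axioms], rule bilinear_onI)
      (simp_all add: functionalD[OF assms] linear_simps mult.commute)
  finally show ?thesis .
qed

lemma D_add: "D f + D g = D (\<lambda>v. f v + g v)"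
  by (simp add: D_def scale_left_distrib sw_add)

lemma D_scale: "scale c (D f) = D (\<lambda>v. c * f v)"
  by (simp add: D_def scale_scale[symmetric] sw_scale[OF vector_space_axioms] del: scale_scale)

lemma functional_mult: "functional f \<Longrightarrow> functional (\<lambda>v. f (v * h))" "functional f \<Longrightarrow> functional (\<lambda>v. f (h * v))"
  by (auto simp: linear_on_def linear_simps algebra_simps)

text \<open>
  The range \<open>I\<close> of \<open>D\<close> is a right ideal by \<open>D_mult\<close>, and \<open>\<Delta> I \<subseteq> I \<otimes> H\<close> by coassociativity; hence
  \<open>\<epsilon>(d) 1 = \<Sum> d' S(d'')\<close> lies in \<open>I\<close> for all \<open>d \<in> I\<close>.  This is the argument behind the fundamental
  theorem of Hopf modules.  It remains to choose \<open>d = D f\<close> with \<open>\<epsilon>(D f) = f x = 1\<close>.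
\<close>

lemma one_in_range_D: "\<exists>f. functional f \<and> D f = 1"
proof -
  let ?I = "D ` Collect functional"
  have f0: "functional (\<lambda>_. 0)" by (simp add: linear_on_def)
  have I_0: "0 \<in> ?I"
    using f0 sw_zero[of x] by (auto intro!: image_eqI[of _ _ "\<lambda>_. 0"] simp: D_def)
  have I_add: "a + b \<in> ?I" if "a \<in> ?I" "b \<in> ?I" for a b
    using that by (auto simp: D_add linear_on_def algebra_simps intro!: imageI)
  have I_scale: "scale c a \<in> ?I" if "a \<in> ?I" for a c
    using that by (auto simp: D_scale linear_on_def algebra_simps intro!: imageI)
  have I_mult: "a * h \<in> ?I" if "a \<in> ?I" for a h
    using that by (auto simp: D_mult functional_mult intro!: imageI)
  obtain f where f: "functional f" "f x = 1"
    using functional_separates[OF x_nonzero] .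
  \<comment> \<open>By coassociativity \<open>\<epsilon>(D f) 1\<close> becomes \<open>\<Sum> x' K(x'')\<close>.  Expanding \<open>K\<close> in a basis then exhibits it as
    an element of the right ideal.\<close>
  define K where "K w = sw (\<lambda>p q. scale (f q) (S p)) w" for w
  have K: "linear_on scale scale UNIV K"
    unfolding K_def[abs_def]
    by (rule sw_linear[OF vector_space_axioms], rule bilinear_onI)
      (simp_all add: linear_simps functionalD[OF f(1)] mult.commute)
  have "1 = scale (f x) 1" using f by simp
  also have "f x = sw (\<lambda>u v. f v * \<epsilon> u) x"
    using sw_counit_left[OF vector_space_field f(1), of x] by (simp add: mult.commute)
  also have "scale \<dots> 1 = scale (\<epsilon> (D f)) 1"
    by (subst linear_D[of "(*)" \<epsilon>]) (simp_all add: linear_on_def linear_simps)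
  also have "\<dots> = sw (\<lambda>p q. p * S q) (D f)"
    using sw_antipode_right[OF vector_space_axioms, of "\<lambda>h. h" "D f"] by (simp add: linear_on_def)
  also have "\<dots> = sw (\<lambda>u v. scale (f v) (sw (\<lambda>p q. p * S q) u)) x"
    by (rule linear_D, rule sw_linear[OF vector_space_axioms], rule bilinear_onI)
      (simp_all add: linear_simps algebra_simps)
  also have "\<dots> = sw (\<lambda>u v. sw (\<lambda>p q. scale (f v) (p * S q)) u) x"
    by (simp add: sw_scale[OF vector_space_axioms])
  also have "\<dots> = sw (\<lambda>u v. sw (\<lambda>p q. scale (f q) (u * S p)) v) x"
    by (rule sw_coassoc_H, rule trilinear_onI)
      (simp_all add: linear_simps functionalD[OF f(1)] algebra_simps)
  also have "\<dots> = sw (\<lambda>u v. u * K v) x"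
  proof (rule sw_cong[OF refl UNIV_I])
    fix u v
    have "u * K v = sw (\<lambda>p q. u * scale (f q) (S p)) v"
      unfolding K_def by (rule sw_push) (simp add: distrib_left)
    then show "sw (\<lambda>p q. scale (f q) (u * S p)) v = u * K v" by (simp add: mult_scale)
  qed
  also have "\<dots> \<in> ?I"
  proof -
    obtain B where B: "finite B" "span B = UNIV" using finite_dim by blast
    obtain Bs c where Bs: "finite_dimensional_vector_space scale Bs"
      and c: "\<forall>b. functional (c b)" and rep: "\<forall>v. v = (\<Sum>b\<in>Bs. scale (c b v) b)"
      using finite_basis_coordinates[OF B] .
    interpret F: finite_dimensional_vector_space scale Bs by fact
    have sum: "(\<Sum>b\<in>Bs'. sw (\<beta> b) x) = sw (\<lambda>u v. \<Sum>b\<in>Bs'. \<beta> b u v) x"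
      if "finite Bs'" for Bs' and \<beta> :: "'h \<Rightarrow> 'h \<Rightarrow> 'h \<Rightarrow> 'h"
      using that by (induction Bs' rule: finite_induct) (simp_all add: sw_add sw_zero)
    have "sw (\<lambda>u v. u * K v) x = sw (\<lambda>u v. \<Sum>b\<in>Bs. scale (c b (K v)) (u * b)) x"
    proof (rule sw_cong[OF refl UNIV_I])
      fix u v
      have "u * K v = u * (\<Sum>b\<in>Bs. scale (c b (K v)) b)" by (rule arg_cong[OF rep[rule_format]])
      then show "u * K v = (\<Sum>b\<in>Bs. scale (c b (K v)) (u * b))"
        by (simp add: sum_distrib_left mult_scale)
    qed
    also have "\<dots> = (\<Sum>b\<in>Bs. sw (\<lambda>u v. scale (c b (K v)) (u * b)) x)"
      by (rule sum[OF F.finite_Basis, symmetric])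
    also have "\<dots> = (\<Sum>b\<in>Bs. D (\<lambda>v. c b (K v)) * b)"
    proof (rule sum.cong[OF refl])
      fix b
      show "sw (\<lambda>u v. scale (c b (K v)) (u * b)) x = D (\<lambda>v. c b (K v)) * b"
        by (rule linear_D[of scale "\<lambda>h. h * b", symmetric])
          (simp add: linear_on_def linear_simps distrib_right)
    qed
    also have "\<dots> \<in> ?I"
    proof -
      have "functional (\<lambda>v. c b (K v))" for b
        using c K by (simp add: linear_on_def)
      then have mem: "D (\<lambda>v. c b (K v)) * b \<in> ?I" for b by (intro I_mult) blast
      have "(\<Sum>b\<in>Bs'. D (\<lambda>v. c b (K v)) * b) \<in> ?I" if "finite Bs'" for Bs'
        using that by (induction Bs' rule: finite_induct) (simp_all only: sum.empty sum.insert I_0 I_add mem not_False_eq_True)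
      then show ?thesis using F.finite_Basis .
    qed
    finally show ?thesis .
  qed
  finally show ?thesis by force
qed

text \<open>
  The integral of the dual Hopf algebra, normalized by \<open>\<Sum> \<psi>(x'') x' = 1\<close>.
\<close>

definition \<psi> :: "'h \<Rightarrow> 'k" where
  "\<psi> = (SOME f. functional f \<and> D f = 1)"

lemma functional_\<psi>: "functional \<psi>" and D_\<psi>: "D \<psi> = 1"
  using someI_ex[OF one_in_range_D] by (auto simp: \<psi>_def)

text \<open>
  Dual bases for the form \<open>\<psi>(v w)\<close>.  In particular \<open>\<sigma>\<close> is injective.
\<close>

lemma D_\<psi>_\<sigma>: "D (\<lambda>v. \<psi> (v * \<sigma> h)) = h"
  using D_mult[OF functional_\<psi>, of h] by (simp add: D_\<psi>)

lemma zero_of_functional: "functional f \<Longrightarrow> f 0 = 0"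
  using functionalD(2)[of f 0 0] by simp

lemma D_zero: "D (\<lambda>v. 0) = 0" and D'_zero: "D' (\<lambda>v. 0) = 0"
  by (simp_all add: D_def D'_def sw_zero)

lemma pairing: "functional f \<Longrightarrow> functional g \<Longrightarrow> f (D g) = g (D' f)"
  by (simp add: linear_D[of "(*)"] linear_D'[of "(*)"] mult.commute)

lemma \<sigma>_eq_0: "\<sigma> h = 0 \<Longrightarrow> h = 0"
  using D_\<psi>_\<sigma>[of h] by (simp add: zero_of_functional[OF functional_\<psi>] D_zero)

lemma bij_\<sigma>: "bij \<sigma>"
proof -
  obtain B where "finite B" "span B = UNIV" using finite_dim by blast
  then show ?thesis using injective_linear_surjective[OF _ _ \<sigma>_linear] \<sigma>_eq_0 by blast
qed

lemma D'_eq_0: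
  assumes f: "functional f" and 0: "D' f = 0"
  shows "f = (\<lambda>_. 0)"
proof
  fix h
  have "f h = f (D (\<lambda>v. \<psi> (v * \<sigma> h)))" by (simp add: D_\<psi>_\<sigma>)
  also have "\<dots> = \<psi> (D' f * \<sigma> h)"
    by (rule pairing[OF f]) (rule functional_mult[OF functional_\<psi>])
  finally show "f h = 0" by (simp add: 0 zero_of_functional[OF functional_\<psi>])
qed

text \<open>
  The distinguished grouplike element \<open>g\<close>.
\<close>

definition gl :: 'h where
  "gl = D' \<psi>"

lemma gl_\<sigma>: "gl * \<sigma> h = D' (\<lambda>u. \<psi> (u * h))"
proof -
  have "gl * \<sigma> h = sw (\<lambda>u v. scale (\<psi> u) (v * \<sigma> h)) x"
    unfolding gl_def by (rule linear_D') (simp add: linear_on_def linear_simps distrib_right)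
  also have "\<dots> = D' (\<lambda>u. \<psi> (u * h))"
    unfolding D'_def
    by (rule integral_mult_right[OF vector_space_axioms, symmetric], rule bilinear_onI)
      (simp_all add: functionalD[OF functional_\<psi>] linear_simps mult.commute)
  finally show ?thesis .
qed

text \<open>
  The map \<open>h \<mapsto> g \<sigma>(h)\<close> takes values in the range of \<open>D'\<close> by \<open>gl_\<sigma>\<close>, and it is injective, hence
  surjective.
\<close>

lemma D'_surj: "\<exists>f. functional f \<and> D' f = y"
proof -
  obtain B where B: "finite B" "span B = UNIV" using finite_dim by blast
  have "bij (\<lambda>h. gl * \<sigma> h)"
  proof (rule injective_linear_surjective[OF B])
    show "linear_on scale scale UNIV (\<lambda>h. gl * \<sigma> h)"
      using \<sigma>_linear by (simp add: linear_on_def distrib_left linear_simps)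
    fix h assume "gl * \<sigma> h = 0"
    then have 0: "(\<lambda>u. \<psi> (u * h)) = (\<lambda>_. 0)"
      by (intro D'_eq_0) (simp_all add: gl_\<sigma> functional_mult functional_\<psi>)
    obtain k where k: "h = \<sigma> k" using bij_\<sigma> by (metis bij_pointE)
    have "k = 0" using D_\<psi>_\<sigma>[of k] 0 by (simp add: k D_zero)
    then show "h = 0" using k \<sigma>_linear by (metis linear_on_def UNIV_I scale_zero_left)
  qed
  then obtain h where "y = gl * \<sigma> h" by (metis bij_pointE)
  then show ?thesis using gl_\<sigma>[of h] functional_mult(1)[OF functional_\<psi>] by metis
qed

text \<open>
  \<open>D\<close> and \<open>D'\<close> are transposes of each other (\<open>pairing\<close>), and \<open>D'\<close> is surjective.
\<close>

lemma D_inject: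
  assumes f: "functional f" and g: "functional g" and eq: "D f = D g"
  shows "f = g"
proof
  fix y
  obtain p where p: "functional p" "D' p = y" using D'_surj by blast
  show "f y = g y" using pairing[OF p(1) f] pairing[OF p(1) g] eq p(2) by simp
qed

text \<open>
  Both functionals of \<open>y\<close> are sent to \<open>S k\<close> by the injective map \<open>D\<close>.
\<close>

lemma nakayama: "\<psi> (k * y) = \<psi> (y * \<sigma> (S k))"
proof -
  have "D (\<lambda>v. \<psi> (k * v)) = sw (\<lambda>u v. scale (\<psi> v) (S k * u)) x"
    unfolding D_def
    by (rule integral_mult_left[OF vector_space_axioms], rule bilinear_onI)
      (simp_all add: functionalD[OF functional_\<psi>] linear_simps mult.commute)
  also have "\<dots> = S k * D \<psi>"
    by (rule linear_D[symmetric]) (simp add: linear_on_def linear_simps distrib_left)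
  also have "\<dots> = D (\<lambda>v. \<psi> (v * \<sigma> (S k)))"
    by (simp add: D_\<psi> D_\<psi>_\<sigma>)
  finally have "(\<lambda>v. \<psi> (k * v)) = (\<lambda>v. \<psi> (v * \<sigma> (S k)))"
    by (rule D_inject[rotated 2]) (rule functional_mult[OF functional_\<psi>])+
  then show ?thesis by (rule fun_cong)
qed

text \<open>
  Radford's formula in embryo: \<open>h g = \<Sum> \<psi>(S(h) x') x''\<close>, where \<open>S(h)\<close> can be moved to the other side
  of \<open>x'\<close> by \<open>nakayama\<close>.
\<close>

lemma gl_conjugation: "h * gl = gl * \<sigma> (\<sigma> (S (S h)))"
  using mult_D'[OF functional_\<psi>, of h] nakayama[of "S h"] by (simp add: gl_\<sigma>) (simp add: gl_def)

text \<open>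
  Every \<open>h\<close> has the form \<open>\<Sum> f(x') x''\<close>, and then the left-hand side is the contraction by \<open>f\<close> of the
  coproduct of \<open>\<Sum> \<psi>(x'') x' = 1\<close>.
\<close>

lemma \<psi>_left_invariant: "sw (\<lambda>p q. scale (\<psi> q) p) h = scale (\<psi> h) 1"
proof -
  obtain f where f: "functional f" "D' f = h" using D'_surj by blast
  have G: "linear_on scale scale UNIV (sw (\<lambda>p q. scale (\<psi> q) p))"
    by (rule sw_linear[OF vector_space_axioms], rule bilinear_onI)
      (simp_all add: functionalD[OF functional_\<psi>] linear_simps mult.commute)
  have M: "bilinear_on scale scale scale UNIV UNIV (\<lambda>p q. scale (f p) q)"
    by (rule bilinear_onI) (simp_all add: functionalD[OF f(1)] linear_simps mult.commute)
  have "sw (\<lambda>p q. scale (\<psi> q) p) h = sw (\<lambda>u v. sw (\<lambda>p q. scale (f u) (scale (\<psi> q) p)) v) x"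
    unfolding f(2)[symmetric] linear_D'[OF G] by (simp only: sw_scale[OF vector_space_axioms])
  also have "\<dots> = sw (\<lambda>u v. sw (\<lambda>p q. scale (f p) (scale (\<psi> v) q)) u) x"
    by (rule sw_coassoc_H[symmetric], rule trilinear_onI)
      (simp_all add: functionalD[OF functional_\<psi>] functionalD[OF f(1)] linear_simps algebra_simps)
  also have "\<dots> = sw (\<lambda>u v. scale (\<psi> v) (sw (\<lambda>p q. scale (f p) q) u)) x"
    by (simp add: sw_scale[OF vector_space_axioms, symmetric] mult.commute)
  also have "\<dots> = scale (f 1) 1"
    unfolding linear_D[OF sw_linear[OF vector_space_axioms M], symmetric] D_\<psi>
    by (rule sw_unit[OF vector_space_axioms M])
  also have "f 1 = \<psi> h"
    using pairing[OF f(1) functional_\<psi>] by (simp add: D_\<psi> f(2))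
  finally show ?thesis .
qed

text \<open>
  Uniqueness of integrals: for a functional \<open>f\<close>, the convolution \<open>\<psi> * f\<close> is again left invariant, so
  \<open>D\<close> maps it to a scalar and \<open>D_inject\<close> makes it a multiple of \<open>\<psi>\<close>.
\<close>

lemma \<psi>_right_invariant: "sw (\<lambda>u v. scale (\<psi> u) v) h = scale (\<psi> h) gl"
proof -
  have "f (sw (\<lambda>u v. scale (\<psi> u) v) h) = f (scale (\<psi> h) gl)" if f: "functional f" for f h
  proof -
    define F where "F = sw (\<lambda>u v. \<psi> u * f v)"
    have F: "functional F"
      unfolding F_def
      by (rule sw_linear[OF vector_space_field], rule bilinear_onI)
        (simp_all add: functionalD[OF functional_\<psi>] functionalD[OF f] algebra_simps)
    have "D F = sw (\<lambda>u v. sw (\<lambda>p q. scale (\<psi> p * f q) u) v) x"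
      unfolding D_def F_def by (subst sw_push[of "\<lambda>c. scale c u" for u]) (simp_all add: linear_simps)
    also have "\<dots> = sw (\<lambda>u v. sw (\<lambda>p q. scale (\<psi> q * f v) p) u) x"
      by (rule sw_coassoc_H[symmetric], rule trilinear_onI)
        (simp_all add: functionalD[OF functional_\<psi>] functionalD[OF f(1)] linear_simps algebra_simps)
    also have "\<dots> = sw (\<lambda>u v. scale (f v) (sw (\<lambda>p q. scale (\<psi> q) p) u)) x"
      by (simp add: sw_scale[OF vector_space_axioms, symmetric] mult.commute)
    also have "\<dots> = sw (\<lambda>u v. scale (\<psi> u * f v) 1) x"
      unfolding \<psi>_left_invariant by (simp add: mult.commute)
    also have "\<dots> = scale (sw (\<lambda>u v. \<psi> u * f v) x) 1"
      by (rule sw_push[symmetric]) (simp add: linear_simps)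
    also have "sw (\<lambda>u v. \<psi> u * f v) x = f gl"
      unfolding gl_def by (rule linear_D'[OF f, symmetric])
    also have "scale (f gl) 1 = D (\<lambda>v. f gl * \<psi> v)"
      by (simp add: D_scale[symmetric] D_\<psi>)
    finally have "F = (\<lambda>v. f gl * \<psi> v)"
      by (rule D_inject[OF F, rotated])
        (use functional_\<psi> in \<open>simp add: linear_on_def algebra_simps\<close>)
    moreover have "f (sw (\<lambda>u v. scale (\<psi> u) v) h) = F h"
      unfolding F_def using f by (subst sw_push[of f]) (simp_all add: linear_on_def)
    ultimately show ?thesis using f by (simp add: linear_on_def)
  qed
  then have "sw (\<lambda>u v. scale (\<psi> u) v) h - scale (\<psi> h) gl = 0"
  proof (intro zero_if_functionals_vanish)
    fix f assume f: "functional f"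
    have "f (a - b) = f a - f b" for a b
      using functionalD(1)[OF f, of "a - b" b] by (simp add: algebra_simps)
    then show "f (sw (\<lambda>u v. scale (\<psi> u) v) h - scale (\<psi> h) gl) = 0"
      using \<open>\<And>h f. functional f \<Longrightarrow> f (sw (\<lambda>u v. scale (\<psi> u) v) h) = f (scale (\<psi> h) gl)\<close>[OF f] by simp
  qed
  then show ?thesis by simp
qed

text \<open>
  Grouplikeness of \<open>g = \<Sum> \<psi>(x') x''\<close>: in \<open>\<Sum> \<psi>(x') x'' \<otimes> x'''\<close> the first two legs combine to \<open>\<psi>(x') g\<close>.
\<close>

lemma sw_gl:
  assumes t: "vector_space t" and \<beta>: "bilinear_on scale scale t UNIV UNIV \<beta>"
  shows "sw \<beta> gl = \<beta> gl gl"
proof -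
  note b = bilinear_UNIV_simps[OF \<beta>]
  interpret t: vector_space t by fact
  have "sw \<beta> gl = sw (\<lambda>u v. sw (\<lambda>p q. t (\<psi> u) (\<beta> p q)) v) x"
    unfolding gl_def linear_D'[OF sw_linear[OF t \<beta>]] by (simp only: sw_scale[OF t])
  also have "\<dots> = sw (\<lambda>u v. sw (\<lambda>p q. t (\<psi> p) (\<beta> q v)) u) x"
    by (rule sw_coassoc[OF t _ UNIV_I, symmetric], rule trilinear_onI)
      (simp_all add: functionalD[OF functional_\<psi>] b linear_simps algebra_simps)
  also have "\<dots> = sw (\<lambda>u v. t (\<psi> u) (\<beta> gl v)) x"
  proof (rule sw_cong[OF refl UNIV_I])
    fix u v
    have "t (\<psi> u) (\<beta> gl v) = \<beta> (sw (\<lambda>p q. scale (\<psi> p) q) u) v"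
      by (simp add: \<psi>_right_invariant b)
    also have "\<dots> = sw (\<lambda>p q. t (\<psi> p) (\<beta> q v)) u"
      by (subst sw_push[of "\<lambda>h. \<beta> h v"]) (simp_all add: b)
    finally show "sw (\<lambda>p q. t (\<psi> p) (\<beta> q v)) u = t (\<psi> u) (\<beta> gl v)" ..
  qed
  also have "\<dots> = \<beta> gl gl"
    unfolding gl_def by (rule linear_D'[symmetric]) (simp add: linear_on_def b)
  finally show ?thesis .
qed

lemma \<epsilon>_gl: "\<epsilon> gl = 1"
proof -
  have "\<epsilon> gl = \<psi> x"
    unfolding gl_def linear_D'[OF counit_linear]
    using sw_counit_right[OF vector_space_field functional_\<psi>, of x] by (simp add: mult.commute)
  also have "\<psi> x = \<epsilon> (D \<psi>)"
    unfolding linear_D[OF counit_linear]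
    using sw_counit_left[OF vector_space_field functional_\<psi>, of x] by (simp add: mult.commute)
  finally show ?thesis by (simp add: D_\<psi> counit_unit)
qed

lemma gl_inverse: "S gl * gl = 1"
proof -
  have "bilinear_on scale scale scale UNIV UNIV (\<lambda>u v. S u * v)"
    by (rule bilinear_onI) (simp_all add: linear_simps algebra_simps)
  from sw_gl[OF vector_space_axioms this] show ?thesis
    using sw_antipode_left[OF vector_space_axioms, of "\<lambda>h. h" gl] by (simp add: linear_on_def \<epsilon>_gl)
qed
section \<open>Translations by the modular function and the fourth power of the antipode\<close>

text \<open>
  \<open>\<kappa> h = \<alpha>\<^sup>-\<^sup>1 \<rightharpoonup> h\<close> and its inverse \<open>\<kappa>' h = \<alpha> \<rightharpoonup> h\<close>.
\<close>

definition \<kappa> :: "'h \<Rightarrow> 'h" where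
  "\<kappa> h = sw (\<lambda>u v. scale (\<alpha> (S v)) u) h"

definition \<kappa>' :: "'h \<Rightarrow> 'h" where
  "\<kappa>' h = sw (\<lambda>u v. scale (\<alpha> v) u) h"

lemma \<kappa>_linear: "linear_on scale scale UNIV \<kappa>"
  unfolding \<kappa>_def[abs_def]
  by (rule sw_linear[OF vector_space_axioms], rule bilinear_onI) (simp_all add: linear_simps mult.commute)

lemma \<kappa>'_linear: "linear_on scale scale UNIV \<kappa>'"
  unfolding \<kappa>'_def[abs_def]
  by (rule sw_linear[OF vector_space_axioms], rule bilinear_onI) (simp_all add: linear_simps mult.commute)

lemma linear_\<tau>: "linear_on scale t UNIV F \<Longrightarrow> F (\<tau> h) = sw (\<lambda>u v. t (\<alpha> u) (F v)) h"
  unfolding \<tau>_def by (subst sw_push[of F]) (simp_all add: linear_on_def)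

lemma linear_\<kappa>: "linear_on scale t UNIV F \<Longrightarrow> F (\<kappa> h) = sw (\<lambda>u v. t (\<alpha> (S v)) (F u)) h"
  unfolding \<kappa>_def by (subst sw_push[of F]) (simp_all add: linear_on_def)

lemma linear_\<kappa>': "linear_on scale t UNIV F \<Longrightarrow> F (\<kappa>' h) = sw (\<lambda>u v. t (\<alpha> v) (F u)) h"
  unfolding \<kappa>'_def by (subst sw_push[of F]) (simp_all add: linear_on_def)

lemma \<tau>_\<kappa>: "\<tau> (\<kappa> h) = \<kappa> (\<tau> h)"
proof -
  have "\<tau> (\<kappa> h) = sw (\<lambda>u v. scale (\<alpha> (S v)) (sw (\<lambda>p q. scale (\<alpha> p) q) u)) h"
    by (subst linear_\<kappa>[OF \<tau>_linear]) (simp add: \<tau>_def)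
  also have "\<dots> = sw (\<lambda>u v. sw (\<lambda>p q. scale (\<alpha> (S v)) (scale (\<alpha> p) q)) u) h"
    by (simp only: sw_scale[OF vector_space_axioms])
  also have "\<dots> = sw (\<lambda>u v. sw (\<lambda>p q. scale (\<alpha> (S q)) (scale (\<alpha> u) p)) v) h"
    by (rule sw_coassoc_H, rule trilinear_onI) (simp_all add: linear_simps algebra_simps)
  also have "\<dots> = sw (\<lambda>u v. scale (\<alpha> u) (sw (\<lambda>p q. scale (\<alpha> (S q)) p) v)) h"
    by (simp add: sw_scale[OF vector_space_axioms, symmetric] mult.commute)
  also have "\<dots> = \<kappa> (\<tau> h)"
    by (subst linear_\<tau>[OF \<kappa>_linear]) (simp add: \<kappa>_def)
  finally show ?thesis .
qed

lemma \<kappa>'_\<kappa>: "\<kappa>' (\<kappa> h) = h"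
proof -
  have "\<kappa>' (\<kappa> h) = sw (\<lambda>u v. sw (\<lambda>p q. scale (\<alpha> (S v)) (scale (\<alpha> q) p)) u) h"
    by (subst linear_\<kappa>[OF \<kappa>'_linear]) (simp only: \<kappa>'_def sw_scale[OF vector_space_axioms])
  also have "\<dots> = sw (\<lambda>u v. sw (\<lambda>p q. scale (\<alpha> (S q)) (scale (\<alpha> p) u)) v) h"
    by (rule sw_coassoc_H, rule trilinear_onI) (simp_all add: linear_simps algebra_simps)
  also have "\<dots> = sw (\<lambda>u v. scale (\<epsilon> v) u) h"
  proof (rule sw_cong[OF refl UNIV_I])
    fix u v
    show "sw (\<lambda>p q. scale (\<alpha> (S q)) (scale (\<alpha> p) u)) v = scale (\<epsilon> v) u"
      using sw_antipode_right[OF vector_space_axioms, of "\<lambda>h. scale (\<alpha> h) u" v]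
      by (simp add: linear_on_def linear_simps \<alpha>_mult \<alpha>_one mult.commute)
  qed
  also have "\<dots> = h"
    using sw_counit_right[OF vector_space_axioms, of "\<lambda>h. h" h] by (simp add: linear_on_def)
  finally show ?thesis .
qed

lemma \<kappa>'_bij: "bij \<kappa>'" and \<kappa>_\<kappa>': "\<kappa> (\<kappa>' h) = h"
proof -
  obtain B where B: "finite B" "span B = UNIV" using finite_dim by blast
  have "\<kappa>' 0 = 0" using \<kappa>'_linear by (metis linear_on_def UNIV_I scale_zero_left)
  then have *: "\<kappa> h = 0 \<Longrightarrow> h = 0" for h using \<kappa>'_\<kappa>[of h] by simp
  have bij: "bij \<kappa>"
    by (rule injective_linear_surjective[OF B \<kappa>_linear *])
  show **: "\<kappa> (\<kappa>' h) = h" for h using \<kappa>'_\<kappa> bij by (metis bij_pointE)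
  show "bij \<kappa>'" by (rule o_bij[of \<kappa>]) (auto simp: fun_eq_iff \<kappa>'_\<kappa> **)
qed

lemma \<tau>_bij: "bij \<tau>"
proof -
  obtain B where B: "finite B" "span B = UNIV" using finite_dim by blast
  have "S 0 = 0" using S_linear(2)[of 0 0] by simp
  then have "h = 0" if "\<tau> h = 0" for h using \<sigma>_eq_0[of h] that by (simp add: \<sigma>_def)
  then show ?thesis by (rule injective_linear_surjective[OF B \<tau>_linear])
qed

lemma \<tau>_mult: "\<tau> (g * h) = \<tau> g * \<tau> h"
proof -
  have "bilinear_on scale scale scale UNIV UNIV (\<lambda>u v. scale (\<alpha> u) v)"
    by (rule bilinear_onI) (simp_all add: linear_simps mult.commute)
  from sw_mult[OF vector_space_axioms this, of g h]
  have "\<tau> (g * h) = sw (\<lambda>u v. sw (\<lambda>p q. scale (\<alpha> u) (v * scale (\<alpha> p) q)) h) g"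
    by (simp add: \<tau>_def \<alpha>_mult mult_scale)
  also have "\<dots> = sw (\<lambda>u v. scale (\<alpha> u) (v * \<tau> h)) g"
  proof (rule sw_cong[OF refl UNIV_I])
    fix u v
    show "sw (\<lambda>p q. scale (\<alpha> u) (v * scale (\<alpha> p) q)) h = scale (\<alpha> u) (v * \<tau> h)"
      unfolding \<tau>_def by (rule sw_push[symmetric]) (simp add: distrib_left linear_simps)
  qed
  also have "\<dots> = \<tau> g * \<tau> h"
    by (rule linear_\<tau>[symmetric]) (simp add: linear_on_def distrib_right linear_simps)
  finally show ?thesis .
qed

lemma \<kappa>'_mult: "\<kappa>' (g * h) = \<kappa>' g * \<kappa>' h"
proof -
  have "bilinear_on scale scale scale UNIV UNIV (\<lambda>u v. scale (\<alpha> v) u)"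
    by (rule bilinear_onI) (simp_all add: linear_simps mult.commute)
  from sw_mult[OF vector_space_axioms this, of g h]
  have "\<kappa>' (g * h) = sw (\<lambda>u v. sw (\<lambda>p q. scale (\<alpha> v) (u * scale (\<alpha> q) p)) h) g"
    by (simp add: \<kappa>'_def \<alpha>_mult mult_scale)
  also have "\<dots> = sw (\<lambda>u v. scale (\<alpha> v) (u * \<kappa>' h)) g"
  proof (rule sw_cong[OF refl UNIV_I])
    fix u v
    show "sw (\<lambda>p q. scale (\<alpha> v) (u * scale (\<alpha> q) p)) h = scale (\<alpha> v) (u * \<kappa>' h)"
      unfolding \<kappa>'_def by (rule sw_push[symmetric]) (simp add: distrib_left linear_simps)
  qed
  also have "\<dots> = \<kappa>' g * \<kappa>' h"
    by (rule linear_\<kappa>'[symmetric]) (simp add: linear_on_def distrib_right linear_simps)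
  finally show ?thesis .
qed

lemma \<kappa>_mult: "\<kappa> (g * h) = \<kappa> g * \<kappa> h"
  using \<kappa>'_mult[of "\<kappa> g" "\<kappa> h"] by (metis \<kappa>'_\<kappa> \<kappa>_\<kappa>')

text \<open>
  \<open>\<tau>\<close> is a comodule map for the right regular coaction; likewise \<open>\<kappa>'\<close> for the left one.  Such a map
  is determined by its composition with the counit.
\<close>

lemma sw_\<tau>:
  assumes t: "vector_space t" and \<beta>: "bilinear_on scale scale t UNIV UNIV \<beta>"
  shows "sw \<beta> (\<tau> h) = sw (\<lambda>u v. \<beta> (\<tau> u) v) h"
proof -
  note b = bilinear_UNIV_simps[OF \<beta>]
  interpret t: vector_space t by fact
  have "sw \<beta> (\<tau> h) = sw (\<lambda>u v. sw (\<lambda>p q. t (\<alpha> u) (\<beta> p q)) v) h"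
    unfolding linear_\<tau>[OF sw_linear[OF t \<beta>]] by (simp only: sw_scale[OF t])
  also have "\<dots> = sw (\<lambda>u v. sw (\<lambda>p q. t (\<alpha> p) (\<beta> q v)) u) h"
    by (rule sw_coassoc[OF t _ UNIV_I, symmetric], rule trilinear_onI)
      (simp_all add: b linear_simps algebra_simps)
  also have "\<dots> = sw (\<lambda>u v. \<beta> (\<tau> u) v) h"
    by (rule sw_cong[OF refl UNIV_I], rule linear_\<tau>[symmetric]) (simp add: linear_on_def b)
  finally show ?thesis .
qed

lemma sw_\<kappa>':
  assumes t: "vector_space t" and \<beta>: "bilinear_on scale scale t UNIV UNIV \<beta>"
  shows "sw \<beta> (\<kappa>' h) = sw (\<lambda>u v. \<beta> u (\<kappa>' v)) h"
proof -
  note b = bilinear_UNIV_simps[OF \<beta>]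
  interpret t: vector_space t by fact
  have "sw \<beta> (\<kappa>' h) = sw (\<lambda>u v. sw (\<lambda>p q. t (\<alpha> v) (\<beta> p q)) u) h"
    unfolding linear_\<kappa>'[OF sw_linear[OF t \<beta>]] by (simp only: sw_scale[OF t])
  also have "\<dots> = sw (\<lambda>u v. sw (\<lambda>p q. t (\<alpha> q) (\<beta> u p)) v) h"
    by (rule sw_coassoc[OF t _ UNIV_I], rule trilinear_onI)
      (simp_all add: b linear_simps algebra_simps)
  also have "\<dots> = sw (\<lambda>u v. \<beta> u (\<kappa>' v)) h"
    by (rule sw_cong[OF refl UNIV_I], rule linear_\<kappa>'[symmetric]) (simp add: linear_on_def b)
  finally show ?thesis .
qed

lemma \<tau>_one: "\<tau> 1 = 1"
proof -
  have "bilinear_on scale scale scale UNIV UNIV (\<lambda>u v. scale (\<alpha> u) v)"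
    by (rule bilinear_onI) (simp_all add: linear_simps mult.commute)
  from sw_unit[OF vector_space_axioms this] show ?thesis by (simp add: \<tau>_def \<alpha>_one)
qed

lemma \<epsilon>_\<tau>: "\<epsilon> (\<tau> h) = \<alpha> h"
  unfolding linear_\<tau>[OF counit_linear]
  using sw_counit_right[OF vector_space_field functional_\<alpha>, of h] by (simp add: mult.commute)

text \<open>
  Both sides are convolution inverses of the algebra map \<open>\<tau>\<close>: the left side because
  \<open>\<Sum> \<tau>(S(h')) \<tau>(h'') = \<tau>(\<epsilon>(h) 1)\<close>, the right side by a direct computation.
\<close>

lemma \<tau>_S: "\<tau> (S h) = S (\<kappa> h)"
proof -
  note lin = linear_simps linear_on_def \<tau>_linear[unfolded linear_on_def, simplified]
    \<kappa>_linear[unfolded linear_on_def, simplified]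
  have left: "sw (\<lambda>u v. \<tau> (S u) * \<tau> v) k = scale (\<epsilon> k) 1" for k
    using sw_antipode_left[OF vector_space_axioms \<tau>_linear, of k] by (simp add: \<tau>_mult \<tau>_one)
  have S\<kappa>: "S (\<kappa> v) = sw (\<lambda>p q. scale (\<alpha> (S q)) (S p)) v" for v
    by (rule linear_\<kappa>) (simp add: lin)
  have right: "sw (\<lambda>u v. \<tau> u * S (\<kappa> v)) k = scale (\<epsilon> k) 1" for k
  proof -
    have "sw (\<lambda>u v. \<tau> u * S (\<kappa> v)) k = sw (\<lambda>u v. sw (\<lambda>p q. scale (\<alpha> (S q)) (\<tau> u * S p)) v) k"
      by (rule sw_cong[OF refl UNIV_I], rule linear_\<kappa>) (simp add: lin algebra_simps)
    also have "\<dots> = sw (\<lambda>u v. sw (\<lambda>p q. scale (\<alpha> (S v)) (\<tau> p * S q)) u) k"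
      by (rule sw_coassoc_H[symmetric], rule trilinear_onI) (simp_all add: lin algebra_simps)
    also have "\<dots> = sw (\<lambda>u v. scale (\<alpha> (u * S v)) 1) k"
    proof (rule sw_cong[OF refl UNIV_I])
      fix u v
      have "bilinear_on scale scale scale UNIV UNIV (\<lambda>p q. p * S q)"
        by (rule bilinear_onI) (simp_all add: linear_simps algebra_simps)
      then have "sw (\<lambda>p q. \<tau> p * S q) u = sw (\<lambda>p q. p * S q) (\<tau> u)"
        by (rule sw_\<tau>[OF vector_space_axioms, symmetric])
      also have "\<dots> = scale (\<alpha> u) 1"
        using sw_antipode_right[OF vector_space_axioms, of "\<lambda>h. h" "\<tau> u"]
        by (simp add: linear_on_def \<epsilon>_\<tau>)
      finally show "sw (\<lambda>p q. scale (\<alpha> (S v)) (\<tau> p * S q)) u = scale (\<alpha> (u * S v)) 1"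
        by (simp add: sw_scale[OF vector_space_axioms] \<alpha>_mult mult.commute)
    qed
    also have "\<dots> = scale (\<epsilon> k) 1"
      using sw_antipode_right[OF vector_space_axioms, of "\<lambda>h. scale (\<alpha> h) 1" k]
      by (simp add: lin \<alpha>_one)
    finally show ?thesis .
  qed
  have "\<tau> (S h) = sw (\<lambda>u v. scale (\<epsilon> v) (\<tau> (S u))) h"
    by (rule sw_counit_right[OF vector_space_axioms, symmetric]) (simp_all add: lin)
  also have "\<dots> = sw (\<lambda>u v. sw (\<lambda>p q. \<tau> (S u) * (\<tau> p * S (\<kappa> q))) v) h"
  proof (rule sw_cong[OF refl UNIV_I])
    fix u v
    have "sw (\<lambda>p q. \<tau> (S u) * (\<tau> p * S (\<kappa> q))) v = \<tau> (S u) * sw (\<lambda>p q. \<tau> p * S (\<kappa> q)) v"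
      by (rule sw_push[symmetric]) (simp add: distrib_left)
    then show "scale (\<epsilon> v) (\<tau> (S u)) = sw (\<lambda>p q. \<tau> (S u) * (\<tau> p * S (\<kappa> q))) v"
      by (simp add: right mult_scale)
  qed
  also have "\<dots> = sw (\<lambda>u v. sw (\<lambda>p q. \<tau> (S p) * (\<tau> q * S (\<kappa> v))) u) h"
    by (rule sw_coassoc_H[symmetric], rule trilinear_onI) (simp_all add: lin algebra_simps)
  also have "\<dots> = sw (\<lambda>u v. scale (\<epsilon> u) (S (\<kappa> v))) h"
  proof (rule sw_cong[OF refl UNIV_I])
    fix u v
    have "sw (\<lambda>p q. \<tau> (S p) * \<tau> q * S (\<kappa> v)) u = sw (\<lambda>p q. \<tau> (S p) * \<tau> q) u * S (\<kappa> v)"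
      by (rule sw_push[symmetric, of "\<lambda>y. y * S (\<kappa> v)"]) (simp add: distrib_right)
    then show "sw (\<lambda>p q. \<tau> (S p) * (\<tau> q * S (\<kappa> v))) u = scale (\<epsilon> u) (S (\<kappa> v))"
      by (simp add: left mult_scale mult.assoc)
  qed
  also have "\<dots> = S (\<kappa> h)"
    by (rule sw_counit_left[OF vector_space_axioms]) (simp_all add: lin)
  finally show ?thesis .
qed

text \<open>
  The twist \<open>\<alpha>\<^sup>-\<^sup>1 \<rightharpoonup> h \<leftharpoonup> \<alpha>\<close>.
\<close>

definition \<omega> :: "'h \<Rightarrow> 'h" where
  "\<omega> h = \<tau> (\<kappa> h)"

lemma \<sigma>_\<sigma>: "\<sigma> (\<sigma> h) = S (S (\<omega> h))"
  by (simp add: \<sigma>_def \<tau>_S \<omega>_def \<tau>_\<kappa>)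

lemma \<omega>_eq_hits: "\<omega> h = hit_right scale UNIV \<Delta> (hit_left scale UNIV \<Delta> (\<alpha> \<circ> S) h) \<alpha>"
proof -
  have "hit_left scale UNIV \<Delta> (\<alpha> \<circ> S) h = \<kappa> h"
    unfolding hit_left_def \<kappa>_def o_def
    by (rule sweedler_eq_sw[OF vector_space_axioms _ UNIV_I], rule bilinear_onI)
      (simp_all add: linear_simps mult.commute)
  moreover have "hit_right scale UNIV \<Delta> k \<alpha> = \<tau> k" for k
    unfolding hit_right_def \<tau>_def
    by (rule sweedler_eq_sw[OF vector_space_axioms _ UNIV_I], rule bilinear_onI)
      (simp_all add: linear_simps mult.commute)
  ultimately show ?thesis by (simp add: \<omega>_def)
qed

text \<open>
  Radford's formula: since \<open>\<sigma>\<^sup>4\<close> is \<open>S\<^sup>4\<close> composed with \<open>\<omega>\<^sup>2\<close>, it says that \<open>S\<^sup>4\<close> agrees with \<open>\<omega>\<^sup>-\<^sup>1\<close> up to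
  conjugation by \<open>g\<close>.
\<close>

lemma \<omega>_gl: "\<omega> h * gl = gl * \<sigma> (\<sigma> (\<sigma> (\<sigma> h)))"
  using gl_conjugation[of "\<omega> h"] by (simp add: \<sigma>_\<sigma>[of h])

lemma \<omega>_mult: "\<omega> (g * h) = \<omega> g * \<omega> h"
  by (simp add: \<omega>_def \<tau>_mult \<kappa>_mult)

lemma \<omega>_one: "\<omega> 1 = 1"
proof -
  have "bilinear_on scale scale scale UNIV UNIV (\<lambda>u v. scale (\<alpha> v) u)"
    by (rule bilinear_onI) (simp_all add: linear_simps mult.commute)
  from sw_unit[OF vector_space_axioms this] have "\<kappa>' 1 = 1" by (simp add: \<kappa>'_def \<alpha>_one)
  then have "\<kappa> 1 = 1" using \<kappa>_\<kappa>'[of 1] by simp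
  then show ?thesis by (simp add: \<omega>_def \<tau>_one)
qed

lemma \<omega>_fixes_gl: "\<omega> gl = gl"
proof -
  have "bilinear_on scale scale scale UNIV UNIV (\<lambda>u v. scale (\<alpha> u) v)"
    and "bilinear_on scale scale scale UNIV UNIV (\<lambda>u v. scale (\<alpha> (S v)) u)"
    by (rule bilinear_onI; simp add: linear_simps mult.commute)+
  from this[THEN sw_gl[OF vector_space_axioms]]
  have "\<tau> gl = scale (\<alpha> gl) gl" "\<kappa> gl = scale (\<alpha> (S gl)) gl" by (simp_all add: \<tau>_def \<kappa>_def)
  then have "\<omega> gl = scale (\<alpha> (S gl * gl)) gl"
    using \<tau>_linear by (simp add: \<omega>_def linear_on_def \<alpha>_mult)
  then show ?thesis by (simp add: gl_inverse \<alpha>_one)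
qed

text \<open>
  Iterating Radford's formula is possible because \<open>\<omega>\<close> is multiplicative and fixes \<open>g\<close>.
\<close>

lemma \<omega>_power_gl: "(\<omega> ^^ m) h * gl ^ m = gl ^ m * ((\<sigma> ^^ 4) ^^ m) h"
proof (induction m)
  case 0
  show ?case by simp
next
  case (Suc m)
  have gl_pow: "\<omega> (gl ^ n) = gl ^ n" for n
    by (induction n) (simp_all add: \<omega>_mult \<omega>_fixes_gl \<omega>_one)
  have "(\<omega> ^^ Suc m) h * gl ^ Suc m = \<omega> ((\<omega> ^^ m) h) * \<omega> (gl ^ m) * gl"
    by (simp add: gl_pow power_commutes mult.assoc)
  also have "\<dots> = gl ^ m * (\<omega> (((\<sigma> ^^ 4) ^^ m) h) * gl)"
    by (simp add: \<omega>_mult[symmetric] Suc) (simp add: \<omega>_mult gl_pow mult.assoc)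
  also have "\<dots> = gl ^ Suc m * ((\<sigma> ^^ 4) ^^ Suc m) h"
    by (simp add: \<omega>_gl mult.assoc[symmetric] power_commutes numeral_eq_Suc)
  finally show ?case .
qed

text \<open>
  The functionals \<open>\<epsilon> \<circ> T\<^sup>n\<close> are multiplicative, so two of them coincide.
\<close>

lemma finite_order_from_counit:
  assumes lin: "linear_on scale scale UNIV T" and mult: "\<And>g h. T (g * h) = T g * T h" and bij: "bij T"
    and counit: "\<And>i j. (\<And>h. \<epsilon> ((T ^^ i) h) = \<epsilon> ((T ^^ j) h)) \<Longrightarrow> T ^^ i = T ^^ j"
  shows "\<exists>m>0. T ^^ m = id"
proof -
  obtain B where B: "finite B" "span B = UNIV" using finite_dim by blast
  interpret K: vector_space "(*) :: 'k \<Rightarrow> 'k \<Rightarrow> 'k" by (rule vector_space_field)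
  interpret p: vector_space "pointwise_scale (*) :: 'k \<Rightarrow> ('h \<Rightarrow> 'k) \<Rightarrow> _"
    by (rule vector_space_pointwise[OF vector_space_field])
  have span1: "K.span {1} = UNIV"
    using K.span_breakdown_eq[of _ "1::'k" "{}"] by auto
  obtain F where F: "finite F" and F_span: "\<And>f. functional f \<Longrightarrow> f \<in> p.span F"
    using finite_span_linear_maps[OF vector_space_axioms vector_space_field B _ span1] by blast
  have one: "T 1 = 1"
    using bij mult by (metis bij_pointE mult_1 mult_1_right)
  have pow: "(T ^^ n) (g * h) = (T ^^ n) g * (T ^^ n) h" "(T ^^ n) 1 = 1"
    "functional (\<lambda>h. \<epsilon> ((T ^^ n) h))" for n g h
  proof -
    show "(T ^^ n) (g * h) = (T ^^ n) g * (T ^^ n) h" by (induction n) (simp_all add: mult)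
    show "(T ^^ n) 1 = 1" by (induction n) (simp_all add: one)
    have "linear_on scale scale UNIV (T ^^ n)"
      using lin by (induction n) (simp_all add: linear_on_def)
    then show "functional (\<lambda>h. \<epsilon> ((T ^^ n) h))" by (simp add: linear_on_def linear_simps)
  qed
  have "\<exists>i j. i < j \<and> (\<lambda>h. \<epsilon> ((T ^^ i) h)) = (\<lambda>h. \<epsilon> ((T ^^ j) h))"
  proof (rule multiplicative_sequence_repeats[OF vector_space_field, where m = "(*)" and F = F])
    show "\<epsilon> ((T ^^ n) (g * h)) = \<epsilon> ((T ^^ n) g) * \<epsilon> ((T ^^ n) h)" for n g h
      by (simp add: pow counit_mult)
    show "(\<lambda>h. \<epsilon> ((T ^^ n) h)) \<noteq> 0" for n
      using pow(2)[of n] counit_unit by (metis zero_fun_apply zero_neq_one)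
    show "range (\<lambda>n h. \<epsilon> ((T ^^ n) h)) \<subseteq> p.span F" using F_span pow(3) by blast
    fix \<Phi> :: "('h \<Rightarrow> 'k) set" and b \<phi>
    assume \<Phi>: "finite \<Phi>" "p.independent \<Phi>" "\<And>y. (\<Sum>\<phi>\<in>\<Phi>. b \<phi> * \<phi> y) = 0" "\<phi> \<in> \<Phi>"
    have "(\<Sum>\<phi>\<in>\<Phi>. pointwise_scale (*) (b \<phi>) \<phi>) = 0"
      by (rule ext) (simp add: sum_apply pointwise_scale_def \<Phi>(3))
    then show "b \<phi> = 0" using p.independentD[OF \<Phi>(2,1) order.refl _ \<Phi>(4)] by blast
  next
    show "c * a * b = c * (a * b)" "a * (c * b) = c * (a * b)" for a b c :: 'k
      by (rule mult.assoc) (rule mult.left_commute)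
  qed (rule F)
  then obtain i j where ij: "i < j" "T ^^ i = T ^^ j" using counit by metis
  then show ?thesis using bij_funpow_repeat[OF bij ij] by (intro exI[of _ "j - i"]) simp
qed

lemma \<tau>_finite_order: "\<exists>m>0. \<tau> ^^ m = id"
proof (rule finite_order_from_counit[OF \<tau>_linear \<tau>_mult \<tau>_bij])
  have lin: "linear_on scale scale UNIV (\<tau> ^^ n)" for n
    using \<tau>_linear by (induction n) (simp_all add: linear_on_def)
  have bil: "bilinear_on scale scale scale UNIV UNIV (\<lambda>u v. scale (\<epsilon> ((\<tau> ^^ n) u)) v)" for n
    using lin[of n] by (intro bilinear_onI) (simp_all add: linear_on_def linear_simps mult.commute)
  have "(\<tau> ^^ n) h = sw (\<lambda>u v. scale (\<epsilon> ((\<tau> ^^ n) u)) v) h" for n h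
  proof -
    have "sw (\<lambda>u v. scale (\<epsilon> u) v) ((\<tau> ^^ n) h) = sw (\<lambda>u v. scale (\<epsilon> ((\<tau> ^^ n) u)) v) h"
    proof (induction n arbitrary: h)
      case (Suc n)
      have "sw (\<lambda>u v. scale (\<epsilon> u) v) ((\<tau> ^^ Suc n) h) = sw (\<lambda>u v. scale (\<epsilon> ((\<tau> ^^ n) u)) v) (\<tau> h)"
        using Suc[of "\<tau> h"] by (simp add: funpow_swap1)
      then show ?case using sw_\<tau>[OF vector_space_axioms bil, of n h] by (simp add: funpow_swap1)
    qed simp
    then show ?thesis
      using sw_counit_left[OF vector_space_axioms, of "\<lambda>h. h" "(\<tau> ^^ n) h"] by (simp add: linear_on_def)
  qed
  note counit = this
  show "\<tau> ^^ i = \<tau> ^^ j" if eq: "\<And>h. \<epsilon> ((\<tau> ^^ i) h) = \<epsilon> ((\<tau> ^^ j) h)" for i j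
  proof
    fix h
    have "(\<tau> ^^ i) h = sw (\<lambda>u v. scale (\<epsilon> ((\<tau> ^^ i) u)) v) h" by (rule counit)
    also have "\<dots> = sw (\<lambda>u v. scale (\<epsilon> ((\<tau> ^^ j) u)) v) h" by (simp only: eq)
    also have "\<dots> = (\<tau> ^^ j) h" by (rule counit[symmetric])
    finally show "(\<tau> ^^ i) h = (\<tau> ^^ j) h" .
  qed
qed

lemma \<kappa>'_finite_order: "\<exists>m>0. \<kappa>' ^^ m = id"
proof (rule finite_order_from_counit[OF \<kappa>'_linear \<kappa>'_mult \<kappa>'_bij])
  have lin: "linear_on scale scale UNIV (\<kappa>' ^^ n)" for n
    using \<kappa>'_linear by (induction n) (simp_all add: linear_on_def)
  have bil: "bilinear_on scale scale scale UNIV UNIV (\<lambda>u v. scale (\<epsilon> ((\<kappa>' ^^ n) v)) u)" for n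
    using lin[of n] by (intro bilinear_onI) (simp_all add: linear_on_def linear_simps mult.commute)
  have "(\<kappa>' ^^ n) h = sw (\<lambda>u v. scale (\<epsilon> ((\<kappa>' ^^ n) v)) u) h" for n h
  proof -
    have "sw (\<lambda>u v. scale (\<epsilon> v) u) ((\<kappa>' ^^ n) h) = sw (\<lambda>u v. scale (\<epsilon> ((\<kappa>' ^^ n) v)) u) h"
    proof (induction n arbitrary: h)
      case (Suc n)
      have "sw (\<lambda>u v. scale (\<epsilon> v) u) ((\<kappa>' ^^ Suc n) h) = sw (\<lambda>u v. scale (\<epsilon> ((\<kappa>' ^^ n) v)) u) (\<kappa>' h)"
        using Suc[of "\<kappa>' h"] by (simp add: funpow_swap1)
      then show ?case using sw_\<kappa>'[OF vector_space_axioms bil, of n h] by (simp add: funpow_swap1)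
    qed simp
    then show ?thesis
      using sw_counit_right[OF vector_space_axioms, of "\<lambda>h. h" "(\<kappa>' ^^ n) h"] by (simp add: linear_on_def)
  qed
  note counit = this
  show "\<kappa>' ^^ i = \<kappa>' ^^ j" if eq: "\<And>h. \<epsilon> ((\<kappa>' ^^ i) h) = \<epsilon> ((\<kappa>' ^^ j) h)" for i j
  proof
    fix h
    have "(\<kappa>' ^^ i) h = sw (\<lambda>u v. scale (\<epsilon> ((\<kappa>' ^^ i) v)) u) h" by (rule counit)
    also have "\<dots> = sw (\<lambda>u v. scale (\<epsilon> ((\<kappa>' ^^ j) v)) u) h" by (simp only: eq)
    also have "\<dots> = (\<kappa>' ^^ j) h" by (rule counit[symmetric])
    finally show "(\<kappa>' ^^ i) h = (\<kappa>' ^^ j) h" .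
  qed
qed

lemma \<omega>_finite_order: "\<exists>m>0. \<omega> ^^ m = id"
proof -
  obtain a where a: "a > 0" "\<tau> ^^ a = id" using \<tau>_finite_order by blast
  obtain b where b: "b > 0" "\<kappa>' ^^ b = id" using \<kappa>'_finite_order by blast
  have "(\<kappa>' ^^ n) ((\<kappa> ^^ n) h) = h" for n h
  proof (induction n)
    case (Suc n)
    have "(\<kappa>' ^^ Suc n) ((\<kappa> ^^ Suc n) h) = (\<kappa>' ^^ n) (\<kappa>' (\<kappa> ((\<kappa> ^^ n) h)))"
      by (simp only: funpow_Suc_right[of n \<kappa>'] funpow.simps(2)[of n \<kappa>] o_apply)
    then show ?case by (simp add: \<kappa>'_\<kappa> Suc)
  qed simp
  from this[of b] have \<kappa>: "\<kappa> ^^ b = id" by (simp add: b fun_eq_iff)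
  have \<tau>\<kappa>n: "(\<tau> ^^ n) (\<kappa> h) = \<kappa> ((\<tau> ^^ n) h)" for n h
    by (induction n) (simp_all add: \<tau>_\<kappa>)
  have "(\<omega> ^^ n) h = (\<tau> ^^ n) ((\<kappa> ^^ n) h)" for n h
    by (induction n) (simp_all add: \<omega>_def \<tau>\<kappa>n)
  then have "\<omega> ^^ (a * b) = (\<tau> ^^ (a * b)) \<circ> (\<kappa> ^^ (a * b))" by (simp add: fun_eq_iff)
  also have "\<dots> = id"
  proof -
    have "\<tau> ^^ (a * b) = id" by (simp add: funpow_mult[symmetric] a(2))
    moreover have "\<kappa> ^^ (a * b) = id"
      by (subst mult.commute) (simp add: funpow_mult[symmetric] \<kappa>)
    ultimately show ?thesis by simp
  qed
  finally show ?thesis using a b by (intro exI[of _ "a * b"]) simp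
qed

end

section \<open>The Nakayama automorphism of a Galois algebra\<close>

locale dual_galois_with_integral =
  dual_galois_module_algebra scale UNIV "(*)" 1 \<Delta> \<epsilon> S scaleA act
  for scale :: "'k::field \<Rightarrow> 'h::ring_1 \<Rightarrow> 'h"
    and \<Delta> :: "'h \<Rightarrow> ('h, 'h, 'k) tensor" and \<epsilon> :: "'h \<Rightarrow> 'k" and S :: "'h \<Rightarrow> 'h"
    and scaleA :: "'k \<Rightarrow> 'a::ring_1 \<Rightarrow> 'a" and act :: "'h \<Rightarrow> 'a \<Rightarrow> 'a"  (infixr \<open>\<cdot>\<close> 75) +
  fixes x :: 'h and \<alpha> :: "'h \<Rightarrow> 'k"
  assumes left_integral_x: "left_integral scale UNIV (*) \<epsilon> x"
    and modular_\<alpha>: "modular_function scale UNIV (*) 1 x \<alpha>"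

sublocale dual_galois_with_integral \<subseteq> hopf_algebra_with_integral scale \<Delta> \<epsilon> S x \<alpha>
  by unfold_locales (use finite_dimensional left_integral_x modular_\<alpha> in auto)

context dual_galois_with_integral
begin

lemmas act_lin = act_linear[OF UNIV_I, simplified]

lemma canonical_map_sum_list:
  "tensor_lift scaleA scale UNIV UNIV (\<lambda>a h. \<lambda>b. a * (h \<cdot> b)) (\<Sum>(u, w)\<leftarrow>ps. tensor scaleA scale u w)
    = (\<lambda>b. \<Sum>(u, w)\<leftarrow>ps. u * (w \<cdot> b))"
proof -
  let ?\<beta> = "\<lambda>a h. \<lambda>b. a * (h \<cdot> b)"
  have P: "vector_space (pointwise_scale scaleA :: 'k \<Rightarrow> ('a \<Rightarrow> 'a) \<Rightarrow> _)"
    by (rule vector_space_pointwise[OF A.vector_space_axioms])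
  have \<beta>: "bilinear_on scaleA scale (pointwise_scale scaleA) UNIV UNIV ?\<beta>"
    by (rule bilinear_onI)
      (auto simp: fun_eq_iff pointwise_scale_def act_lin scaleA_mult algebra_simps)
  have "tensor_lift scaleA scale UNIV UNIV ?\<beta> (\<Sum>(u, w)\<leftarrow>ps. tensor scaleA scale u w)
      = (\<Sum>(u, w)\<leftarrow>ps. ?\<beta> u w)"
    by (rule tensor_lift_sum[OF A.vector_space_axioms vector_space_axioms P _ _ \<beta>]) auto
  moreover have "(\<Sum>(u, w)\<leftarrow>ps. ?\<beta> u w) b = (\<Sum>(u, w)\<leftarrow>ps. ?\<beta> u w b)" for b
    by (induction ps) auto
  ultimately show ?thesis by (simp add: fun_eq_iff)
qed

text \<open>
  Injectivity of the canonical map: a relation between the maps \<open>b \<mapsto> a (h b)\<close> holds already in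
  \<open>A \<otimes> H\<close>, where it may be contracted by a functional on \<open>H\<close>.
\<close>

lemma smash_product_relation:
  assumes zero: "\<And>b. (\<Sum>(a, h)\<leftarrow>ps. a * (h \<cdot> b)) = 0" and f: "functional f"
  shows "(\<Sum>(a, h)\<leftarrow>ps. scaleA (f h) a) = 0"
proof -
  let ?t = "tensor scaleA scale"
  have mem: "(\<Sum>(u, w)\<leftarrow>qs. ?t u w) \<in> tensor_space scaleA scale UNIV UNIV" for qs
  proof -
    interpret T: vector_space "tensor_scale :: 'k \<Rightarrow> ('a, 'h, 'k) tensor \<Rightarrow> _"
      by (rule vector_space_pointwise[OF vector_space_field])
    show ?thesis
    proof (induction qs)
      case Nil
      show ?case
        by (simp only: list.map sum_list.Nil T.subspace_0[OF subspace_tensor_space])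
    next
      case (Cons q qs)
      show ?case
        using T.subspace_add[OF subspace_tensor_space tensor_in_tensor_space[OF UNIV_I UNIV_I] Cons]
        by (simp only: list.map sum_list.Cons case_prod_unfold)
    qed
  qed
  have eq: "(\<Sum>(u, w)\<leftarrow>ps. ?t u w) = (\<Sum>(u, w)\<leftarrow>[]. ?t u w)"
  proof (rule inj_onD[OF bij_betw_imp_inj_on[OF galois] _ mem mem])
    show "tensor_lift scaleA scale UNIV UNIV (\<lambda>a h b. a * h \<cdot> b) (\<Sum>(u, w)\<leftarrow>ps. ?t u w)
        = tensor_lift scaleA scale UNIV UNIV (\<lambda>a h b. a * h \<cdot> b) (\<Sum>(u, w)\<leftarrow>[]. ?t u w)"
      unfolding canonical_map_sum_list by (simp add: zero)
  qed
  have "bilinear_on scaleA scale scaleA UNIV UNIV (\<lambda>a h. scaleA (f h) a)"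
    by (rule bilinear_onI) (simp_all add: functionalD[OF f] algebra_simps)
  from tensor_relation[OF A.vector_space_axioms vector_space_axioms A.vector_space_axioms _ _ this _ _ eq]
  show ?thesis by simp
qed

text \<open>
  Surjectivity of the canonical map.
\<close>

lemma linear_map_from_smash_product:
  assumes "linear_on scaleA scaleA UNIV F"
  obtains ps where "\<And>b. F b = (\<Sum>(a, h)\<leftarrow>ps. a * (h \<cdot> b))"
proof -
  have "F \<in> Endo scaleA"
    using assms linear_on_UNIV_iff[OF A.vector_space_axioms A.vector_space_axioms]
    by (simp add: Endo_def)
  then obtain t where t: "t \<in> tensor_space scaleA scale UNIV UNIV"
    "F = tensor_lift scaleA scale UNIV UNIV (\<lambda>a h. \<lambda>b. a * (h \<cdot> b)) t"
    using galois unfolding bij_betw_def by blast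
  obtain ps where ps: "t = (\<Sum>(u, w)\<leftarrow>ps. tensor scaleA scale u w)"
    using tensor_space_elim[OF A.vector_space_axioms _ t(1)] by auto
  show thesis using that[of ps] unfolding t(2) ps canonical_map_sum_list by simp
qed

text \<open>
  Right multiplication by an invariant commutes with all maps \<open>b \<mapsto> c (h b)\<close>, hence with the
  rank-one projection \<open>F\<close> onto the scalars.
\<close>

lemma invariant_is_scalar:
  assumes a: "\<And>h. h \<cdot> a = scaleA (\<epsilon> h) a"
  shows "\<exists>c. a = scaleA c 1"
proof -
  obtain f where f: "linear_on scaleA (*) UNIV f" "f 1 = 1"
    using A.functional_separates[OF A.unit_nonzero] .
  define F where "F b = scaleA (f b) 1" for b
  have "linear_on scaleA scaleA UNIV F"
    using f(1) by (simp add: F_def linear_on_def algebra_simps)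
  then obtain ps where ps: "\<And>b. F b = (\<Sum>(c, h)\<leftarrow>ps. c * (h \<cdot> b))"
    using linear_map_from_smash_product by blast
  have mult_a: "h \<cdot> (b * a) = (h \<cdot> b) * a" for h b
  proof -
    have "h \<cdot> (b * a) = sw (\<lambda>u v. scaleA (\<epsilon> v) ((u \<cdot> b) * a)) h"
      by (simp add: act_times_sw a scaleA_mult)
    also have "\<dots> = (h \<cdot> b) * a"
      by (rule sw_counit_right[OF A.vector_space_axioms])
        (simp_all add: linear_on_def act_lin scaleA_mult algebra_simps)
    finally show ?thesis .
  qed
  have "F (b * a) = F b * a" for b
    unfolding ps by (induction ps) (auto simp: mult_a algebra_simps)
  from this[of 1] have "scaleA (f a) 1 = a" using f(2) by (simp add: F_def)
  then show ?thesis by metis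
qed

definition \<chi> :: "'a \<Rightarrow> 'k" where
  "\<chi> = integral_functional scaleA act x"

lemma scaleA_one_inject: "scaleA c 1 = scaleA d 1 \<longleftrightarrow> c = d"
  using A.unit_nonzero by simp

lemma x_act: "x \<cdot> a = scaleA (\<chi> a) 1"
proof -
  have "h \<cdot> (x \<cdot> a) = scaleA (\<epsilon> h) (x \<cdot> a)" for h
    using act_mult[of h x a] by (simp add: mult_x act_lin)
  then obtain c where "x \<cdot> a = scaleA c 1" using invariant_is_scalar by blast
  then have "x \<cdot> a = scaleA (THE c. x \<cdot> a = scaleA c 1) 1"
    by (intro theI[of "\<lambda>c. x \<cdot> a = scaleA c 1"]) (auto simp: scaleA_one_inject)
  then show ?thesis by (simp add: \<chi>_def integral_functional_def)
qed

lemma \<chi>_add: "\<chi> (a + b) = \<chi> a + \<chi> b" and \<chi>_scale: "\<chi> (scaleA c a) = c * \<chi> a"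
proof -
  have "scaleA (\<chi> (a + b)) 1 = scaleA (\<chi> a + \<chi> b) 1"
    by (simp only: x_act[symmetric] act_lin A.scale_left_distrib)
  then show "\<chi> (a + b) = \<chi> a + \<chi> b" by (simp only: scaleA_one_inject)
  have "scaleA (\<chi> (scaleA c a)) 1 = scaleA (c * \<chi> a) 1"
    by (simp only: x_act[symmetric] act_lin A.scale_scale[symmetric])
  then show "\<chi> (scaleA c a) = c * \<chi> a" by (simp only: scaleA_one_inject)
qed

lemma \<chi>_zero: "\<chi> 0 = 0"
  using \<chi>_scale[of 0 0] by simp

lemma \<chi>_act: "\<chi> (h \<cdot> a) = \<alpha> h * \<chi> a"
proof -
  have "scaleA (\<chi> (h \<cdot> a)) 1 = (x * h) \<cdot> a"
    by (simp add: x_act act_mult)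
  also have "\<dots> = scaleA (\<alpha> h * \<chi> a) 1"
    by (simp add: x_mult act_lin x_act)
  finally show ?thesis by (simp only: scaleA_one_inject)
qed

lemma \<chi>_transfer: "\<chi> ((h \<cdot> b) * a) = \<chi> (b * (\<sigma> h \<cdot> a))"
proof -
  have "\<chi> ((h \<cdot> b) * a) = sw (\<lambda>u v. \<alpha> u * \<chi> (b * (S v \<cdot> a))) h"
    unfolding act_times_transfer[OF UNIV_I, of h] by (subst sw_push[of \<chi>]) (simp_all add: \<chi>_add \<chi>_act)
  also have "\<dots> = \<chi> (b * (\<sigma> h \<cdot> a))"
    by (rule linear_on_\<sigma>[symmetric])
      (simp add: linear_on_def act_lin distrib_left scaleA_mult \<chi>_add \<chi>_scale)
  finally show ?thesis .
qed

lemma \<chi>_transfer': "\<chi> (b * (h \<cdot> a)) = \<chi> ((inv \<sigma> h \<cdot> b) * a)"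
  using \<chi>_transfer[of "inv \<sigma> h" b a] bij_\<sigma> by (simp add: bij_is_surj surj_f_inv_f)

lemma \<chi>_nonzero: "\<exists>a. \<chi> a = 1"
proof (rule ccontr)
  assume no: "\<not> ?thesis"
  have "\<chi> a = 0" for a
  proof (rule ccontr)
    assume "\<chi> a \<noteq> 0"
    then have "\<chi> (scaleA (inverse (\<chi> a)) a) = 1" by (simp add: \<chi>_scale)
    then show False using no by blast
  qed
  then have "(\<Sum>(a, h)\<leftarrow>[(1, x)]. a * (h \<cdot> b)) = 0" for b by (simp add: x_act)
  moreover obtain f where "functional f" "f x = 1" using functional_separates[OF x_nonzero] .
  ultimately have "(\<Sum>(a, h)\<leftarrow>[(1, x)]. scaleA (f h) a) = 0" by (intro smash_product_relation)
  then show False using \<open>f x = 1\<close> A.unit_nonzero by simp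
qed

text \<open>
  With \<open>\<chi>(a\<^sub>0) = 1\<close>, the functional \<open>\<xi>\<close> is \<open>\<chi>\<close> composed with \<open>b \<mapsto> \<xi>(b) a\<^sub>0\<close>.  Writing the latter as a
  sum of maps \<open>b \<mapsto> c (h b)\<close>, each \<open>h\<close> can be moved to the other factor because \<open>\<sigma>\<close> is surjective.
\<close>

lemma functional_eq_\<chi>_mult:
  assumes \<xi>: "linear_on scaleA (*) UNIV \<xi>"
  shows "\<exists>c. \<forall>b. \<xi> b = \<chi> (c * b)"
proof -
  obtain a0 where a0: "\<chi> a0 = 1" using \<chi>_nonzero by blast
  define F where "F b = scaleA (\<xi> b) a0" for b
  have "linear_on scaleA scaleA UNIV F"
    using \<xi> by (simp add: F_def linear_on_def algebra_simps)
  then obtain ps where ps: "\<And>b. F b = (\<Sum>(c, h)\<leftarrow>ps. c * (h \<cdot> b))"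
    using linear_map_from_smash_product by blast
  have "\<xi> b = \<chi> ((\<Sum>(c, h)\<leftarrow>ps. inv \<sigma> h \<cdot> c) * b)" for b
  proof -
    have "\<xi> b = \<chi> (F b)" by (simp add: F_def \<chi>_scale a0)
    also have "\<dots> = \<chi> ((\<Sum>(c, h)\<leftarrow>ps. inv \<sigma> h \<cdot> c) * b)"
      unfolding ps by (induction ps) (auto simp: \<chi>_zero \<chi>_add \<chi>_transfer' distrib_right)
    finally show ?thesis .
  qed
  then show ?thesis by blast
qed

lemma finite_dim_A: "\<exists>B. finite B \<and> A.span B = UNIV"
proof (rule A.finite_dimensional_if_dual_parametrized[of "\<lambda>c b. \<chi> (c * b)"])
  show "bilinear_on scaleA scaleA (*) UNIV UNIV (\<lambda>c b. \<chi> (c * b))"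
    by (rule bilinear_onI) (simp_all add: distrib_left distrib_right scaleA_mult \<chi>_add \<chi>_scale)
  show "\<exists>u. f = (\<lambda>b. \<chi> (u * b))" if "linear_on scaleA (*) UNIV f" for f
    using functional_eq_\<chi>_mult[OF that] by (auto simp: fun_eq_iff)
qed

text \<open>
  The hypothesis says that \<open>x (c b) = \<Sum> (x' c) (x'' b)\<close> vanishes for all \<open>b\<close>.  Hence
  \<open>\<Sum> \<psi>(x'') x' c = 0\<close>, and \<open>\<Sum> \<psi>(x'') x' = 1\<close>.
\<close>

lemma \<chi>_nondegenerate_left:
  assumes "\<And>a. \<chi> (c * a) = 0"
  shows "c = 0"
proof -
  let ?ps = "map (\<lambda>(u, v). (u \<cdot> c, v)) (coprod_list x)"
  have "(\<Sum>(a, h)\<leftarrow>?ps. a * (h \<cdot> b)) = x \<cdot> (c * b)" for b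
    by (simp add: act_times_sw sw_def o_def case_prod_unfold)
  then have "(\<Sum>(a, h)\<leftarrow>?ps. a * (h \<cdot> b)) = 0" for b by (simp add: x_act assms)
  then have "(\<Sum>(a, h)\<leftarrow>?ps. scaleA (\<psi> h) a) = 0"
    by (rule smash_product_relation) (rule functional_\<psi>)
  then have "sw (\<lambda>u v. scaleA (\<psi> v) (u \<cdot> c)) x = 0"
    by (simp add: sw_def o_def case_prod_unfold)
  also have "sw (\<lambda>u v. scaleA (\<psi> v) (u \<cdot> c)) x = D \<psi> \<cdot> c"
    by (rule linear_D[symmetric]) (simp add: linear_on_def act_lin)
  finally show ?thesis by (simp add: D_\<psi> act_unit)
qed

lemma \<chi>_nondegenerate_right:
  assumes "\<And>a. \<chi> (a * c) = 0"
  shows "c = 0"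
proof (rule A.zero_if_functionals_vanish)
  fix f assume "linear_on scaleA (*) UNIV f"
  then show "f c = 0" using functional_eq_\<chi>_mult assms by metis
qed

lemma \<chi>_diff: "\<chi> (a - b) = \<chi> a - \<chi> b"
  using \<chi>_add[of "a - b" b] by simp

lemma \<chi>_inject_left: "(\<And>a. \<chi> (c * a) = \<chi> (d * a)) \<Longrightarrow> c = d"
  using \<chi>_nondegenerate_left[of "c - d"] by (simp add: left_diff_distrib \<chi>_diff)

lemma \<chi>_inject_right: "(\<And>a. \<chi> (a * c) = \<chi> (a * d)) \<Longrightarrow> c = d"
  using \<chi>_nondegenerate_right[of "c - d"] by (simp add: right_diff_distrib \<chi>_diff)

text \<open>
  What \<open>functional_eq_\<chi>_mult\<close> provides is the inverse \<open>\<nu>\<close>, with \<open>\<chi>(a c) = \<chi>(\<nu>(c) a)\<close>.  Nondegeneracy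
  on the left makes it linear, nondegeneracy on the right injective, and finite dimension bijective.
\<close>

lemma nakayama_automorphism_exists:
  "\<exists>\<theta>. \<forall>a b. \<chi> (b * a) = \<chi> (a * \<theta> b)"
proof -
  have "\<exists>d. \<forall>a. \<chi> (a * c) = \<chi> (d * a)" for c
    by (rule functional_eq_\<chi>_mult) (simp add: linear_on_def distrib_right scaleA_mult \<chi>_add \<chi>_scale)
  then obtain \<nu> where \<nu>: "\<And>a c. \<chi> (a * c) = \<chi> (\<nu> c * a)" by metis
  obtain B where B: "finite B" "A.span B = UNIV" using finite_dim_A by blast
  have "bij \<nu>"
  proof (rule A.injective_linear_surjective[OF B])
    show "linear_on scaleA scaleA UNIV \<nu>"
      by (intro linear_onI \<chi>_inject_left)
        (simp_all add: \<nu>[symmetric] distrib_left distrib_right scaleA_mult \<chi>_add \<chi>_scale)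
    show "c = 0" if "\<nu> c = 0" for c
      by (rule \<chi>_nondegenerate_right, subst \<nu>) (simp add: that \<chi>_zero)
  qed
  then have "\<chi> (b * a) = \<chi> (a * inv \<nu> b)" for a b
    using \<nu>[of a "inv \<nu> b"] by (simp add: bij_is_surj surj_f_inv_f)
  then show ?thesis by blast
qed

definition \<theta> :: "'a \<Rightarrow> 'a" where
  "\<theta> = (SOME \<theta>. \<forall>a b. \<chi> (b * a) = \<chi> (a * \<theta> b))"

lemma \<chi>_\<theta>: "\<chi> (b * a) = \<chi> (a * \<theta> b)"
  using someI_ex[OF nakayama_automorphism_exists] unfolding \<theta>_def by blast

lemma \<theta>_linear: "linear_on scaleA scaleA UNIV \<theta>"
  by (intro linear_onI \<chi>_inject_right)
    (simp_all add: \<chi>_\<theta>[symmetric] distrib_left distrib_right scaleA_mult \<chi>_add \<chi>_scale)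

lemma \<theta>_mult: "\<theta> (a * b) = \<theta> a * \<theta> b"
proof (rule \<chi>_inject_right)
  fix c
  have "\<chi> (c * \<theta> (a * b)) = \<chi> (a * (b * c))" by (simp add: \<chi>_\<theta>[symmetric] mult.assoc)
  also have "\<dots> = \<chi> (b * (c * \<theta> a))" by (subst \<chi>_\<theta>) (simp add: mult.assoc)
  also have "\<dots> = \<chi> (c * (\<theta> a * \<theta> b))" by (subst \<chi>_\<theta>) (simp add: mult.assoc)
  finally show "\<chi> (c * \<theta> (a * b)) = \<chi> (c * (\<theta> a * \<theta> b))" .
qed

lemma \<theta>_one: "\<theta> 1 = 1"
  by (rule \<chi>_inject_right) (simp add: \<chi>_\<theta>[symmetric])

lemma \<theta>_bij: "bij \<theta>"
proof -
  obtain B where B: "finite B" "A.span B = UNIV" using finite_dim_A by blast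
  show ?thesis
  proof (rule A.injective_linear_surjective[OF B \<theta>_linear])
    show "c = 0" if "\<theta> c = 0" for c
      by (rule \<chi>_nondegenerate_left, subst \<chi>_\<theta>) (simp add: that \<chi>_zero)
  qed
qed

text \<open>
  Moving \<open>h\<close> once around the cyclic form \<open>\<chi>(b a) = \<chi>(a \<theta>(b))\<close> applies \<open>\<sigma>\<close> twice.
\<close>

lemma \<theta>_act: "\<theta> (h \<cdot> b) = \<sigma> (\<sigma> h) \<cdot> \<theta> b"
proof (rule \<chi>_inject_right)
  fix a
  have "\<chi> (a * \<theta> (h \<cdot> b)) = \<chi> (b * (\<sigma> h \<cdot> a))" by (simp add: \<chi>_\<theta>[symmetric] \<chi>_transfer)
  also have "\<dots> = \<chi> (a * (\<sigma> (\<sigma> h) \<cdot> \<theta> b))" by (subst \<chi>_\<theta>) (rule \<chi>_transfer)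
  finally show "\<chi> (a * \<theta> (h \<cdot> b)) = \<chi> (a * (\<sigma> (\<sigma> h) \<cdot> \<theta> b))" .
qed

lemma act_inject: "(\<And>a. h \<cdot> a = g \<cdot> a) \<Longrightarrow> h = g"
proof -
  assume eq: "\<And>a. h \<cdot> a = g \<cdot> a"
  have "h - g = 0"
  proof (rule zero_if_functionals_vanish)
    fix f assume f: "functional f"
    have "(h - g) \<cdot> a = 0" for a
      using act_lin(3)[of "h - g" g a] eq by simp
    then have "(\<Sum>(a, h)\<leftarrow>[(1, h - g)]. a * (h \<cdot> b)) = 0" for b by simp
    from smash_product_relation[OF this f] show "f (h - g) = 0" using A.unit_nonzero by simp
  qed
  then show ?thesis by simp
qed

text \<open>
  A grouplike element acts by an algebra map, and linear relations among actions of elements of \<open>H\<close>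
  with coefficients in \<open>A\<close> are trivial.
\<close>

lemma gl_finite_order: "\<exists>m>0. gl ^ m = 1"
proof -
  interpret p: vector_space "pointwise_scale scaleA :: 'k \<Rightarrow> ('a \<Rightarrow> 'a) \<Rightarrow> _"
    by (rule vector_space_pointwise[OF A.vector_space_axioms])
  interpret P: vector_space_pair "pointwise_scale scaleA :: 'k \<Rightarrow> ('a \<Rightarrow> 'a) \<Rightarrow> _" "(*) :: 'k \<Rightarrow> 'k \<Rightarrow> 'k"
    using p.vector_space_axioms vector_space_field by (rule vector_space_pair.intro)
  obtain B where B: "finite B" "A.span B = UNIV" using finite_dim_A by blast
  obtain F where F: "finite F" and F_span: "\<And>f. linear_on scaleA scaleA UNIV f \<Longrightarrow> f \<in> p.span F"
    using finite_span_linear_maps[OF A.vector_space_axioms A.vector_space_axioms B B] by blast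
  have gl_times: "gl \<cdot> (a * b) = (gl \<cdot> a) * (gl \<cdot> b)" for a b
    unfolding act_times_sw[OF UNIV_I]
    by (rule sw_gl[OF A.vector_space_axioms], rule bilinear_onI)
      (simp_all add: act_lin scaleA_mult algebra_simps)
  have gl_one: "gl \<cdot> 1 = 1" by (simp add: act_one \<epsilon>_gl)
  have "\<exists>i j. i < j \<and> (\<lambda>a. gl ^ i \<cdot> a) = (\<lambda>a. gl ^ j \<cdot> a)"
  proof (rule multiplicative_sequence_repeats[OF A.vector_space_axioms, where m = "(*)" and F = F])
    show "gl ^ n \<cdot> (a * b) = (gl ^ n \<cdot> a) * (gl ^ n \<cdot> b)" for n a b
      by (induction n) (simp_all add: act_unit act_mult gl_times)
    have "gl ^ n \<cdot> 1 = 1" for n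
      by (induction n) (simp_all add: act_unit act_mult gl_one)
    then show "(\<lambda>a. gl ^ n \<cdot> a) \<noteq> 0" for n
      using A.unit_nonzero by (metis zero_fun_apply)
    show "range (\<lambda>n a. gl ^ n \<cdot> a) \<subseteq> p.span F"
      using F_span by (auto simp: linear_on_def act_lin)
    show "finite F" by (rule F)
    show "scaleA c a * b = scaleA c (a * b)" "a * scaleA c b = scaleA c (a * b)" for c a b
      by (rule scaleA_mult)+
    fix \<Phi> b \<phi>
    assume \<Phi>: "\<Phi> \<subseteq> range (\<lambda>n a. gl ^ n \<cdot> a)" "finite \<Phi>" "p.independent \<Phi>"
      and zero: "\<And>y. (\<Sum>\<phi>\<in>\<Phi>. b \<phi> * \<phi> y) = 0" and \<phi>: "\<phi> \<in> \<Phi>"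
    have "\<forall>\<phi>\<in>\<Phi>. \<exists>h. \<phi> = (\<lambda>a. h \<cdot> a)" using \<Phi>(1) by blast
    then obtain h where h: "\<And>\<phi>. \<phi> \<in> \<Phi> \<Longrightarrow> \<phi> = (\<lambda>a. h \<phi> \<cdot> a)" by metis
    \<comment> \<open>A functional on endomorphisms that singles out \<open>\<phi>\<close> restricts to a functional on \<open>H\<close>.\<close>
    obtain G where G: "Vector_Spaces.linear (pointwise_scale scaleA) (*) G"
      "\<And>\<phi>'. \<phi>' \<in> \<Phi> \<Longrightarrow> G \<phi>' = (if \<phi>' = \<phi> then 1 else 0)"
      using P.linear_independent_extend[OF \<Phi>(3), of "\<lambda>\<phi>'. if \<phi>' = \<phi> then 1 else 0"] by blast
    interpret G: Vector_Spaces.linear "pointwise_scale scaleA" "(*)" G by fact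
    obtain xs where xs: "set xs = \<Phi>" "distinct xs" using finite_distinct_list[OF \<Phi>(2)] by blast
    have lists: "(\<Sum>(a, h)\<leftarrow>map (\<lambda>\<phi>. (b \<phi>, h \<phi>)) xs. \<beta> a h) = (\<Sum>\<phi>\<in>\<Phi>. \<beta> (b \<phi>) (h \<phi>))"
      for \<beta> :: "'a \<Rightarrow> 'h \<Rightarrow> 'a"
      using xs by (simp add: o_def sum_list_distinct_conv_sum_set)
    have "(\<Sum>(a, h)\<leftarrow>map (\<lambda>\<phi>. (b \<phi>, h \<phi>)) xs. a * (h \<cdot> y)) = 0" for y
    proof -
      have "(\<Sum>\<phi>\<in>\<Phi>. b \<phi> * (h \<phi> \<cdot> y)) = (\<Sum>\<phi>\<in>\<Phi>. b \<phi> * \<phi> y)"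
        by (rule sum.cong[OF refl]) (use h in metis)
      then show ?thesis by (simp only: lists zero)
    qed
    moreover have "functional (\<lambda>h. G (\<lambda>a. h \<cdot> a))"
    proof (rule linear_onI)
      have add: "(\<lambda>a. (g + h) \<cdot> a) = (\<lambda>a. g \<cdot> a) + (\<lambda>a. h \<cdot> a)" for g h
        by (simp add: fun_eq_iff act_lin)
      show "G (\<lambda>a. (g + h) \<cdot> a) = G (\<lambda>a. g \<cdot> a) + G (\<lambda>a. h \<cdot> a)" for g h
        by (simp only: add G.add)
      have scale: "(\<lambda>a. scale c h \<cdot> a) = pointwise_scale scaleA c (\<lambda>a. h \<cdot> a)" for c h
        by (simp add: fun_eq_iff act_lin pointwise_scale_def)
      show "G (\<lambda>a. scale c h \<cdot> a) = c * G (\<lambda>a. h \<cdot> a)" for c h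
        by (simp only: scale G.scale)
    qed
    ultimately have "(\<Sum>(a, h)\<leftarrow>map (\<lambda>\<phi>. (b \<phi>, h \<phi>)) xs. scaleA (G (\<lambda>y. h \<cdot> y)) a) = 0"
      by (rule smash_product_relation)
    then have "(\<Sum>\<phi>'\<in>\<Phi>. scaleA (G (\<lambda>a. h \<phi>' \<cdot> a)) (b \<phi>')) = 0"
      unfolding lists .
    also have "(\<Sum>\<phi>'\<in>\<Phi>. scaleA (G (\<lambda>a. h \<phi>' \<cdot> a)) (b \<phi>')) = (\<Sum>\<phi>'\<in>\<Phi>. if \<phi>' = \<phi> then b \<phi>' else 0)"
    proof (rule sum.cong[OF refl])
      fix \<phi>' assume "\<phi>' \<in> \<Phi>"
      then have "G (\<lambda>a. h \<phi>' \<cdot> a) = (if \<phi>' = \<phi> then 1 else 0)" using h[of \<phi>'] G(2) by metis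
      then show "scaleA (G (\<lambda>a. h \<phi>' \<cdot> a)) (b \<phi>') = (if \<phi>' = \<phi> then b \<phi>' else 0)" by simp
    qed
    finally show "b \<phi> = 0" using \<Phi>(2) \<phi> by simp
  qed
  then obtain i j where ij: "i < j" "(\<lambda>a. gl ^ i \<cdot> a) = (\<lambda>a. gl ^ j \<cdot> a)" by blast
  then have "gl ^ i = gl ^ j" by (intro act_inject) metis
  moreover have "S gl ^ i * gl ^ i = 1"
  proof (induction i)
    case (Suc n)
    have "S gl ^ Suc n * gl ^ Suc n = S gl ^ n * (S gl * gl) * gl ^ n"
      unfolding power_Suc2[of "S gl"] power_Suc[of gl] by (simp only: mult.assoc)
    then show ?case by (simp add: gl_inverse Suc)
  qed simp
  moreover have "gl ^ j = gl ^ i * gl ^ (j - i)" using ij(1) by (simp add: power_add[symmetric])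
  ultimately have "gl ^ (j - i) = 1"
    by (metis mult.assoc mult_1)
  then show ?thesis using ij(1) by (intro exI[of _ "j - i"]) simp
qed

text \<open>
  A relation \<open>\<Sum> b\<^sub>\<phi> \<phi> = 0\<close> persists when the coefficients \<open>b\<^sub>\<phi>\<close> are replaced by \<open>h b\<^sub>\<phi>\<close>, because
  \<open>(h b\<^sub>\<phi>) \<phi>(y) = \<Sum> h' (b\<^sub>\<phi> \<phi>(S(h'') y))\<close>.  Hence it persists under every linear map applied to the
  coefficients, in particular under functionals, and then independence over \<open>k\<close> applies.
\<close>

lemma commuting_maps_independent_over_A:
  assumes \<Phi>: "finite \<Phi>" "\<not> module.dependent (pointwise_scale scaleA) \<Phi>"
    and comm: "\<And>\<phi> h a. \<phi> \<in> \<Phi> \<Longrightarrow> \<phi> (h \<cdot> a) = h \<cdot> \<phi> a"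
    and zero: "\<And>y. (\<Sum>\<phi>\<in>\<Phi>. b \<phi> * \<phi> y) = 0" and \<phi>: "\<phi> \<in> \<Phi>"
  shows "b \<phi> = 0"
proof (rule A.zero_if_functionals_vanish)
  fix \<xi> assume \<xi>: "linear_on scaleA (*) UNIV \<xi>"
  interpret p: vector_space "pointwise_scale scaleA :: 'k \<Rightarrow> ('a \<Rightarrow> 'a) \<Rightarrow> _"
    by (rule vector_space_pointwise[OF A.vector_space_axioms])
  have act_zero: "(\<Sum>\<phi>\<in>\<Phi>. (h \<cdot> b \<phi>) * \<phi> y) = 0" for h y
  proof -
    have sum_sw: "(\<Sum>\<phi>\<in>\<Phi>'. sw (\<beta> \<phi>) h) = sw (\<lambda>u v. \<Sum>\<phi>\<in>\<Phi>'. \<beta> \<phi> u v) h"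
      if "finite \<Phi>'" for \<Phi>' and \<beta> :: "('a \<Rightarrow> 'a) \<Rightarrow> 'h \<Rightarrow> 'h \<Rightarrow> 'a"
      using that by (induction \<Phi>' rule: finite_induct) (simp_all add: sw_add sw_zero)
    have act_sum: "u \<cdot> (\<Sum>\<phi>\<in>\<Phi>'. f \<phi>) = (\<Sum>\<phi>\<in>\<Phi>'. u \<cdot> f \<phi>)" if "finite \<Phi>'" for u \<Phi>' and f :: "('a \<Rightarrow> 'a) \<Rightarrow> 'a"
      using that act_lin(2)[of u 0 0] by (induction \<Phi>' rule: finite_induct) (simp_all add: act_lin)
    have "(\<Sum>\<phi>\<in>\<Phi>. (h \<cdot> b \<phi>) * \<phi> y) = (\<Sum>\<phi>\<in>\<Phi>. sw (\<lambda>u v. u \<cdot> (b \<phi> * \<phi> (S v \<cdot> y))) h)"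
      by (rule sum.cong[OF refl]) (simp add: act_times_transfer comm)
    also have "\<dots> = sw (\<lambda>u v. u \<cdot> (\<Sum>\<phi>\<in>\<Phi>. b \<phi> * \<phi> (S v \<cdot> y))) h"
      unfolding sum_sw[OF \<Phi>(1)] act_sum[OF \<Phi>(1)] ..
    also have "\<dots> = 0" using act_lin(2)[of _ 0 0] by (simp add: zero sw_zero)
    finally show ?thesis .
  qed
  have "linear_on scaleA scaleA UNIV (\<lambda>a. scaleA (\<xi> a) 1)"
    using \<xi> by (simp add: linear_on_def algebra_simps)
  then obtain ps where ps: "\<And>a. scaleA (\<xi> a) 1 = (\<Sum>(c, h)\<leftarrow>ps. c * (h \<cdot> a))"
    using linear_map_from_smash_product by blast
  have "(\<Sum>\<phi>\<in>\<Phi>. scaleA (\<xi> (b \<phi>)) (\<phi> y)) = 0" for y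
  proof -
    have "(\<Sum>\<phi>\<in>\<Phi>. scaleA (\<xi> (b \<phi>)) (\<phi> y)) = (\<Sum>\<phi>\<in>\<Phi>. scaleA (\<xi> (b \<phi>)) 1 * \<phi> y)"
      by (simp add: scaleA_mult)
    also have "\<dots> = 0"
      unfolding ps
    proof (induction ps)
      case (Cons q ps)
      obtain c h where q: "q = (c, h)" by (cases q)
      have "(\<Sum>\<phi>\<in>\<Phi>. c * (h \<cdot> b \<phi>) * \<phi> y) = c * (\<Sum>\<phi>\<in>\<Phi>. (h \<cdot> b \<phi>) * \<phi> y)"
        by (simp add: sum_distrib_left mult.assoc)
      then show ?case using Cons by (simp add: q distrib_right sum.distrib act_zero)
    qed simp
    finally show ?thesis .
  qed
  then have "(\<Sum>\<phi>\<in>\<Phi>. pointwise_scale scaleA (\<xi> (b \<phi>)) \<phi>) = 0"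
    by (intro ext) (simp add: sum_apply pointwise_scale_def)
  then show "\<xi> (b \<phi>) = 0" by (rule p.independentD[OF \<Phi>(2,1) order.refl _ \<phi>])
qed

lemma commuting_automorphism_finite_order:
  assumes lin: "linear_on scaleA scaleA UNIV \<zeta>" and bij: "bij \<zeta>"
    and mult: "\<And>a b. \<zeta> (a * b) = \<zeta> a * \<zeta> b" and comm: "\<And>h a. \<zeta> (h \<cdot> a) = h \<cdot> \<zeta> a"
  shows "\<exists>m>0. \<zeta> ^^ m = id"
proof -
  interpret p: vector_space "pointwise_scale scaleA :: 'k \<Rightarrow> ('a \<Rightarrow> 'a) \<Rightarrow> _"
    by (rule vector_space_pointwise[OF A.vector_space_axioms])
  obtain B where B: "finite B" "A.span B = UNIV" using finite_dim_A by blast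
  obtain F where F: "finite F" and F_span: "\<And>f. linear_on scaleA scaleA UNIV f \<Longrightarrow> f \<in> p.span F"
    using finite_span_linear_maps[OF A.vector_space_axioms A.vector_space_axioms B B] by blast
  have "\<exists>i j. i < j \<and> \<zeta> ^^ i = \<zeta> ^^ j"
  proof (rule multiplicative_sequence_repeats[OF A.vector_space_axioms, where m = "(*)" and F = F])
    show "(\<zeta> ^^ n) (a * b) = (\<zeta> ^^ n) a * (\<zeta> ^^ n) b" for n a b
      by (induction n) (simp_all add: mult)
    show "\<zeta> ^^ n \<noteq> 0" for n
    proof
      assume "\<zeta> ^^ n = 0"
      moreover have "surj (\<zeta> ^^ n)" using bij by (simp add: bij_fn bij_is_surj)
      ultimately have "1 = (0 :: 'a)" by (metis surjD zero_fun_apply)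
      then show False using A.unit_nonzero by simp
    qed
    have "linear_on scaleA scaleA UNIV (\<zeta> ^^ n)" for n
      using lin by (induction n) (simp_all add: linear_on_def)
    then show "range (\<lambda>n. \<zeta> ^^ n) \<subseteq> p.span F" using F_span by auto
    show "finite F" by (rule F)
    show "scaleA c a * b = scaleA c (a * b)" "a * scaleA c b = scaleA c (a * b)" for c a b
      by (rule scaleA_mult)+
    have pow_comm: "(\<zeta> ^^ n) (h \<cdot> a) = h \<cdot> (\<zeta> ^^ n) a" for n h a
      by (induction n) (simp_all add: comm)
    fix \<Phi> b \<phi>
    assume \<Phi>: "\<Phi> \<subseteq> range (\<lambda>n. \<zeta> ^^ n)" "finite \<Phi>" "p.independent \<Phi>"
      and zero: "\<And>y. (\<Sum>\<phi>\<in>\<Phi>. b \<phi> * \<phi> y) = 0" and \<phi>: "\<phi> \<in> \<Phi>"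
    show "b \<phi> = 0"
      by (rule commuting_maps_independent_over_A[OF \<Phi>(2,3) _ zero \<phi>]) (use \<Phi>(1) pow_comm in auto)
  qed
  then obtain i j where "i < j" "\<zeta> ^^ i = \<zeta> ^^ j" by blast
  then show ?thesis using bij_funpow_repeat[OF bij] by (intro exI[of _ "j - i"]) simp
qed

text \<open>
  By \<open>\<theta>_act\<close> and Radford's formula, a power of \<open>\<theta>\<close> commutes with \<open>H\<close> once \<open>\<omega>\<close> and \<open>g\<close> are raised to a
  common multiple of their orders.
\<close>

lemma \<theta>_finite_order: "\<exists>n>0. \<theta> ^^ n = id"
proof -
  obtain m1 where m1: "m1 > 0" "\<omega> ^^ m1 = id" using \<omega>_finite_order by blast
  obtain m2 where m2: "m2 > 0" "gl ^ m2 = 1" using gl_finite_order by blast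
  let ?m = "m1 * m2"
  have "\<omega> ^^ ?m = id" by (simp add: funpow_mult[symmetric] m1(2))
  moreover have "gl ^ ?m = 1" by (subst mult.commute) (simp add: power_mult m2(2))
  ultimately have \<sigma>_order: "((\<sigma> ^^ 4) ^^ ?m) h = h" for h
    using \<omega>_power_gl[of ?m h] by simp
  have \<theta>2: "(\<theta> ^^ 2) (h \<cdot> a) = (\<sigma> ^^ 4) h \<cdot> (\<theta> ^^ 2) a" for h a
    by (simp add: numeral_eq_Suc \<theta>_act)
  have "((\<theta> ^^ 2) ^^ n) (h \<cdot> a) = ((\<sigma> ^^ 4) ^^ n) h \<cdot> ((\<theta> ^^ 2) ^^ n) a" for n h a
    by (induction n) (simp_all only: funpow.simps id_apply o_apply \<theta>2)
  then have "((\<theta> ^^ 2) ^^ ?m) (h \<cdot> a) = h \<cdot> ((\<theta> ^^ 2) ^^ ?m) a" for h a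
    by (simp only: \<sigma>_order)
  then have comm: "(\<theta> ^^ (2 * ?m)) (h \<cdot> a) = h \<cdot> (\<theta> ^^ (2 * ?m)) a" for h a
    by (simp only: funpow_mult)
  have "linear_on scaleA scaleA UNIV (\<theta> ^^ n)" for n
    using \<theta>_linear by (induction n) (simp_all add: linear_on_def)
  moreover have "(\<theta> ^^ n) (a * b) = (\<theta> ^^ n) a * (\<theta> ^^ n) b" for n a b
    by (induction n) (simp_all add: \<theta>_mult)
  moreover have "bij (\<theta> ^^ n)" for n using \<theta>_bij by (rule bij_fn)
  ultimately obtain k where "k > 0" "(\<theta> ^^ (2 * ?m)) ^^ k = id"
    using commuting_automorphism_finite_order comm by metis
  then have "\<theta> ^^ (2 * ?m * k) = id" "2 * ?m * k > 0" using m1 m2 by (simp_all add: funpow_mult)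
  then show ?thesis by blast
qed

end

theorem proposition3p4:
  fixes scaleH :: "'k::field \<Rightarrow> 'h::ring_1 \<Rightarrow> 'h"
    and \<Delta> :: "'h \<Rightarrow> ('h, 'h, 'k) tensor" and \<epsilon> :: "'h \<Rightarrow> 'k" and S :: "'h \<Rightarrow> 'h"
    and scaleA :: "'k \<Rightarrow> 'a::ring_1 \<Rightarrow> 'a" and act :: "'h \<Rightarrow> 'a \<Rightarrow> 'a"
    and E :: "('a \<Rightarrow> 'a) set"
    and \<Delta>E :: "('a \<Rightarrow> 'a) \<Rightarrow> ('a \<Rightarrow> 'a, 'a \<Rightarrow> 'a, 'k) tensor"
    and \<epsilon>E :: "('a \<Rightarrow> 'a) \<Rightarrow> 'k" and SE :: "('a \<Rightarrow> 'a) \<Rightarrow> ('a \<Rightarrow> 'a)"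
    and x :: 'h and \<alpha> :: "'h \<Rightarrow> 'k" and \<chi> :: "'a \<Rightarrow> 'k"
  assumes A: "dual_galois_module_algebra scaleH UNIV (*) 1 \<Delta> \<epsilon> S scaleA act"
    and E: "E = module_Endo scaleA UNIV act"
    and Hopf_E: "module_algebra (pointwise_scale scaleA) E (\<circ>) id \<Delta>E \<epsilon>E SE scaleA (\<lambda>\<phi> a. \<phi> a)"
    and x: "left_integral scaleH UNIV (*) \<epsilon> x"
    and \<alpha>: "modular_function scaleH UNIV (*) 1 x \<alpha>"
    and \<chi>: "\<chi> = integral_functional scaleA act x"
  shows "(\<forall>a. act x a = scaleA (\<chi> a) 1) \<and> Vector_Spaces.linear scaleA (*) \<chi> \<and>
    (\<forall>\<phi>\<in>E. \<forall>a. \<chi> (\<phi> a) = \<epsilon>E \<phi> * \<chi> a) \<and>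
    (\<forall>h a. \<chi> (act h a) = \<alpha> h * \<chi> a) \<and>
    (\<exists>\<theta>. algebra_automorphism scaleA \<theta> \<and> (\<exists>n>0. \<theta> ^^ n = id) \<and>
      (\<forall>a b. \<chi> (b * a) = \<chi> (a * \<theta> b)) \<and>
      (\<forall>\<phi>\<in>E. \<theta> \<circ> \<phi> \<circ> inv \<theta> = SE (SE \<phi>)) \<and>
      (\<forall>h. \<theta> \<circ> act h \<circ> inv \<theta>
        = act (S (S (hit_right scaleH UNIV \<Delta> (hit_left scaleH UNIV \<Delta> (\<alpha> \<circ> S) h) \<alpha>)))))"
proof -
  interpret G: dual_galois_with_integral scaleH \<Delta> \<epsilon> S scaleA act x \<alpha>
    by (rule dual_galois_with_integral.intro[OF A dual_galois_with_integral_axioms.intro[OF x \<alpha>]])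
  interpret E: module_algebra "pointwise_scale scaleA" E "(\<circ>)" id \<Delta>E \<epsilon>E SE scaleA "\<lambda>\<phi> a. \<phi> a"
    by (rule Hopf_E)
  have [simp]: "\<chi> = G.\<chi>" by (simp add: \<chi> G.\<chi>_def)
  let ?\<theta> = "G.\<theta>"
  have lin: "linear_on scaleA s UNIV f \<longleftrightarrow> Vector_Spaces.linear scaleA s f" if "vector_space s"
    for s and f :: "'a \<Rightarrow> 'z::ab_group_add"
    by (rule linear_on_UNIV_iff[OF G.A.vector_space_axioms that])
  have \<chi>_linear: "Vector_Spaces.linear scaleA (*) G.\<chi>"
    using lin[OF vector_space_field] by (metis G.\<chi>_add G.\<chi>_scale linear_onI)
  have E_lin: "\<phi> (a + b) = \<phi> a + \<phi> b" "\<phi> (scaleA c a) = scaleA c (\<phi> a)" if "\<phi> \<in> E" for \<phi> a b c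
    using E.act_linear[OF that] by auto
  have E_comm: "\<phi> (act h a) = act h (\<phi> a)" if "\<phi> \<in> E" for \<phi> h a
    using that by (simp add: E module_Endo_def)
  have \<chi>_E: "G.\<chi> (\<phi> a) = \<epsilon>E \<phi> * G.\<chi> a" if \<phi>: "\<phi> \<in> E" for \<phi> a
  proof -
    have "scaleA (G.\<chi> (\<phi> a)) 1 = \<phi> (scaleA (G.\<chi> a) 1)"
      by (simp add: G.x_act[symmetric] E_comm[OF \<phi>])
    also have "\<dots> = scaleA (\<epsilon>E \<phi> * G.\<chi> a) 1"
      by (simp add: E_lin[OF \<phi>] E.act_one[OF \<phi>] mult.commute)
    finally show ?thesis by (simp only: G.scaleA_one_inject)
  qed
  have \<chi>_E_transfer: "G.\<chi> (\<phi> b * a) = G.\<chi> (b * SE \<phi> a)" if \<phi>: "\<phi> \<in> E" for \<phi> a b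
  proof -
    have "G.\<chi> (\<phi> b * a) = E.sw (\<lambda>u v. G.\<chi> (u (b * SE v a))) \<phi>"
      unfolding E.act_times_transfer[OF \<phi>] by (rule E.sw_push) (rule G.\<chi>_add)
    also have "\<dots> = E.sw (\<lambda>u v. \<epsilon>E u * G.\<chi> (b * SE v a)) \<phi>"
      by (rule E.sw_cong[OF refl \<phi>]) (rule \<chi>_E)
    also have "\<dots> = G.\<chi> (b * SE \<phi> a)"
    proof (rule E.sw_counit_left[OF vector_space_field _ \<phi>], rule linear_onI)
      show "G.\<chi> (b * SE (\<phi> + \<phi>') a) = G.\<chi> (b * SE \<phi> a) + G.\<chi> (b * SE \<phi>' a)"
        if "\<phi> \<in> E" "\<phi>' \<in> E" for \<phi> \<phi>'
        by (simp add: E.S_linear(1)[OF that] distrib_left G.\<chi>_add)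
      show "G.\<chi> (b * SE (pointwise_scale scaleA c \<phi>) a) = c * G.\<chi> (b * SE \<phi> a)"
        if "\<phi> \<in> E" for \<phi> c
        unfolding E.S_linear(2)[OF that] unfolding pointwise_scale_def G.scaleA_mult G.\<chi>_scale ..
    qed
    finally show ?thesis .
  qed
  have \<theta>_E: "?\<theta> (\<phi> b) = SE (SE \<phi>) (?\<theta> b)" if \<phi>: "\<phi> \<in> E" for \<phi> b
  proof (rule G.\<chi>_inject_right)
    fix a
    have "G.\<chi> (a * ?\<theta> (\<phi> b)) = G.\<chi> (b * SE \<phi> a)"
      by (simp add: G.\<chi>_\<theta>[symmetric] \<chi>_E_transfer[OF \<phi>])
    also have "\<dots> = G.\<chi> (a * SE (SE \<phi>) (?\<theta> b))"
      by (subst G.\<chi>_\<theta>) (rule \<chi>_E_transfer[OF E.antipode_closed[OF \<phi>]])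
    finally show "G.\<chi> (a * ?\<theta> (\<phi> b)) = G.\<chi> (a * SE (SE \<phi>) (?\<theta> b))" .
  qed
  have inv: "?\<theta> (inv ?\<theta> a) = a" for a using G.\<theta>_bij by (simp add: bij_is_surj surj_f_inv_f)
  have auto: "algebra_automorphism scaleA ?\<theta>"
    using G.\<theta>_linear lin[OF G.A.vector_space_axioms] G.\<theta>_bij G.\<theta>_mult G.\<theta>_one
    by (simp add: algebra_automorphism_def)
  have "?\<theta> \<circ> \<phi> \<circ> inv ?\<theta> = SE (SE \<phi>)" if "\<phi> \<in> E" for \<phi>
    using \<theta>_E[OF that] by (simp add: fun_eq_iff inv)
  moreover have "?\<theta> \<circ> act h \<circ> inv ?\<theta>
      = act (S (S (hit_right scaleH UNIV \<Delta> (hit_left scaleH UNIV \<Delta> (\<alpha> \<circ> S) h) \<alpha>)))" for h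
    by (simp add: fun_eq_iff G.\<theta>_act inv G.\<sigma>_\<sigma> G.\<omega>_eq_hits)
  ultimately show ?thesis
    using G.x_act \<chi>_linear \<chi>_E G.\<chi>_act auto G.\<theta>_finite_order G.\<chi>_\<theta> by auto
qed

end
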